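(* Let $r>0$ and let $n\ge0$ be an integer. Consider the LWR data on $\mathbb C$: $$\xi=\begin{pmatrix}0&rz^n\\ \lambda&0\end{pmatrix}dz,\qquad\Phi(0)=\mathrm I,\qquad(\lambda_0,\lambda_1)=\begin{cases}(0,1)&\text{in }\mathbb E^3,\\(1,0)&\text{in }\mathbb H^3.\end{cases}$$ This data induces an Enneper surface. Moreover, any Enneper surface in $\mathbb E^3$ or $\mathbb H^3$ can be obtained this way for some $r>0$ and $n\ge 0$, up to an isometry and a coordinate change.
   Context: Ambient spaces. $\mathcal H_2$: $2\times2$ Hermitian matrices with $\langle x,y\rangle=-\frac12\operatorname{tr}(x\widehat y)$ ($\widehat y$ the adjugate), extended complex-bilinearly. $\mathbb H^3=\{x\in\mathcal H_2:\det x=1,\operatorname{tr}x>0\}$; $\mathbb E^3=T_{\mathrm I}\mathbb H^3$ = trace-free Hermitian matrices, oriented so that $(x,y,-\frac i2[x,y])$ is positive; the orientation is transported to $\mathbb H^3$ by $x\mapsto VxV^*$, $V\in \mathrm{SL}_2\mathbb C$. For a conformal immersion $f$: metric $ds^2=2\langle f_z,f_{\bar z}\rangle|dz|^2$, unit normal $N$ with $(f_x,f_y,N)$ positively oriented orthogonal, Hopf differential $Q\,dz^2$ and mean curvature $H$ defined by $-\langle df,dN\rangle=Q\,dz^2+H\,ds^2+\bar Q\,d\bar z^2$; minimal: $H\equiv 0$ in $\mathbb E^3$; CMC 1: $H\equiv1$ in $\mathbb H^3$; flat: $Q\equiv0$. Given LWR data, $\Phi_\lambda$ is the $\mathrm{SL}_2\mathbb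 C$-valued solution of $\Phi^{-1}d\Phi=\xi$ with the given initial value, for all $\lambda\in\mathbb C$; the induced immersions are $f^{\mathbb E}=\psi+\psi^*$ with $\psi=(\lambda_1-\lambda_0)(\dot\Phi\Phi^{-1})_{\lambda_0}$ (dot $=\partial_\lambda$) and $f^{\mathbb H}=\Psi^*\Psi$ with $\Psi=\Phi_{\lambda_1}\Phi_{\lambda_0}^{-1}$. An immersion $f$ of the universal cover $\widetilde{\mathbb C^*}$ of $\mathbb C^*$ into $\mathbb E^3$ or $\mathbb H^3$ is an intrinsic surface of revolution if its metric is $ds^2=m^2|dz|^2$ with $m>0$ a function depending only on $|z|$. An Enneper surface is a minimal (in $\mathbb E^3$) or CMC 1 (in $\mathbb H^3$) immersion which is a non-flat intrinsic surface of revolution that descends from $\widetilde{\mathbb C^*}$ to $\mathbb{C}^*$ and extends to a conformal immersion on $\mathbb C$. *)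

theory Defs
  imports "HOL-Analysis.Analysis"
begin

type_synonym cmat2 = "complex^2^2"

definition cscale :: "complex \<Rightarrow> cmat2 \<Rightarrow> cmat2" where
  "cscale c A = (\<chi> i j. c * A $ i $ j)"

definition ctransp :: "cmat2 \<Rightarrow> cmat2" where
  "ctransp A = (\<chi> i j. cnj (A $ j $ i))"

definition adjugate2 :: "cmat2 \<Rightarrow> cmat2" where
  "adjugate2 A = vector [vector [A $ 2 $ 2, - A $ 1 $ 2], vector [- A $ 2 $ 1, A $ 1 $ 1]]"

definition hermitian :: "cmat2 \<Rightarrow> bool" where
  "hermitian A \<longleftrightarrow> ctransp A = A"

definition herm_form :: "cmat2 \<Rightarrow> cmat2 \<Rightarrow> complex" where
  "herm_form x y = - (1/2) * trace (x ** adjugate2 y)"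

text \<open>The two ambient spaces: Euclidean 3-space (trace-free Hermitian matrices) and
  hyperbolic 3-space (a sheet of the hyperboloid in the Hermitian matrices).\<close>

datatype ambient = Euc3 | Hyp3

fun space_of :: "ambient \<Rightarrow> cmat2 set" where
  "space_of Euc3 = {x. hermitian x \<and> trace x = 0}"
| "space_of Hyp3 = {x. hermitian x \<and> det x = 1 \<and> Re (trace x) > 0}"

text \<open>The orientation of \<open>Euc3\<close> makes \<open>(a, b, n)\<close> with \<open>n = -(i/2)[a,b]\<close> positive for
  linearly independent \<open>a\<close>, \<open>b\<close>. As \<open>n\<close> is orthogonal to \<open>a\<close> and \<open>b\<close>, a triple \<open>(a, b, c)\<close>
  is a positive basis iff \<open>\<langle>n, c\<rangle> > 0\<close>. The form is real on Hermitian matrices.\<close>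

definition positive_basis_E :: "cmat2 \<Rightarrow> cmat2 \<Rightarrow> cmat2 \<Rightarrow> bool" where
  "positive_basis_E a b c \<longleftrightarrow>
     a \<in> space_of Euc3 \<and> b \<in> space_of Euc3 \<and> c \<in> space_of Euc3 \<and>
     Re (herm_form (cscale (- \<i> / 2) (a ** b - b ** a)) c) > 0"

text \<open>Positive basis of the tangent space at \<open>p\<close>. The tangent space of \<open>Hyp3\<close> at the identity is
  \<open>Euc3\<close>; tangent space and orientation at \<open>p = V V\<^sup>*\<close> are transported by \<open>x \<mapsto> V x V\<^sup>*\<close>.\<close>

fun positive_basis :: "ambient \<Rightarrow> cmat2 \<Rightarrow> cmat2 \<Rightarrow> cmat2 \<Rightarrow> cmat2 \<Rightarrow> bool" where
  "positive_basis Euc3 p a b c \<longleftrightarrow> positive_basis_E a b c"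
| "positive_basis Hyp3 p a b c \<longleftrightarrow>
     (\<exists>V a' b' c'. det V = 1 \<and> p = V ** ctransp V \<and>
        a = V ** a' ** ctransp V \<and> b = V ** b' ** ctransp V \<and> c = V ** c' ** ctransp V \<and>
        positive_basis_E a' b' c')"

fun ambient_dist :: "ambient \<Rightarrow> cmat2 \<Rightarrow> cmat2 \<Rightarrow> real" where
  "ambient_dist Euc3 x y = sqrt (Re (herm_form (x - y) (x - y)))"
| "ambient_dist Hyp3 x y = arcosh (- Re (herm_form x y))"

definition ambient_isometry :: "ambient \<Rightarrow> (cmat2 \<Rightarrow> cmat2) \<Rightarrow> bool" where
  "ambient_isometry sp T \<longleftrightarrow> bij_betw T (space_of sp) (space_of sp) \<and>
     (\<forall>x\<in>space_of sp. \<forall>y\<in>space_of sp. ambient_dist sp (T x) (T y) = ambient_dist sp x y)"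

primrec times_cont_diff :: "nat \<Rightarrow> ('a::real_normed_vector \<Rightarrow> 'b::real_normed_vector) \<Rightarrow> bool" where
  "times_cont_diff 0 f \<longleftrightarrow> continuous_on UNIV f"
| "times_cont_diff (Suc k) f \<longleftrightarrow>
     (\<forall>x. f differentiable (at x)) \<and> (\<forall>v. times_cont_diff k (\<lambda>x. frechet_derivative f (at x) v))"

definition smooth :: "('a::real_normed_vector \<Rightarrow> 'b::real_normed_vector) \<Rightarrow> bool" where
  "smooth f \<longleftrightarrow> (\<forall>k. times_cont_diff k f)"

text \<open>All surfaces below are parametrised by the whole complex plane: it serves both as the
  domain \<open>\<complex>\<close> itself and, via \<open>exp\<close>, as the universal cover of the punctured plane.\<close>

definition diff_x :: "(complex \<Rightarrow> cmat2) \<Rightarrow> complex \<Rightarrow> cmat2" where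
  "diff_x f z = frechet_derivative f (at z) 1"

definition diff_y :: "(complex \<Rightarrow> cmat2) \<Rightarrow> complex \<Rightarrow> cmat2" where
  "diff_y f z = frechet_derivative f (at z) \<i>"

definition diff_z :: "(complex \<Rightarrow> cmat2) \<Rightarrow> complex \<Rightarrow> cmat2" where
  "diff_z f z = cscale (1/2) (diff_x f z - cscale \<i> (diff_y f z))"

definition diff_zbar :: "(complex \<Rightarrow> cmat2) \<Rightarrow> complex \<Rightarrow> cmat2" where
  "diff_zbar f z = cscale (1/2) (diff_x f z + cscale \<i> (diff_y f z))"

definition conformal_immersion :: "ambient \<Rightarrow> (complex \<Rightarrow> cmat2) \<Rightarrow> bool" where
  "conformal_immersion sp f \<longleftrightarrow>
     range f \<subseteq> space_of sp \<and> smooth f \<and>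
     (\<forall>z. inj (frechet_derivative f (at z)) \<and> herm_form (diff_z f z) (diff_z f z) = 0)"

text \<open>The metric is \<open>ds\<^sup>2 = metric_coeff f z |dz|\<^sup>2\<close>.\<close>

definition metric_coeff :: "(complex \<Rightarrow> cmat2) \<Rightarrow> complex \<Rightarrow> complex" where
  "metric_coeff f z = 2 * herm_form (diff_z f z) (diff_zbar f z)"

definition unit_normal :: "ambient \<Rightarrow> (complex \<Rightarrow> cmat2) \<Rightarrow> complex \<Rightarrow> cmat2" where
  "unit_normal sp f z = (THE N. herm_form N N = 1 \<and>
     herm_form (diff_x f z) N = 0 \<and> herm_form (diff_y f z) N = 0 \<and>
     positive_basis sp (f z) (diff_x f z) (diff_y f z) N)"

text \<open>\<open>Q\<close> and \<open>H\<close> are the Hopf coefficient and the mean curvature at \<open>z\<close>, i.e.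
  \<open>-\<langle>df, dN\<rangle> = Q dz\<^sup>2 + H ds\<^sup>2 + cnj Q d(cnj z)\<^sup>2\<close>, both sides read as quadratic forms in \<open>h\<close>.\<close>

definition hopf_mean_curvature ::
    "ambient \<Rightarrow> (complex \<Rightarrow> cmat2) \<Rightarrow> complex \<Rightarrow> complex \<Rightarrow> real \<Rightarrow> bool" where
  "hopf_mean_curvature sp f z Q H \<longleftrightarrow>
     (\<forall>h. - herm_form (frechet_derivative f (at z) h)
                      (frechet_derivative (unit_normal sp f) (at z) h) =
          Q * h\<^sup>2 + of_real H * (metric_coeff f z * of_real ((cmod h)\<^sup>2)) + cnj Q * (cnj h)\<^sup>2)"

text \<open>Minimal in \<open>Euc3\<close>, CMC 1 in \<open>Hyp3\<close>.\<close>

definition has_ambient_cmc :: "ambient \<Rightarrow> (complex \<Rightarrow> cmat2) \<Rightarrow> bool" where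
  "has_ambient_cmc sp f \<longleftrightarrow>
     (\<forall>z. \<exists>Q. hopf_mean_curvature sp f z Q (case sp of Euc3 \<Rightarrow> 0 | Hyp3 \<Rightarrow> 1))"

definition flat :: "ambient \<Rightarrow> (complex \<Rightarrow> cmat2) \<Rightarrow> bool" where
  "flat sp f \<longleftrightarrow> (\<forall>z. \<exists>H. hopf_mean_curvature sp f z 0 H)"

text \<open>Here \<open>F\<close> is an immersion of the universal cover \<open>exp : \<complex> \<rightarrow> \<complex>\<^sup>*\<close>; in terms of \<open>z = exp w\<close>
  the metric \<open>m(|z|)\<^sup>2 |dz|\<^sup>2\<close> is \<open>m(|exp w|)\<^sup>2 |exp w|\<^sup>2 |dw|\<^sup>2\<close>.\<close>

definition intrinsic_surface_of_revolution :: "ambient \<Rightarrow> (complex \<Rightarrow> cmat2) \<Rightarrow> bool" where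
  "intrinsic_surface_of_revolution sp F \<longleftrightarrow>
     conformal_immersion sp F \<and>
     (\<exists>m :: real \<Rightarrow> real. \<forall>w. m (cmod (exp w)) > 0 \<and>
        metric_coeff F w = of_real ((m (cmod (exp w)))\<^sup>2 * (cmod (exp w))\<^sup>2))"

text \<open>An Enneper surface, given by its extension \<open>g\<close> to \<open>\<complex>\<close>: the immersion of the universal cover
  which descends to \<open>\<complex>\<^sup>*\<close> and extends to \<open>g\<close> is \<open>g \<circ> exp\<close>.\<close>

definition enneper_surface :: "ambient \<Rightarrow> (complex \<Rightarrow> cmat2) \<Rightarrow> bool" where
  "enneper_surface sp g \<longleftrightarrow>
     conformal_immersion sp g \<and>
     intrinsic_surface_of_revolution sp (g \<circ> exp) \<and>
     has_ambient_cmc sp (g \<circ> exp) \<and> \<not> flat sp (g \<circ> exp)"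

text \<open>\<open>\<Phi> l\<close> is the frame with spectral parameter \<open>l\<close>, and the matrix \<open>\<xi> l z\<close> is the coefficient
  of \<open>dz\<close> in the potential.\<close>

definition is_lwr_frame ::
    "(complex \<Rightarrow> complex \<Rightarrow> cmat2) \<Rightarrow> complex \<Rightarrow> cmat2 \<Rightarrow> (complex \<Rightarrow> complex \<Rightarrow> cmat2) \<Rightarrow> bool" where
  "is_lwr_frame \<xi> z0 A \<Phi> \<longleftrightarrow>
     (\<forall>l. \<Phi> l z0 = A \<and>
        (\<forall>z. det (\<Phi> l z) = 1 \<and>
           (\<exists>D. (\<Phi> l has_derivative D) (at z) \<and>
                (\<forall>h. matrix_inv (\<Phi> l z) ** D h = cscale h (\<xi> l z)))))"

definition lwr_frame ::
    "(complex \<Rightarrow> complex \<Rightarrow> cmat2) \<Rightarrow> complex \<Rightarrow> cmat2 \<Rightarrow> complex \<Rightarrow> complex \<Rightarrow> cmat2" where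
  "lwr_frame \<xi> z0 A = (THE \<Phi>. is_lwr_frame \<xi> z0 A \<Phi>)"

fun induced_immersion ::
    "ambient \<Rightarrow> complex \<Rightarrow> complex \<Rightarrow> (complex \<Rightarrow> complex \<Rightarrow> cmat2) \<Rightarrow> complex \<Rightarrow> cmat2" where
  "induced_immersion Euc3 l0 l1 \<Phi> z =
     (let \<Phi>dot = (\<chi> i j. deriv (\<lambda>l. \<Phi> l z $ i $ j) l0);
          \<psi> = cscale (l1 - l0) (\<Phi>dot ** matrix_inv (\<Phi> l0 z))
      in \<psi> + ctransp \<psi>)"
| "induced_immersion Hyp3 l0 l1 \<Phi> z =
     (let \<Psi> = \<Phi> l1 z ** matrix_inv (\<Phi> l0 z) in ctransp \<Psi> ** \<Psi>)"

definition enneper_potential :: "real \<Rightarrow> nat \<Rightarrow> complex \<Rightarrow> complex \<Rightarrow> cmat2" where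
  "enneper_potential r n l z = vector [vector [0, of_real r * z ^ n], vector [l, 0]]"

definition enneper_lwr :: "ambient \<Rightarrow> real \<Rightarrow> nat \<Rightarrow> complex \<Rightarrow> cmat2" where
  "enneper_lwr sp r n =
     (case sp of Euc3 \<Rightarrow> induced_immersion sp 0 1 | Hyp3 \<Rightarrow> induced_immersion sp 1 0)
       (lwr_frame (enneper_potential r n) 0 (mat 1))"

end

theory Submission
  imports Defs "HOL-Complex_Analysis.Complex_Analysis"
begin

text \<open>
  Both geometries are treated at once through holomorphic data (\<open>hol_data\<close>). A surface \<open>f\<close> has data
  \<open>(X, \<Psi>)\<close> if \<open>X\<close> is an entire, nowhere vanishing, nilpotent matrix function, \<open>det \<Psi> = 1\<close>,
  \<open>\<Psi>\<^sub>z = H X \<Psi>\<close> and \<open>f\<^sub>z = \<Psi>\<^sup>* X \<Psi>\<close>, where \<open>H\<close> is 0 in Euclidean and 1 in hyperbolic space; the inverse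
  of the base point is \<open>P = (\<Psi>\<^sup>* \<Psi>)\<^sup>-\<^sup>1\<close>. Data determine a conformal immersion with metric
  \<open>tr(X X\<^sup>*) |dz|\<^sup>2\<close>, mean curvature \<open>H\<close>, and a Hopf differential that can be read off from \<open>X\<close> and \<open>X\<^sub>z\<close>
  (\<open>hol_data_conformal_immersion\<close>, \<open>hol_data_metric\<close>, \<open>hol_data_hopf\<close>).

  The frame of the LWR data can be written with hypergeometric functions of \<open>\<lambda> z\<^sup>n\<^sup>+\<^sup>2\<close>, and the induced
  surfaces have data \<open>X = \<plusminus> (b, -b\<^sup>2; 1, -b)\<close> with \<open>b = r z\<^sup>n\<^sup>+\<^sup>1 / (n + 1)\<close> (\<open>hol_data_enneper\<close>). The metric
  \<open>(1 + |b|\<^sup>2)\<^sup>2 |dz|\<^sup>2\<close> is radial and the Hopf differential is a nonzero multiple of \<open>z\<^sup>n dz\<^sup>2\<close>, so these are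
  Enneper surfaces.

  Conversely, the curvature condition on \<open>f\<close> is the equation \<open>\<partial> f\<^sub>z / \<partial> cnj z = H (f\<^sub>z)\<^sup>* P f\<^sub>z\<close>
  (\<open>cmc_equation\<close>), which says that \<open>P f\<^sub>z\<close> is holomorphic. For an Enneper surface it extends over
  the origin, and integrating a linear differential equation produces data (\<open>hol_data_exists\<close>). The
  norm of \<open>X\<close> is then radial. A reflection argument shows that \<open>tr(X(z) X(0)\<^sup>*)\<close> is constant
  (\<open>radial_sum_const\<close>); after a unitary conjugation one off-diagonal entry of \<open>X\<close> is therefore a
  constant \<open>s\<close>, the diagonal entry is a monomial \<open>p\<close>, and the remaining entry is \<open>-p\<^sup>2/s\<close>. Up to a linear
  change of \<open>z\<close> and a further unitary conjugation this is the matrix of the preceding paragraph, and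
  surfaces whose data are related in this way are congruent (\<open>hol_data_congruent\<close>).
\<close>

no_notation fps_nth (infixl \<open>$\<close> 75)

section \<open>Matrices of size two and the Hermitian form\<close>

definition mk2 :: "complex \<Rightarrow> complex \<Rightarrow> complex \<Rightarrow> complex \<Rightarrow> cmat2" where
  "mk2 a b c d = vector [vector [a, b], vector [c, d]]"

lemma mk2_nth [simp]:
  "mk2 a b c d $ 1 $ 1 = a" "mk2 a b c d $ 1 $ 2 = b"
  "mk2 a b c d $ 2 $ 1 = c" "mk2 a b c d $ 2 $ 2 = d"
  by (simp_all add: mk2_def)

lemma cmat2_eq_iff:
  "A = B \<longleftrightarrow> A $ 1 $ 1 = B $ 1 $ 1 \<and> A $ 1 $ 2 = B $ 1 $ 2 \<and> A $ 2 $ 1 = B $ 2 $ 1 \<and> A $ 2 $ 2 = B $ 2 $ 2"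
  for A B :: cmat2
  by (auto simp: vec_eq_iff forall_2)

lemma mult_nth: "(A ** B) $ i $ j = A $ i $ 1 * B $ 1 $ j + A $ i $ 2 * B $ 2 $ j" for A B :: cmat2
  by (simp add: matrix_matrix_mult_def sum_2)

lemma cscale_nth: "cscale c A $ i $ j = c * A $ i $ j"
  by (simp add: cscale_def)

lemma ctransp_nth: "ctransp A $ i $ j = cnj (A $ j $ i)"
  by (simp add: ctransp_def)

lemma adjugate2_nth:
  "adjugate2 A $ 1 $ 1 = A $ 2 $ 2" "adjugate2 A $ 1 $ 2 = - A $ 1 $ 2"
  "adjugate2 A $ 2 $ 1 = - A $ 2 $ 1" "adjugate2 A $ 2 $ 2 = A $ 1 $ 1"
  by (simp_all add: adjugate2_def)

lemma trace_2: "trace A = A $ 1 $ 1 + A $ 2 $ 2" for A :: cmat2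
  by (simp add: trace_def sum_2)

lemma mat_1_nth:
  "(mat 1 :: cmat2) $ 1 $ 1 = 1" "(mat 1 :: cmat2) $ 1 $ 2 = 0"
  "(mat 1 :: cmat2) $ 2 $ 1 = 0" "(mat 1 :: cmat2) $ 2 $ 2 = 1"
  by (simp_all add: mat_def)

lemma herm_form_nth:
  "herm_form x y = - (1/2) * (x $ 1 $ 1 * y $ 2 $ 2 + x $ 2 $ 2 * y $ 1 $ 1 - x $ 1 $ 2 * y $ 2 $ 1 - x $ 2 $ 1 * y $ 1 $ 2)"
  by (simp add: herm_form_def trace_2 mult_nth adjugate2_nth algebra_simps)

text \<open>Rewriting with these rules turns an identity between \<open>2 \<times> 2\<close> matrices into polynomial identities
between their entries.\<close>

lemmas entries = cmat2_eq_iff mult_nth cscale_nth ctransp_nth adjugate2_nth trace_2 det_2 mat_1_nth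
  herm_form_nth

lemma ctransp_mult: "ctransp (A ** B) = ctransp B ** ctransp A"
  by (simp add: entries algebra_simps)
lemma ctransp_ctransp [simp]: "ctransp (ctransp A) = A"
  by (simp add: entries)
lemma ctransp_add: "ctransp (A + B) = ctransp A + ctransp B"
  by (simp add: entries)
lemma ctransp_diff: "ctransp (A - B) = ctransp A - ctransp B"
  by (simp add: entries)
lemma ctransp_cscale: "ctransp (cscale c A) = cscale (cnj c) (ctransp A)"
  by (simp add: entries)
lemma ctransp_mat1 [simp]: "ctransp (mat 1) = mat 1"
  by (simp add: entries)
lemma ctransp_mk2: "ctransp (mk2 a b c d) = mk2 (cnj a) (cnj c) (cnj b) (cnj d)"
  by (simp add: entries)
lemma det_ctransp [simp]: "det (ctransp A) = cnj (det A)" by (simp add: entries)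
lemma trace_ctransp [simp]: "trace (ctransp A) = cnj (trace A)" by (simp add: entries)

lemma adj_mult: "adjugate2 (A ** B) = adjugate2 B ** adjugate2 A"
  by (simp add: entries algebra_simps)
lemma adj_adj [simp]: "adjugate2 (adjugate2 A) = A"
  by (simp add: entries)
lemma adj_mat1 [simp]: "adjugate2 (mat 1) = mat 1"
  by (simp add: entries)
lemma adj_ctransp: "adjugate2 (ctransp A) = ctransp (adjugate2 A)"
  by (simp add: entries)
lemma det_adj [simp]: "det (adjugate2 A) = det A" by (simp add: entries mult.commute)

lemma adj_inverse:
  assumes "det A = 1"
  shows "A ** adjugate2 A = mat 1" "adjugate2 A ** A = mat 1"
  using assms by (simp_all add: entries algebra_simps)

lemma adj_cancel:
  assumes "det A = 1"
  shows "A ** (adjugate2 A ** B) = B" "adjugate2 A ** (A ** B) = B"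
  using adj_inverse[OF assms] by (simp_all add: matrix_mul_assoc)

lemma matrix_inv_eq_adj:
  assumes "det A = 1"
  shows "matrix_inv A = adjugate2 A"
proof -
  have inv: "A ** matrix_inv A = mat 1"
    unfolding matrix_inv_def by (rule someI2[of _ "adjugate2 A"]) (use adj_inverse[OF assms] in auto)
  have "adjugate2 A ** (A ** matrix_inv A) = matrix_inv A" by (rule adj_cancel[OF assms])
  then show ?thesis by (simp add: inv)
qed

lemma cscale_mult_left: "cscale c A ** B = cscale c (A ** B)"
  by (simp add: entries algebra_simps)
lemma cscale_mult_right: "A ** cscale c B = cscale c (A ** B)"
  by (simp add: entries algebra_simps)
lemma cscale_cscale: "cscale c (cscale d A) = cscale (c * d) A"
  by (simp add: entries)
lemma cscale_1 [simp]: "cscale 1 A = A" by (simp add: entries)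
lemma cscale_0 [simp]: "cscale 0 A = 0" "cscale c 0 = 0" by (simp_all add: entries)
lemma cscale_add_right: "cscale c (A + B) = cscale c A + cscale c B"
  by (simp add: entries algebra_simps)
lemma mat_distrib:
  "A ** (B + C) = A ** B + A ** C" "(B + C) ** A = B ** A + C ** A" for A B C :: cmat2
  by (simp_all add: entries algebra_simps)
lemma mat_mult_diff:
  "A ** (B - C) = A ** B - A ** C" "(B - C) ** A = B ** A - C ** A" for A B C :: cmat2
  by (simp_all add: entries algebra_simps)
lemma mat_mult_0 [simp]: "A ** (0::cmat2) = 0" "(0::cmat2) ** A = 0"
  by (simp_all add: entries)
lemma mat_mult_uminus: "A ** (- B) = - (A ** B)" "(- A) ** B = - (A ** B)" for A B :: cmat2
  by (simp_all add: entries)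

lemma herm_form_sym: "herm_form x y = herm_form y x"
  by (simp add: entries algebra_simps)
lemma herm_form_self: "herm_form x x = - det x"
  by (simp add: entries algebra_simps)
lemma herm_form_bilin:
  "herm_form (x + y) w = herm_form x w + herm_form y w"
  "herm_form w (x + y) = herm_form w x + herm_form w y"
  "herm_form (x - y) w = herm_form x w - herm_form y w"
  "herm_form w (x - y) = herm_form w x - herm_form w y"
  "herm_form (cscale c x) w = c * herm_form x w"
  "herm_form w (cscale c x) = c * herm_form w x"
  by (simp_all add: entries algebra_simps)
lemma herm_form_0 [simp]: "herm_form 0 w = 0" "herm_form w 0 = 0"
  by (simp_all add: entries)

lemma herm_form_congruence: "herm_form (A ** x ** B) (A ** y ** B) = det A * det B * herm_form x y"
  by (simp add: entries algebra_simps)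

lemma herm_form_transport:
  assumes "det V = 1"
  shows "herm_form (V ** x ** ctransp V) (V ** y ** ctransp V) = herm_form x y"
  by (simp add: herm_form_congruence assms)

lemma herm_form_mult_left_degenerate:
  assumes "det X = 0"
  shows "herm_form X (B ** X) = 0"
  using herm_form_congruence[of "mat 1" "mat 1" X B] assms by simp

lemma cnj_herm_form: "cnj (herm_form x y) = herm_form (ctransp x) (ctransp y)"
  by (simp add: entries algebra_simps)

lemma herm_form_mat1: "herm_form (mat 1) x = - (1/2) * trace x"
  by (simp add: entries)

lemma unitary_inverse:
  assumes "det U = 1" "U ** ctransp U = mat 1"
  shows "ctransp U = adjugate2 U" "ctransp U ** U = mat 1"
proof -
  have "adjugate2 U ** (U ** ctransp U) = adjugate2 U" using assms by simp
  then show *: "ctransp U = adjugate2 U" unfolding adj_cancel[OF assms(1)] .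
  show "ctransp U ** U = mat 1" unfolding * using adj_inverse assms by simp
qed

text \<open>Since \<open>det p = 1\<close>, the diagonal entries of a Hermitian \<open>p\<close> are real with positive product, so the
trace decides their sign. The factor is lower triangular with diagonal \<open>\<surd>p\<^sub>1\<^sub>1\<close>, \<open>1/\<surd>p\<^sub>1\<^sub>1\<close>.\<close>

lemma cholesky:
  assumes "p \<in> space_of Hyp3"
  obtains V where "det V = 1" "p = V ** ctransp V"
proof -
  have h: "cnj (p$1$1) = p$1$1" "cnj (p$2$2) = p$2$2" "cnj (p$1$2) = p$2$1" "cnj (p$2$1) = p$1$2"
    and d: "p$1$1 * p$2$2 - p$1$2 * p$2$1 = 1" and t: "Re (p$1$1) + Re (p$2$2) > 0"
    using assms by (auto simp: hermitian_def entries)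
  define a where "a = Re (p$1$1)"
  have a: "p$1$1 = of_real a" using h(1) by (simp add: a_def complex_eq_iff)
  define b where "b = Re (p$2$2)"
  have b: "p$2$2 = of_real b" using h(2) by (simp add: b_def complex_eq_iff)
  have "of_real (a * b - (cmod (p$1$2))\<^sup>2) = (1::complex)"
    using d a b h(3) by (simp add: complex_norm_square flip: of_real_power)
  then have ab: "a * b = 1 + (cmod (p$1$2))\<^sup>2" by (simp only: of_real_eq_1_iff)
  then have "a * b > 0" by (simp add: add_pos_nonneg)
  then have a0: "a > 0" using t unfolding a_def[symmetric] b_def[symmetric]
    by (auto simp: zero_less_mult_iff)
  define V where "V = mk2 (of_real (sqrt a)) 0 (p$2$1 / of_real (sqrt a)) (1 / of_real (sqrt a))"
  have sq: "complex_of_real (sqrt a) * complex_of_real (sqrt a) = of_real a"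
    using a0 by (simp flip: of_real_mult)
  have nz: "complex_of_real (sqrt a) \<noteq> 0" using a0 by simp
  have "det V = 1" using nz by (simp add: V_def entries)
  moreover have "p = V ** ctransp V"
  proof -
    have "p$2$2 * of_real a = p$2$1 * p$1$2 + 1" using d a by (simp add: algebra_simps)
    then have "p$2$2 = (p$2$1 * p$1$2 + 1) / of_real a" using a0 by (simp add: field_simps)
    then show ?thesis using nz a h
      by (simp add: V_def entries sq add_divide_distrib)
  qed
  ultimately show thesis using that by blast
qed

text \<open>Schur triangularisation of a nilpotent matrix: the second column of \<open>U\<close> is a unit vector in the
kernel of \<open>X\<close>, which makes the second column of \<open>U\<^sup>* X U\<close> vanish; the trace condition then removes
its upper left entry.\<close>

lemma nilpotent_schur:
  assumes "det X = 0" "trace X = 0" "X \<noteq> 0"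
  obtains U s where "det U = 1" "U ** ctransp U = mat 1" "s \<noteq> 0" "X = U ** mk2 0 0 s 0 ** ctransp U"
proof -
  define p q s where "p = X$1$1" "q = X$1$2" "s = X$2$1"
  have X22: "X$2$2 = - p" using assms(2) by (simp add: p_q_s_def entries add_eq_0_iff2)
  have dz: "p * p + q * s = 0" using assms(1) X22 unfolding p_q_s_def by (simp add: entries) algebra
  obtain k1 k2 where k: "p * k1 + q * k2 = 0" "s * k1 - p * k2 = 0" "k1 \<noteq> 0 \<or> k2 \<noteq> 0"
  proof (cases "s = 0 \<and> p = 0")
    case True
    then show thesis using that[of 1 0] by simp
  next
    case False
    then show thesis using that[of p s] dz by (auto simp: algebra_simps)
  qed
  define l where "l = sqrt ((cmod k1)\<^sup>2 + (cmod k2)\<^sup>2)"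
  have l0: "l > 0" using k(3) by (auto simp: l_def intro: add_pos_nonneg add_nonneg_pos)
  have l2: "complex_of_real l * of_real l = k1 * cnj k1 + k2 * cnj k2"
  proof -
    have "l * l = (cmod k1)\<^sup>2 + (cmod k2)\<^sup>2" by (simp add: l_def)
    then show ?thesis by (simp only: flip: of_real_mult) (simp add: complex_norm_square flip: of_real_power)
  qed
  define e1 e2 where "e1 = k1 / of_real l" "e2 = k2 / of_real l"
  have e: "p * e1 + q * e2 = 0" "s * e1 - p * e2 = 0"
    using k l0 by (simp_all add: e1_e2_def field_simps)
  have n: "e1 * cnj e1 + e2 * cnj e2 = 1"
  proof -
    have "e1 * cnj e1 + e2 * cnj e2 = (k1 * cnj k1 + k2 * cnj k2) / (complex_of_real l * of_real l)"
      by (simp add: e1_e2_def add_divide_distrib)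
    also have "\<dots> = (complex_of_real l * of_real l) / (complex_of_real l * of_real l)"
      by (simp only: l2)
    finally have "e1 * cnj e1 + e2 * cnj e2 = (complex_of_real l * of_real l) / (complex_of_real l * of_real l)" .
    then show ?thesis using l0 by simp
  qed
  define U where "U = mk2 (cnj e2) e1 (- cnj e1) e2"
  define w where "w = ctransp U ** X ** U"
  have U1: "det U = 1" using n by (simp add: U_def entries algebra_simps)
  have U2: "U ** ctransp U = mat 1" using n by (simp add: U_def entries algebra_simps)
  note U3 = unitary_inverse[OF U1 U2]
  have XU: "(X ** U)$1$2 = 0" "(X ** U)$2$2 = 0"
    using e X22 by (simp_all add: U_def entries flip: p_q_s_def)
  have w2: "w$1$2 = 0" "w$2$2 = 0"
    unfolding w_def matrix_mul_assoc[symmetric] by (simp_all add: mult_nth[of "ctransp U"] XU)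
  have "trace w = trace (U ** ctransp U ** X)"
    unfolding w_def by (simp add: entries algebra_simps)
  then have "trace w = 0" using U2 assms by simp
  then have w1: "w$1$1 = 0" using w2 by (simp add: entries)
  have weq: "w = mk2 0 0 (w$2$1) 0" using w1 w2 by (simp add: cmat2_eq_iff)
  have Xw: "X = U ** w ** ctransp U"
  proof -
    have "U ** w ** ctransp U = (U ** ctransp U) ** X ** (U ** ctransp U)"
      unfolding w_def by (simp only: matrix_mul_assoc)
    then show ?thesis using U2 by simp
  qed
  have "w$2$1 \<noteq> 0"
  proof
    assume "w$2$1 = 0"
    then have "w = 0" using w1 w2 by (simp add: entries)
    then show False using Xw assms(3) by simp
  qed
  then show thesis using that[OF U1 U2, of "w$2$1"] Xw unfolding weq[symmetric] by simp
qed

section \<open>Adapted frames and the unit normal\<close>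

text \<open>Tangent vectors of either space are the Hermitian matrices orthogonal to the base point, where
Euclidean space uses the identity as base point at every \<open>p\<close>: its orthogonal complement consists
of the trace-free matrices. With this convention all formulas below have the same shape in both
geometries.\<close>

definition base_pt :: "ambient \<Rightarrow> cmat2 \<Rightarrow> cmat2" where
  "base_pt sp p = (case sp of Euc3 \<Rightarrow> mat 1 | Hyp3 \<Rightarrow> p)"

lemma base_pt_simps [simp]: "base_pt Euc3 p = mat 1" "base_pt Hyp3 p = p"
  by (simp_all add: base_pt_def)

lemma base_pt_factor:
  assumes "p \<in> space_of sp"
  obtains V where "det V = 1" "base_pt sp p = V ** ctransp V"
proof (cases sp)
  case Euc3
  then show ?thesis using that[of "mat 1"] by simp
next
  case Hyp3
  then obtain V where "det V = 1" "p = V ** ctransp V" using cholesky assms by blast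
  then show ?thesis using that Hyp3 by simp
qed

lemma transport_inverse:
  assumes "det V = 1"
  shows "V ** (adjugate2 V ** x ** ctransp (adjugate2 V)) ** ctransp V = x"
proof -
  have "V ** (adjugate2 V ** x ** ctransp (adjugate2 V)) ** ctransp V
      = (V ** adjugate2 V) ** x ** ctransp (V ** adjugate2 V)"
    by (simp only: ctransp_mult matrix_mul_assoc)
  then show ?thesis by (simp add: adj_inverse assms)
qed

text \<open>A nonzero complex null tangent vector \<open>u\<close> has a normal form: a factor \<open>V\<close> of the base point carries
it to a nilpotent matrix at the identity, and the freedom \<open>V \<mapsto> V U\<close> with \<open>U\<close> unitary makes that
matrix triangular. Identities between \<open>u\<close>, \<open>u\<^sup>*\<close> and the base point thereby become identities between
matrices with one nonzero entry.\<close>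

lemma adapted_frame:
  assumes p: "p \<in> space_of sp" and "herm_form (base_pt sp p) u = 0" "herm_form u u = 0" "u \<noteq> 0"
  obtains V s where "det V = 1" "base_pt sp p = V ** ctransp V" "s \<noteq> 0" "u = V ** mk2 0 0 s 0 ** ctransp V"
    "ctransp u = V ** mk2 0 (cnj s) 0 0 ** ctransp V"
proof -
  obtain W where W: "det W = 1" "base_pt sp p = W ** ctransp W" using base_pt_factor[OF p] .
  define u' where "u' = adjugate2 W ** u ** ctransp (adjugate2 W)"
  have uu': "u = W ** u' ** ctransp W" unfolding u'_def using transport_inverse[OF W(1)] by simp
  have "herm_form (W ** mat 1 ** ctransp W) (W ** u' ** ctransp W) = 0"
    using assms(2) W uu' by simp
  then have t: "trace u' = 0" unfolding herm_form_transport[OF W(1)] by (simp add: herm_form_mat1)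
  have "herm_form u' u' = 0" using assms(3) unfolding uu' herm_form_transport[OF W(1)] .
  then have d: "det u' = 0" by (simp add: herm_form_self)
  have "u' \<noteq> 0" using uu' assms(4) by auto
  then obtain U s where U: "det U = 1" "U ** ctransp U = mat 1" "s \<noteq> 0" "u' = U ** mk2 0 0 s 0 ** ctransp U"
    using nilpotent_schur[OF d t] by blast
  show thesis
  proof (rule that[of "W ** U" s])
    show "det (W ** U) = 1" using W U by (simp add: det_mul)
    have "(W ** U) ** ctransp (W ** U) = W ** (U ** ctransp U) ** ctransp W"
      by (simp only: ctransp_mult matrix_mul_assoc)
    then show "base_pt sp p = (W ** U) ** ctransp (W ** U)" using W U by simp
    show u: "u = (W ** U) ** mk2 0 0 s 0 ** ctransp (W ** U)"
      unfolding uu' U(4) by (simp only: ctransp_mult matrix_mul_assoc)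
    show "ctransp u = (W ** U) ** mk2 0 (cnj s) 0 0 ** ctransp (W ** U)"
      unfolding u by (simp add: ctransp_mult ctransp_mk2 matrix_mul_assoc)
  qed (rule U)
qed

lemma positive_basis_E_unitary:
  assumes R: "det R = 1" "R ** ctransp R = mat 1" and pos: "positive_basis_E a b c"
  shows "positive_basis_E (R ** a ** ctransp R) (R ** b ** ctransp R) (R ** c ** ctransp R)"
proof -
  note R' = unitary_inverse[OF R]
  have sp: "R ** x ** ctransp R \<in> space_of Euc3" if "x \<in> space_of Euc3" for x
  proof -
    have "trace (R ** x ** ctransp R) = trace (ctransp R ** R ** x)"
      by (simp add: entries algebra_simps)
    moreover have "hermitian (R ** x ** ctransp R)"
      using that by (simp add: hermitian_def ctransp_mult matrix_mul_assoc)
    ultimately show ?thesis using that by (simp add: R'(2))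
  qed
  have m: "(R ** x ** ctransp R) ** (R ** y ** ctransp R) = R ** (x ** y) ** ctransp R" for x y
  proof -
    have "(R ** x ** ctransp R) ** (R ** y ** ctransp R) = R ** x ** (ctransp R ** R) ** y ** ctransp R"
      by (simp only: matrix_mul_assoc)
    then show ?thesis unfolding R'(2) by (simp add: matrix_mul_assoc)
  qed
  have "cscale (-\<i>/2) ((R ** a ** ctransp R) ** (R ** b ** ctransp R) - (R ** b ** ctransp R) ** (R ** a ** ctransp R))
     = R ** cscale (-\<i>/2) (a ** b - b ** a) ** ctransp R"
    unfolding m by (simp only: mat_mult_diff cscale_mult_left cscale_mult_right)
  then show ?thesis using pos sp unfolding positive_basis_E_def
    by (simp only: herm_form_transport[OF R(1)])
qed

text \<open>Two factors \<open>V\<close> of the same base point differ by a unitary matrix of determinant 1, and conjugation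
by such a matrix preserves commutators and the form. So the orientation does not depend on the
factor that the definition chooses existentially.\<close>

lemma positive_basis_transport:
  assumes V: "det V = 1" "base_pt sp p = V ** ctransp V"
  shows "positive_basis sp p (V ** a ** ctransp V) (V ** b ** ctransp V) (V ** c ** ctransp V)
     \<longleftrightarrow> positive_basis_E a b c"
proof (cases sp)
  case Euc3
  then have VV: "V ** ctransp V = mat 1" using V by simp
  have V': "det (ctransp V) = 1" "ctransp V ** ctransp (ctransp V) = mat 1"
    using V unitary_inverse(2)[OF V(1) VV] by simp_all
  have inv: "ctransp V ** (V ** x ** ctransp V) ** ctransp (ctransp V) = x" for x
  proof -
    have "ctransp V ** (V ** x ** ctransp V) ** V = (ctransp V ** V) ** x ** (ctransp V ** V)"
      by (simp only: matrix_mul_assoc)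
    then show ?thesis using V' by simp
  qed
  show ?thesis unfolding Euc3 positive_basis.simps
    using positive_basis_E_unitary[OF V(1) VV, of a b c]
      positive_basis_E_unitary[OF V', of "V ** a ** ctransp V" "V ** b ** ctransp V" "V ** c ** ctransp V"]
    unfolding inv by blast
next
  case Hyp3
  show ?thesis
  proof
    assume "positive_basis sp p (V ** a ** ctransp V) (V ** b ** ctransp V) (V ** c ** ctransp V)"
    then obtain W a' b' c' where W: "det W = 1" "p = W ** ctransp W"
      and e: "V ** a ** ctransp V = W ** a' ** ctransp W" "V ** b ** ctransp V = W ** b' ** ctransp W"
       "V ** c ** ctransp V = W ** c' ** ctransp W" and pos: "positive_basis_E a' b' c'"
      using Hyp3 by auto
    define R where "R = adjugate2 V ** W"
    have R1: "det R = 1" using V W by (simp add: R_def det_mul)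
    have VR: "V ** R = W" unfolding R_def by (simp add: adj_cancel V(1))
    have "V ** (R ** ctransp R) ** ctransp V = (V ** R) ** ctransp (V ** R)"
      by (simp only: ctransp_mult matrix_mul_assoc)
    also have "\<dots> = V ** mat 1 ** ctransp V" using V(2) W(2) Hyp3 by (simp add: VR)
    finally have VRV: "V ** (R ** ctransp R) ** ctransp V = V ** mat 1 ** ctransp V" .
    have canc: "x = y" if "V ** x ** ctransp V = V ** y ** ctransp V" for x y
    proof -
      have e: "adjugate2 V ** (V ** x ** ctransp V) ** ctransp (adjugate2 V) = x" for x
        using transport_inverse[of "adjugate2 V" x] V(1) unfolding adj_adj det_adj by blast
      show ?thesis using e[of x] e[of y] unfolding that by (rule trans[OF sym])
    qed
    have R2: "R ** ctransp R = mat 1" by (rule canc) (rule VRV)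
    have tr: "x = R ** x' ** ctransp R" if "V ** x ** ctransp V = W ** x' ** ctransp W" for x x'
    proof (rule canc)
      have "W ** x' ** ctransp W = (V ** R) ** x' ** ctransp (V ** R)" by (simp only: VR)
      then show "V ** x ** ctransp V = V ** (R ** x' ** ctransp R) ** ctransp V"
        unfolding that by (simp only: ctransp_mult matrix_mul_assoc)
    qed
    show "positive_basis_E a b c"
      using positive_basis_E_unitary[OF R1 R2 pos] tr[OF e(1)] tr[OF e(2)] tr[OF e(3)] by simp
  next
    assume "positive_basis_E a b c"
    then show "positive_basis sp p (V ** a ** ctransp V) (V ** b ** ctransp V) (V ** c ** ctransp V)"
      using V Hyp3 by auto
  qed
qed

text \<open>In the adapted frame, \<open>f\<^sub>x\<close> and \<open>f\<^sub>y\<close> span the off-diagonal Hermitian matrices, so a unit normal can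
only be \<open>\<plusminus> diag(1, -1)\<close>; the orientation selects the sign, because
\<open>-(i/2) [a, b] = |s|\<^sup>2 diag(1, -1)\<close>.\<close>

lemma unit_normal_frame:
  assumes V: "det V = 1" "base_pt sp (f z) = V ** ctransp V" and s: "s \<noteq> 0"
    and u: "u = V ** mk2 0 0 s 0 ** ctransp V"
    and fx: "diff_x f z = u + ctransp u" and fy: "diff_y f z = cscale \<i> (u - ctransp u)"
  shows "unit_normal sp f z = V ** mk2 1 0 0 (-1) ** ctransp V"
proof -
  define a where "a = mk2 0 (cnj s) s 0"
  define b where "b = mk2 0 (- \<i> * cnj s) (\<i> * s) 0"
  have ucs: "ctransp u = V ** mk2 0 (cnj s) 0 0 ** ctransp V"
    unfolding u by (simp only: ctransp_mult ctransp_ctransp ctransp_mk2 matrix_mul_assoc complex_cnj_zero)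
  have a: "diff_x f z = V ** a ** ctransp V"
  proof -
    have "mk2 0 0 s 0 + mk2 0 (cnj s) 0 0 = a" by (simp add: a_def entries)
    then show ?thesis unfolding fx ucs unfolding u by (simp flip: mat_distrib)
  qed
  have b: "diff_y f z = V ** b ** ctransp V"
  proof -
    have "b = cscale \<i> (mk2 0 0 s 0 - mk2 0 (cnj s) 0 0)" by (simp add: b_def entries)
    then show ?thesis unfolding fy ucs unfolding u by (simp add: mat_mult_diff cscale_mult_left cscale_mult_right)
  qed
  have comm: "cscale (-\<i>/2) (a ** b - b ** a) = cscale (s * cnj s) (mk2 1 0 0 (-1))"
    by (simp add: a_def b_def entries)
  have ss: "s * cnj s = of_real ((cmod s)\<^sup>2)" by (rule complex_norm_square[symmetric])
  have ab: "a \<in> space_of Euc3" "b \<in> space_of Euc3"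
    by (simp_all add: a_def b_def hermitian_def entries)
  have pos_iff: "positive_basis_E a b c \<longleftrightarrow> c \<in> space_of Euc3 \<and> Re (s * cnj s * herm_form (mk2 1 0 0 (-1)) c) > 0" for c
    unfolding positive_basis_E_def comm using ab by (simp add: herm_form_bilin)
  show ?thesis
    unfolding unit_normal_def
  proof (rule the_equality)
    have "positive_basis_E a b (mk2 1 0 0 (-1))"
      unfolding pos_iff using s ss by (simp add: hermitian_def entries)
    then show "herm_form (V ** mk2 1 0 0 (-1) ** ctransp V) (V ** mk2 1 0 0 (-1) ** ctransp V) = 1 \<and>
     herm_form (diff_x f z) (V ** mk2 1 0 0 (-1) ** ctransp V) = 0 \<and>
     herm_form (diff_y f z) (V ** mk2 1 0 0 (-1) ** ctransp V) = 0 \<and>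
     positive_basis sp (f z) (diff_x f z) (diff_y f z) (V ** mk2 1 0 0 (-1) ** ctransp V)"
      unfolding a b herm_form_transport[OF V(1)] positive_basis_transport[OF V]
      by (simp add: a_def b_def herm_form_nth)
  next
    fix N
    define c where "c = adjugate2 V ** N ** ctransp (adjugate2 V)"
    have N: "N = V ** c ** ctransp V" unfolding c_def using transport_inverse V by simp
    assume "herm_form N N = 1 \<and> herm_form (diff_x f z) N = 0 \<and> herm_form (diff_y f z) N = 0 \<and>
         positive_basis sp (f z) (diff_x f z) (diff_y f z) N"
    then have c: "herm_form c c = 1" "herm_form a c = 0" "herm_form b c = 0" and pos: "positive_basis_E a b c"
      unfolding a b N herm_form_transport[OF V(1)] positive_basis_transport[OF V] by auto
    have tr: "c$2$2 = - c$1$1" "cnj (c$1$1) = c$1$1"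
      using pos by (auto simp: pos_iff hermitian_def entries add_eq_0_iff)
    have ac: "herm_form a c = (cnj s * c$2$1 + s * c$1$2) / 2"
      "herm_form b c = \<i> * (s * c$1$2 - cnj s * c$2$1) / 2"
      by (simp_all add: a_def b_def herm_form_nth field_simps)
    have n: "c$1$1 * c$1$1 + c$1$2 * c$2$1 = 1"
    proof -
      have "2 * (c$1$1 * c$1$1 + c$1$2 * c$2$1) = 2"
        using c(1) tr(1) by (simp add: herm_form_nth field_simps)
      then show ?thesis unfolding mult_cancel_left2 by simp
    qed
    have "cnj s * c$2$1 + s * c$1$2 = 0" "s * c$1$2 - cnj s * c$2$1 = 0"
      using ac c(2,3) by simp_all
    then have "s * c$1$2 = 0" "cnj s * c$2$1 = 0" by auto
    then have off: "c$1$2 = 0" "c$2$1 = 0" using s by simp_all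
    \<comment> \<open>Orthogonality leaves \<open>c\<close> diagonal and trace-free; its norm and orientation fix the entry.\<close>
    with n have "(c$1$1 - 1) * (c$1$1 + 1) = 0" by (simp add: algebra_simps)
    then have "c$1$1 = 1 \<or> c$1$1 = -1" by (metis add_eq_0_iff2 eq_iff_diff_eq_0 mult_eq_0_iff)
    moreover have "c$1$1 \<noteq> -1"
    proof
      assume "c$1$1 = -1"
      then have "herm_form (mk2 1 0 0 (-1)) c = -1" using tr by (simp add: herm_form_nth)
      then have "Re (complex_of_real ((cmod s)\<^sup>2) * (-1)) > 0" using pos unfolding pos_iff ss by simp
      then show False by simp
    qed
    ultimately have "c = mk2 1 0 0 (-1)" using off tr by (simp add: cmat2_eq_iff)
    then show "N = V ** mk2 1 0 0 (-1) ** ctransp V" using N by simp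
  qed
qed

section \<open>Matrix-valued entire functions\<close>

lemma bounded_bilinear_mat_mult: "bounded_bilinear ((**) :: cmat2 \<Rightarrow> cmat2 \<Rightarrow> cmat2)"
  unfolding bilinear_conv_bounded_bilinear[symmetric] bilinear_def
  by (auto intro!: linearI simp: entries algebra_simps)
lemma bounded_bilinear_cscale: "bounded_bilinear cscale"
  unfolding bilinear_conv_bounded_bilinear[symmetric] bilinear_def
  by (auto intro!: linearI simp: entries algebra_simps)
lemma scaleR_eq_cscale: "r *\<^sub>R A = cscale (of_real r) A"
  by (simp add: cmat2_eq_iff cscale_nth scaleR_conv_of_real[where 'a=complex])
lemma bounded_bilinear_herm_form: "bounded_bilinear herm_form"
  unfolding bilinear_conv_bounded_bilinear[symmetric] bilinear_def
  by (auto intro!: linearI simp: herm_form_bilin scaleR_eq_cscale scaleR_conv_of_real[where 'a=complex])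
lemma bounded_linear_ctransp: "bounded_linear ctransp"
  unfolding linear_conv_bounded_linear[symmetric]
  by (auto intro!: linearI simp: entries algebra_simps)
lemma bounded_linear_adj: "bounded_linear adjugate2"
  unfolding linear_conv_bounded_linear[symmetric]
  by (auto intro!: linearI simp: entries algebra_simps)
lemma bounded_linear_nth_nth: "bounded_linear (\<lambda>A::cmat2. A $ i $ j)"
  unfolding linear_conv_bounded_linear[symmetric] by (auto intro!: linearI)

lemmas has_derivative_mat_mult = bounded_bilinear.FDERIV[OF bounded_bilinear_mat_mult]
lemmas has_derivative_cscale = bounded_bilinear.FDERIV[OF bounded_bilinear_cscale]
lemmas has_derivative_herm_form = bounded_bilinear.FDERIV[OF bounded_bilinear_herm_form]
lemmas has_derivative_ctransp = bounded_linear.has_derivative[OF bounded_linear_ctransp]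
lemmas has_derivative_adj = bounded_linear.has_derivative[OF bounded_linear_adj]
lemmas has_derivative_nth_nth = bounded_linear.has_derivative[OF bounded_linear_nth_nth]

text \<open>Entrywise complex differentiability, expressed with the real derivative so that it can be combined
with products and conjugate transposes.\<close>

definition mat_deriv :: "(complex \<Rightarrow> cmat2) \<Rightarrow> (complex \<Rightarrow> cmat2) \<Rightarrow> bool" where
  "mat_deriv A A' \<longleftrightarrow> (\<forall>z. (A has_derivative (\<lambda>h. cscale h (A' z))) (at z))"

lemma mat_derivD: "mat_deriv A A' \<Longrightarrow> (A has_derivative (\<lambda>h. cscale h (A' z))) (at z)"
  by (simp add: mat_deriv_def)

lemma has_derivative_entries:
  fixes A :: "complex \<Rightarrow> cmat2"
  assumes "\<And>i j. ((\<lambda>z. A z $ i $ j) has_derivative (\<lambda>h. h * B $ i $ j)) (at z)"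
  shows "(A has_derivative (\<lambda>h. cscale h B)) (at z)"
proof -
  have eq: "M = cscale (M$1$1) (mk2 1 0 0 0) + cscale (M$1$2) (mk2 0 1 0 0)
         + cscale (M$2$1) (mk2 0 0 1 0) + cscale (M$2$2) (mk2 0 0 0 1)" for M
    by (simp add: entries)
  have "((\<lambda>z. cscale (A z$1$1) (mk2 1 0 0 0) + cscale (A z$1$2) (mk2 0 1 0 0)
         + cscale (A z$2$1) (mk2 0 0 1 0) + cscale (A z$2$2) (mk2 0 0 0 1)) has_derivative
     (\<lambda>h. cscale (h * B$1$1) (mk2 1 0 0 0) + cscale (h * B$1$2) (mk2 0 1 0 0)
         + cscale (h * B$2$1) (mk2 0 0 1 0) + cscale (h * B$2$2) (mk2 0 0 0 1))) (at z)"
    by (intro has_derivative_add bounded_linear.has_derivative[OF bounded_bilinear.bounded_linear_left[OF bounded_bilinear_cscale]] assms)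
  moreover have "(\<lambda>z. cscale (A z$1$1) (mk2 1 0 0 0) + cscale (A z$1$2) (mk2 0 1 0 0)
         + cscale (A z$2$1) (mk2 0 0 1 0) + cscale (A z$2$2) (mk2 0 0 0 1)) = A"
    by (rule ext) (rule eq[symmetric])
  moreover have "(\<lambda>h. cscale (h * B$1$1) (mk2 1 0 0 0) + cscale (h * B$1$2) (mk2 0 1 0 0)
         + cscale (h * B$2$1) (mk2 0 0 1 0) + cscale (h * B$2$2) (mk2 0 0 0 1)) = (\<lambda>h. cscale h B)"
    by (simp add: entries fun_eq_iff)
  ultimately show ?thesis by (simp only:)
qed

lemma mat_deriv_entries_iff:
  "mat_deriv A A' \<longleftrightarrow> (\<forall>i j z. ((\<lambda>z. A z $ i $ j) has_field_derivative A' z $ i $ j) (at z))"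
proof -
  have *: "(g has_field_derivative c) (at z) \<longleftrightarrow> (g has_derivative (\<lambda>h. h * c)) (at z)" for g and c z :: complex
    unfolding has_field_derivative_def by (simp only: mult_commute_abs)
  show ?thesis
  proof
    assume "mat_deriv A A'"
    then show "\<forall>i j z. ((\<lambda>z. A z $ i $ j) has_field_derivative A' z $ i $ j) (at z)"
      using has_derivative_nth_nth[OF mat_derivD] unfolding cscale_nth * by blast
  next
    assume "\<forall>i j z. ((\<lambda>z. A z $ i $ j) has_field_derivative A' z $ i $ j) (at z)"
    then show "mat_deriv A A'"
      unfolding mat_deriv_def * by (intro allI has_derivative_entries) blast
  qed
qed

lemma mat_deriv_entry: "mat_deriv A A' \<Longrightarrow> ((\<lambda>z. A z $ i $ j) has_field_derivative A' z $ i $ j) (at z)"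
  by (simp add: mat_deriv_entries_iff)

lemma mat_deriv_const: "mat_deriv (\<lambda>z. A) (\<lambda>z. 0)"
  by (simp add: mat_deriv_def)
lemma mat_deriv_mult:
  assumes "mat_deriv A A'" "mat_deriv B B'"
  shows "mat_deriv (\<lambda>z. A z ** B z) (\<lambda>z. A z ** B' z + A' z ** B z)"
  unfolding mat_deriv_def
  using has_derivative_mat_mult[OF mat_derivD[OF assms(1)] mat_derivD[OF assms(2)]]
  by (simp add: cscale_add_right cscale_mult_left cscale_mult_right)
lemma mat_deriv_cscale:
  assumes "\<And>z. (f has_field_derivative f' z) (at z)" "mat_deriv B B'"
  shows "mat_deriv (\<lambda>z. cscale (f z) (B z)) (\<lambda>z. cscale (f z) (B' z) + cscale (f' z) (B z))"
  unfolding mat_deriv_def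
  using has_derivative_cscale[OF assms(1)[unfolded has_field_derivative_def] mat_derivD[OF assms(2)]]
  by (simp add: cscale_add_right cscale_cscale mult.commute)
lemma mat_deriv_adj:
  assumes "mat_deriv A A'"
  shows "mat_deriv (\<lambda>z. adjugate2 (A z)) (\<lambda>z. adjugate2 (A' z))"
proof -
  have "adjugate2 (cscale h B) = cscale h (adjugate2 B)" for h B by (simp add: entries)
  then show ?thesis unfolding mat_deriv_def
    using has_derivative_adj[OF mat_derivD[OF assms]] by simp
qed
lemma mat_deriv_compose:
  assumes "\<And>z. (f has_field_derivative f' z) (at z)" "mat_deriv B B'"
  shows "mat_deriv (\<lambda>z. B (f z)) (\<lambda>z. cscale (f' z) (B' (f z)))"
  unfolding mat_deriv_def
  using has_derivative_compose[OF assms(1)[unfolded has_field_derivative_def] mat_derivD[OF assms(2)]]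
  by (simp add: cscale_cscale mult.commute)

lemma mat_deriv_deriv:
  assumes "mat_deriv A A'"
  obtains A'' where "mat_deriv A' A''"
proof -
  define A'' where "A'' = (\<lambda>z. \<chi> i j. deriv (\<lambda>z. A' z $ i $ j) z)"
  have "((\<lambda>z. A' z $ i $ j) has_field_derivative A'' z $ i $ j) (at z)" for i j z
  proof -
    have h: "(\<lambda>z. A z $ i $ j) holomorphic_on UNIV"
      using mat_deriv_entry[OF assms] by (auto intro!: derivative_intros simp: holomorphic_on_def field_differentiable_def)
    have e: "deriv (\<lambda>z. A z $ i $ j) = (\<lambda>z. A' z $ i $ j)"
      by (rule ext) (rule DERIV_imp_deriv[OF mat_deriv_entry[OF assms]])
    have "(\<lambda>z. A' z $ i $ j) holomorphic_on UNIV"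
      using holomorphic_deriv[OF h] e by simp
    then show ?thesis unfolding A''_def by (simp add: holomorphic_derivI)
  qed
  then show thesis using that[of A''] unfolding mat_deriv_entries_iff by blast
qed

lemma has_derivative_zero_imp_const:
  fixes f :: "complex \<Rightarrow> 'b::real_normed_vector"
  assumes "\<And>x. (f has_derivative (\<lambda>h. 0)) (at x)"
  shows "f x = f y"
proof -
  have "\<exists>c. \<forall>x\<in>UNIV. f x = c" using assms by (intro has_derivative_zero_constant) auto
  then show ?thesis by auto
qed

lemma has_derivative_of_const:
  "((\<lambda>x. c) has_derivative D) (at z) \<Longrightarrow> D h = 0"
  using has_derivative_unique[OF _ has_derivative_const] by (metis (no_types))

lemma frechet_eq: "(f has_derivative D) (at z) \<Longrightarrow> frechet_derivative f (at z) = D"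
  using frechet_derivative_at by metis

lemma times_cont_diff_add:
  "times_cont_diff k f \<Longrightarrow> times_cont_diff k g \<Longrightarrow> times_cont_diff k (\<lambda>x. f x + g x)"
proof (induction k arbitrary: f g)
  case 0
  then show ?case by (auto intro: continuous_intros)
next
  case (Suc k)
  then have d: "(f has_derivative frechet_derivative f (at x)) (at x)"
     "(g has_derivative frechet_derivative g (at x)) (at x)" for x
    by (auto simp: frechet_derivative_works)
  have "((\<lambda>x. f x + g x) has_derivative (\<lambda>v. frechet_derivative f (at x) v + frechet_derivative g (at x) v)) (at x)" for x
    by (intro has_derivative_add d)
  note D = this frechet_eq[OF this]
  show ?case unfolding times_cont_diff.simps D(2)
    using D(1) Suc by (auto simp: differentiable_def)
qed

lemma has_derivative_star_mult:
  assumes "mat_deriv A A'" "mat_deriv B B'"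
  shows "((\<lambda>z. ctransp (A z) ** B z) has_derivative
     (\<lambda>h. ctransp (A z) ** cscale h (B' z) + ctransp (cscale h (A' z)) ** B z)) (at z)"
  by (intro has_derivative_mat_mult has_derivative_ctransp mat_derivD assms)

text \<open>A directional derivative of \<open>A\<^sup>* B\<close> with entire \<open>A\<close>, \<open>B\<close> is a sum of two products of the same kind,
so the class of such sums is closed under differentiation.\<close>

lemma times_cont_diff_star_mult:
  "mat_deriv A A' \<Longrightarrow> mat_deriv B B' \<Longrightarrow> times_cont_diff k (\<lambda>z. ctransp (A z) ** B z)"
proof (induction k arbitrary: A A' B B')
  case 0
  then show ?case
    using has_derivative_star_mult[OF 0] by (auto intro!: has_derivative_continuous_on simp: has_derivative_at_withinI)
next
  case (Suc k)
  note D = has_derivative_star_mult[OF Suc.prems]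
  note E = frechet_eq[OF D]
  obtain A'' B'' where A'': "mat_deriv A' A''" "mat_deriv B' B''" using Suc.prems mat_deriv_deriv by metis
  have c: "mat_deriv (\<lambda>z. cscale v (A z)) (\<lambda>z. cscale v (A' z))" if "mat_deriv A A'" for v A A'
    using mat_deriv_cscale[of "\<lambda>z. v" "\<lambda>z. 0", OF _ that] by simp
  show ?case unfolding times_cont_diff.simps E
    using D by (auto simp: differentiable_def intro!: times_cont_diff_add Suc.IH c Suc.prems A'')
qed

section \<open>Surfaces from holomorphic data\<close>

definition cmc_const :: "ambient \<Rightarrow> real" where
  "cmc_const sp = (case sp of Euc3 \<Rightarrow> 0 | Hyp3 \<Rightarrow> 1)"

text \<open>The Weierstrass and Bryant representations in one notion. In Euclidean space \<open>cmc_const\<close> vanishes,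
so \<open>\<Psi>\<close> is a constant unitary matrix and the condition says that \<open>f\<^sub>z = \<Psi>\<^sup>* X \<Psi>\<close> with a holomorphic
null matrix \<open>X\<close>. In hyperbolic space it says \<open>f = \<Psi>\<^sup>* \<Psi>\<close> with \<open>\<Psi>\<close> holomorphic and \<open>X = \<Psi>\<^sub>z \<Psi>\<^sup>-\<^sup>1\<close>
null. The derivative of \<open>f\<close> has the same form in both cases.\<close>

definition hol_data :: "ambient \<Rightarrow> (complex \<Rightarrow> cmat2) \<Rightarrow> (complex \<Rightarrow> cmat2) \<Rightarrow> (complex \<Rightarrow> cmat2) \<Rightarrow> bool" where
  "hol_data sp f X \<Psi> \<longleftrightarrow>
     (\<exists>X'. mat_deriv X X') \<and> mat_deriv \<Psi> (\<lambda>z. cscale (of_real (cmc_const sp)) (X z ** \<Psi> z)) \<and>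
     (\<forall>z. det (X z) = 0 \<and> trace (X z) = 0 \<and> X z \<noteq> 0 \<and> det (\<Psi> z) = 1 \<and>
        f z \<in> space_of sp \<and> base_pt sp (f z) = ctransp (\<Psi> z) ** \<Psi> z \<and>
        (f has_derivative (\<lambda>h. ctransp (\<Psi> z) ** (cscale h (X z) + ctransp (cscale h (X z))) ** \<Psi> z)) (at z))"

text \<open>The form is positive definite on tangent vectors; in an adapted frame the value is \<open>|s|\<^sup>2/2\<close>.\<close>

lemma tangent_nonzero:
  assumes p: "p \<in> space_of sp" and "herm_form (base_pt sp p) u = 0" "herm_form u u = 0" "u \<noteq> 0"
  obtains t where "t > 0" "herm_form u (ctransp u) = of_real t"
proof -
  obtain V s where V: "det V = 1" "base_pt sp p = V ** ctransp V" "s \<noteq> 0" "u = V ** mk2 0 0 s 0 ** ctransp V"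
    and uc: "ctransp u = V ** mk2 0 (cnj s) 0 0 ** ctransp V"
    using adapted_frame[OF assms] .
  have "herm_form u (ctransp u) = s * cnj s / 2"
    unfolding uc unfolding V(4) herm_form_transport[OF V(1)] by (simp add: herm_form_nth)
  also have "\<dots> = of_real ((cmod s)\<^sup>2 / 2)" unfolding complex_norm_square[symmetric] by simp
  finally have "herm_form u (ctransp u) = of_real ((cmod s)\<^sup>2 / 2)" .
  then show thesis by (rule that[rotated]) (use V(3) in simp)
qed

lemma star_adj_frame:
  assumes V: "det V = 1"
  shows "(V ** x ** ctransp V) ** adjugate2 (V ** ctransp V) ** (V ** y ** ctransp V) = V ** (x ** y) ** ctransp V"
proof -
  have "(V ** x ** ctransp V) ** adjugate2 (V ** ctransp V) ** (V ** y ** ctransp V)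
     = V ** x ** (ctransp V ** adjugate2 (ctransp V)) ** (adjugate2 V ** V) ** y ** ctransp V"
    by (simp only: adj_mult matrix_mul_assoc)
  then show ?thesis using adj_inverse[OF V] adj_inverse[of "ctransp V"] V by (simp add: matrix_mul_assoc)
qed

text \<open>In an adapted frame \<open>u\<^sup>* P u\<close>, with \<open>P\<close> the inverse of the base point, is \<open>|s|\<^sup>2 diag(1, 0)\<close>, and
\<open>2 diag(1, 0) - I = diag(1, -1)\<close>. The result mentions no frame, so it can be differentiated along
the surface.\<close>

lemma unit_normal_formula:
  assumes p: "f z \<in> space_of sp" and u: "herm_form (base_pt sp (f z)) u = 0" "herm_form u u = 0" "u \<noteq> 0"
    and fx: "diff_x f z = u + ctransp u" and fy: "diff_y f z = cscale \<i> (u - ctransp u)"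
  shows "unit_normal sp f z =
    cscale (1 / herm_form u (ctransp u)) (ctransp u ** adjugate2 (base_pt sp (f z)) ** u) - base_pt sp (f z)"
proof -
  obtain V s where V: "det V = 1" "base_pt sp (f z) = V ** ctransp V" "s \<noteq> 0" "u = V ** mk2 0 0 s 0 ** ctransp V"
    and uc: "ctransp u = V ** mk2 0 (cnj s) 0 0 ** ctransp V"
    using adapted_frame[OF p u] .
  have k: "herm_form u (ctransp u) = s * cnj s / 2"
    unfolding uc unfolding V(4) herm_form_transport[OF V(1)] by (simp add: herm_form_nth)
  have pr: "mk2 0 (cnj s) 0 0 ** mk2 0 0 s 0 = cscale (s * cnj s) (mk2 1 0 0 0)"
    by (simp add: entries)
  have c: "cscale (1 / (s * cnj s / 2)) (V ** cscale (s * cnj s) (mk2 1 0 0 0) ** ctransp V) - V ** ctransp V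
      = V ** (cscale 2 (mk2 1 0 0 0) - mat 1) ** ctransp V"
    using V(3) by (simp add: mat_mult_diff cscale_mult_left cscale_mult_right cscale_cscale)
  have "cscale 2 (mk2 1 0 0 0) - mat 1 = mk2 1 0 0 (-1)" by (simp add: entries)
  then show ?thesis
    unfolding k unfolding uc V(2) unfolding V(4) star_adj_frame[OF V(1)] pr c
    using unit_normal_frame[OF V fx fy] by simp
qed

text \<open>The matrices \<open>u\<close>, \<open>u\<^sup>*\<close>, the base point and \<open>u\<^sup>* P u\<close> form a basis, and the form is nondegenerate.\<close>

lemma orthogonal_frame_zero:
  assumes p: "p \<in> space_of sp" and u: "herm_form (base_pt sp p) u = 0" "herm_form u u = 0" "u \<noteq> 0"
    and o: "herm_form (base_pt sp p) d = 0" "herm_form u d = 0" "herm_form (ctransp u) d = 0"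
      "herm_form (ctransp u ** adjugate2 (base_pt sp p) ** u) d = 0"
  shows "d = 0"
proof -
  obtain V s where V: "det V = 1" "base_pt sp p = V ** ctransp V" "s \<noteq> 0" "u = V ** mk2 0 0 s 0 ** ctransp V"
    and uc: "ctransp u = V ** mk2 0 (cnj s) 0 0 ** ctransp V"
    using adapted_frame[OF p u] .
  define e where "e = adjugate2 V ** d ** ctransp (adjugate2 V)"
  have d: "d = V ** e ** ctransp V" unfolding e_def using transport_inverse[OF V(1)] by simp
  have "herm_form (mk2 0 0 s 0) e = 0" "herm_form (mk2 0 (cnj s) 0 0) e = 0"
     "herm_form (mk2 0 (cnj s) 0 0 ** mk2 0 0 s 0) e = 0"
    using o(2-4) unfolding uc V(2) unfolding V(4) star_adj_frame[OF V(1)] d herm_form_transport[OF V(1)] by auto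
  moreover have "herm_form (V ** mat 1 ** ctransp V) (V ** e ** ctransp V) = 0"
    using o(1) unfolding V(2) d by simp
  then have "trace e = 0" unfolding herm_form_transport[OF V(1)] by (simp add: herm_form_mat1)
  ultimately have "e = 0" using V(3) by (simp add: entries)
  then show ?thesis using d by simp
qed

lemma differentiable_cscale_inverse_diff:
  assumes "k differentiable (at z)" "k z \<noteq> 0" "M differentiable (at z)" "b differentiable (at z)"
  shows "(\<lambda>z. cscale (1 / k z) (M z) - b z) differentiable (at z)"
proof -
  obtain k' M' b' where d: "(k has_derivative k') (at z)" "(M has_derivative M') (at z)" "(b has_derivative b') (at z)"
    using assms by (auto simp: differentiable_def)
  have "((\<lambda>z. 1 / k z) has_derivative (\<lambda>h. - (inverse (k z) * k' h * inverse (k z)))) (at z)"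
    using Deriv.has_derivative_inverse[OF assms(2) d(1)] by (simp add: divide_inverse)
  from has_derivative_diff[OF has_derivative_cscale[OF this d(2)] d(3)]
  show ?thesis unfolding differentiable_def by blast
qed

lemma diff_z_eq:
  assumes "diff_x f z = u + ctransp u" and "diff_y f z = cscale \<i> (u - ctransp u)"
  shows "diff_z f z = u" "diff_zbar f z = ctransp u"
  unfolding diff_z_def diff_zbar_def assms by (simp_all add: entries field_simps)

text \<open>The quadratic forms \<open>h\<^sup>2\<close>, \<open>|h|\<^sup>2\<close> and \<open>(cnj h)\<^sup>2\<close> are separated by \<open>h = 1, i, 1 + i\<close>.\<close>

lemma hopf_unique:
  assumes "hopf_mean_curvature sp f z Q H" "hopf_mean_curvature sp f z Q' H'"
  shows "Q = Q'"
proof -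
  define q where "q = Q - Q'"
  define r where "r = of_real (H - H') * metric_coeff f z"
  have e: "q * h\<^sup>2 + r * of_real ((cmod h)\<^sup>2) + cnj q * (cnj h)\<^sup>2 = 0" for h
  proof -
    have "Q * h\<^sup>2 + of_real H * (metric_coeff f z * of_real ((cmod h)\<^sup>2)) + cnj Q * (cnj h)\<^sup>2
      = Q' * h\<^sup>2 + of_real H' * (metric_coeff f z * of_real ((cmod h)\<^sup>2)) + cnj Q' * (cnj h)\<^sup>2"
      using assms unfolding hopf_mean_curvature_def by metis
    then show ?thesis by (simp add: q_def r_def algebra_simps)
  qed
  have "q + r + cnj q = 0" using e[of 1] by simp
  moreover have "- q + r - cnj q = 0" using e[of "\<i>"] by simp
  moreover have "q * (2 * \<i>) + r * 2 - cnj q * (2 * \<i>) = 0"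
    using e[of "1 + \<i>"] by (simp add: power2_eq_square algebra_simps cmod_def)
  ultimately have "q + cnj q = 0" "q - cnj q = 0" 
    by (auto simp: complex_eq_iff)
  then have "q = 0" by (simp add: complex_eq_iff)
  then show ?thesis by (simp add: q_def)
qed

lemma hol_data_first_order:
  assumes D: "hol_data sp f X \<Psi>" and u: "u = ctransp (\<Psi> z) ** X z ** \<Psi> z"
  shows "ctransp u = ctransp (\<Psi> z) ** ctransp (X z) ** \<Psi> z"
    "herm_form (base_pt sp (f z)) u = 0" "herm_form u u = 0" "u \<noteq> 0"
    "diff_x f z = u + ctransp u" "diff_y f z = cscale \<i> (u - ctransp u)"
    "frechet_derivative f (at z) = (\<lambda>h. cscale h u + ctransp (cscale h u))"
    "herm_form u (ctransp u) = herm_form (X z) (ctransp (X z))"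
proof -
  have V: "det (ctransp (\<Psi> z)) = 1" using D by (simp add: hol_data_def)
  show uc: "ctransp u = ctransp (\<Psi> z) ** ctransp (X z) ** \<Psi> z"
    unfolding u by (simp add: ctransp_mult matrix_mul_assoc)
  note tr = herm_form_transport[OF V, unfolded ctransp_ctransp]
  have b: "base_pt sp (f z) = ctransp (\<Psi> z) ** mat 1 ** \<Psi> z" using D by (simp add: hol_data_def)
  show "herm_form (base_pt sp (f z)) u = 0" unfolding b u tr using D by (simp add: herm_form_mat1 hol_data_def)
  show "herm_form u u = 0" unfolding u tr using D by (simp add: herm_form_self hol_data_def)
  show "herm_form u (ctransp u) = herm_form (X z) (ctransp (X z))" unfolding uc unfolding u tr ..
  show "u \<noteq> 0"
  proof
    assume "u = 0"
    then have "adjugate2 (ctransp (\<Psi> z)) ** u ** adjugate2 (\<Psi> z) = 0" by simp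
    also have "adjugate2 (ctransp (\<Psi> z)) ** u ** adjugate2 (\<Psi> z)
       = (adjugate2 (ctransp (\<Psi> z)) ** ctransp (\<Psi> z)) ** X z ** (\<Psi> z ** adjugate2 (\<Psi> z))"
      unfolding u by (simp only: matrix_mul_assoc)
    finally show False using D adj_inverse[of "ctransp (\<Psi> z)"] adj_inverse[of "\<Psi> z"] by (simp add: hol_data_def)
  qed
  have d: "(f has_derivative (\<lambda>h. ctransp (\<Psi> z) ** (cscale h (X z) + ctransp (cscale h (X z))) ** \<Psi> z)) (at z)"
    using D by (simp add: hol_data_def)
  have "ctransp (\<Psi> z) ** (cscale h (X z) + ctransp (cscale h (X z))) ** \<Psi> z = cscale h u + ctransp (cscale h u)" for h
    unfolding ctransp_cscale uc unfolding u by (simp only: mat_distrib cscale_mult_left cscale_mult_right)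
  then show fr: "frechet_derivative f (at z) = (\<lambda>h. cscale h u + ctransp (cscale h u))"
    using frechet_eq[OF d] by simp
  show "diff_x f z = u + ctransp u" unfolding diff_x_def fr by simp
  show "diff_y f z = cscale \<i> (u - ctransp u)" unfolding diff_y_def fr by (simp add: entries algebra_simps)
qed

lemma hol_data_space: "hol_data sp f X \<Psi> \<Longrightarrow> f z \<in> space_of sp"
  by (simp add: hol_data_def)

lemma hol_data_metric:
  assumes D: "hol_data sp f X \<Psi>"
  shows "metric_coeff f z = 2 * herm_form (X z) (ctransp (X z))"
proof -
  note F = hol_data_first_order[OF D refl, of z]
  show ?thesis unfolding metric_coeff_def diff_z_eq[OF F(5,6)] F(8) ..
qed

lemma hol_data_metric_pos:
  assumes D: "hol_data sp f X \<Psi>"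
  obtains t where "t > 0" "herm_form (X z) (ctransp (X z)) = of_real t"
  using hol_data_first_order[OF D refl, of z] tangent_nonzero[OF hol_data_space[OF D, of z]] by metis

lemma hol_data_normal:
  assumes D: "hol_data sp f X \<Psi>"
  shows "unit_normal sp f z = ctransp (\<Psi> z) **
    (cscale (1 / herm_form (X z) (ctransp (X z))) (ctransp (X z) ** X z) - mat 1) ** \<Psi> z"
proof -
  have V: "det (ctransp (\<Psi> z)) = 1" using D by (simp add: hol_data_def)
  have b: "base_pt sp (f z) = ctransp (\<Psi> z) ** \<Psi> z" using D by (simp add: hol_data_def)
  note F = hol_data_first_order[OF D refl, of z]
  show ?thesis
    unfolding unit_normal_formula[where f=f and z=z and sp=sp, OF hol_data_space[OF D] F(2-6)]
    unfolding F(8) unfolding F(1) b star_adj_frame[OF V, unfolded ctransp_ctransp]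
    by (simp add: mat_mult_diff cscale_mult_left cscale_mult_right)
qed

lemma hol_data_smooth:
  assumes D: "hol_data sp f X \<Psi>"
  shows "smooth f"
proof -
  obtain X' where X': "mat_deriv X X'" using D by (auto simp: hol_data_def)
  have Psi: "mat_deriv \<Psi> (\<lambda>z. cscale (of_real (cmc_const sp)) (X z ** \<Psi> z))"
    using D by (auto simp: hol_data_def)
  note F = hol_data_first_order(7)[OF D refl]
  have dif: "f differentiable (at z)" for z using D by (auto simp: hol_data_def differentiable_def)
  have "times_cont_diff k (\<lambda>z. frechet_derivative f (at z) v)" for k v
  proof -
    have m: "mat_deriv (\<lambda>z. cscale v (X z ** \<Psi> z)) (\<lambda>z. cscale v (X z ** cscale (of_real (cmc_const sp)) (X z ** \<Psi> z) + X' z ** \<Psi> z))"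
      using mat_deriv_cscale[of "\<lambda>z. v" "\<lambda>z. 0", OF _ mat_deriv_mult[OF X' Psi]] by simp
    have e: "(\<lambda>z. frechet_derivative f (at z) v) = (\<lambda>z. ctransp (\<Psi> z) ** cscale v (X z ** \<Psi> z) + ctransp (cscale v (X z ** \<Psi> z)) ** \<Psi> z)"
      unfolding F by (simp add: cscale_mult_right ctransp_cscale ctransp_mult cscale_mult_left matrix_mul_assoc)
    show ?thesis unfolding e
      by (intro times_cont_diff_add times_cont_diff_star_mult[OF Psi m] times_cont_diff_star_mult[OF m Psi])
  qed
  then have "times_cont_diff (Suc k) f" for k using dif by simp
  then have "times_cont_diff k f" for k
    using dif by (cases k) (auto intro!: differentiable_imp_continuous_on simp: differentiable_on_def differentiable_at_withinI)
  then show ?thesis by (simp add: smooth_def)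
qed

lemma hol_data_conformal_immersion:
  assumes D: "hol_data sp f X \<Psi>"
  shows "conformal_immersion sp f"
proof -
  have "inj (frechet_derivative f (at z)) \<and> herm_form (diff_z f z) (diff_z f z) = 0" for z
  proof
    define u where "u = ctransp (\<Psi> z) ** X z ** \<Psi> z"
    note F = hol_data_first_order[OF D u_def]
    show "herm_form (diff_z f z) (diff_z f z) = 0"
      using diff_z_eq[OF F(5,6)] F(3) by simp
    obtain t where t: "t > 0" "herm_form u (ctransp u) = of_real t"
      using tangent_nonzero[OF hol_data_space[OF D] F(2-4)] .
    have uu: "herm_form (ctransp u) (ctransp u) = 0" using F(3) by (metis cnj_herm_form complex_cnj_zero)
    have "h = 0" if "cscale h u + ctransp (cscale h u) = 0" for h
    proof -
      have "herm_form (cscale h u + ctransp (cscale h u)) (ctransp u) = 0" using that by simp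
      then have "h * of_real t = 0" using t(2) uu by (simp add: herm_form_bilin ctransp_cscale)
      then show ?thesis using t(1) by simp
    qed
    moreover have "linear (\<lambda>h. cscale h u + ctransp (cscale h u))"
      by (rule linearI) (simp_all add: entries algebra_simps)
    ultimately show "inj (frechet_derivative f (at z))" unfolding F(7)
      by (simp add: linear_injective_0)
  qed
  then show ?thesis unfolding conformal_immersion_def
    using hol_data_space[OF D] hol_data_smooth[OF D] by auto
qed

text \<open>The Hopf differential in terms of the data. The second argument of the form is the unit normal,
pulled back by \<open>\<Psi>\<close> to the identity.\<close>

definition hopf_coeff :: "(complex \<Rightarrow> cmat2) \<Rightarrow> (complex \<Rightarrow> cmat2) \<Rightarrow> complex \<Rightarrow> complex" where
  "hopf_coeff X X' z = herm_form (X' z) (cscale (1 / herm_form (X z) (ctransp (X z))) (ctransp (X z) ** X z) - mat 1)"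

text \<open>Differentiating \<open>\<langle>df(h), N\<rangle> = 0\<close> in the direction \<open>h\<close> gives \<open>-\<langle>df(h), dN(h)\<rangle> = \<langle>D\<^sup>2f(h, h), N\<rangle>\<close>, which
trades the derivative of the normal for second derivatives of \<open>f\<close>. As \<open>X\<^sup>2 = 0\<close>, the second derivative is
\<open>\<Psi>\<^sup>* (h\<^sup>2 X' + (h\<^sup>2 X')\<^sup>* + 2 H |h|\<^sup>2 X\<^sup>* X) \<Psi>\<close>: the last term produces the mean curvature \<open>H\<close>, the first
one the Hopf differential.\<close>

lemma hol_data_hopf:
  assumes D: "hol_data sp f X \<Psi>" and X': "mat_deriv X X'"
  shows "hopf_mean_curvature sp f z (hopf_coeff X X' z) (cmc_const sp)"
proof -
  define H where "H = complex_of_real (cmc_const sp)"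
  define k where "k = (\<lambda>z. herm_form (X z) (ctransp (X z)))"
  define \<nu> where "\<nu> = (\<lambda>z. cscale (1 / k z) (ctransp (X z) ** X z) - mat 1)"
  have Psi: "mat_deriv \<Psi> (\<lambda>z. cscale H (X z ** \<Psi> z))" using D by (auto simp: hol_data_def H_def)
  have V: "det (ctransp (\<Psi> z)) = 1" for z using D by (simp add: hol_data_def)
  note tr = herm_form_transport[OF V, unfolded ctransp_ctransp]
  have N: "unit_normal sp f = (\<lambda>z. ctransp (\<Psi> z) ** \<nu> z ** \<Psi> z)"
    using hol_data_normal[OF D] by (simp add: fun_eq_iff \<nu>_def k_def)
  have knz: "k z \<noteq> 0" for z
  proof -
    obtain t where "t > 0" "k z = of_real t" using hol_data_metric_pos[OF D, of z] unfolding k_def .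
    then show ?thesis by simp
  qed
  have dk: "k differentiable (at z)"
    unfolding k_def differentiable_def
    using has_derivative_herm_form[OF mat_derivD[OF X'] has_derivative_ctransp[OF mat_derivD[OF X']]] by blast
  have dM: "(\<lambda>z. ctransp (X z) ** X z) differentiable (at z)"
    unfolding differentiable_def using has_derivative_star_mult[OF X' X'] by blast
  obtain \<nu>' where nu': "(\<nu> has_derivative \<nu>') (at z)"
    using differentiable_cscale_inverse_diff[OF dk knz dM differentiable_const] unfolding \<nu>_def differentiable_def by blast
  have "unit_normal sp f differentiable (at z)"
    unfolding N differentiable_def
    using has_derivative_mat_mult[OF has_derivative_mat_mult[OF has_derivative_ctransp[OF mat_derivD[OF Psi]] nu'] mat_derivD[OF Psi]] by blast
  then have dN: "(unit_normal sp f has_derivative frechet_derivative (unit_normal sp f) (at z)) (at z)"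
    by (simp add: frechet_derivative_works)
  have nuh: "ctransp (\<nu> z) = \<nu> z"
  proof -
    have "cnj (k z) = k z" unfolding k_def cnj_herm_form by (simp add: herm_form_sym)
    then show ?thesis by (simp add: \<nu>_def ctransp_diff ctransp_cscale ctransp_mult)
  qed
  have dX: "trace (X w) = 0" "det (X w) = 0" for w using D by (auto simp: hol_data_def)
  have XX: "X w ** X w = 0" for w
  proof -
    have a: "X w $2$2 = - X w $1$1" using dX(1)[of w] by (simp add: entries add_eq_0_iff2)
    have "X w $1$1 * X w$1$1 + X w$1$2 * X w$2$1 = 0"
      using dX(2)[of w] unfolding det_2 a by (simp add: algebra_simps) algebra
    then show ?thesis by (simp add: entries a algebra_simps)
  qed
  have kk: "k z = trace (ctransp (X z) ** X z) / 2"
  proof -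
    have a: "X z $2$2 = - X z $1$1" using dX(1)[of z] by (simp add: entries add_eq_0_iff2)
    show ?thesis by (simp add: k_def entries a field_simps)
  qed
  have nuk: "herm_form (ctransp (X z) ** X z) (\<nu> z) = k z"
  proof -
    have "herm_form (ctransp (X z) ** X z) (ctransp (X z) ** X z) = 0"
      by (simp add: herm_form_self det_mul dX)
    moreover have "herm_form (ctransp (X z) ** X z) (mat 1) = - k z"
      unfolding herm_form_sym[of _ "mat 1"] herm_form_mat1 kk by simp
    ultimately show ?thesis unfolding \<nu>_def by (simp add: herm_form_bilin)
  qed
  have met: "metric_coeff f z = 2 * k z" using hol_data_metric[OF D] by (simp add: k_def)
  show ?thesis
    unfolding hopf_mean_curvature_def
  proof (intro allI)
    fix h :: complex
    define Y where "Y = (\<lambda>z. cscale h (X z) + ctransp (cscale h (X z)))"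
    have df: "frechet_derivative f (at w) h = ctransp (\<Psi> w) ** Y w ** \<Psi> w" for w
    proof -
      have "(f has_derivative (\<lambda>h. ctransp (\<Psi> w) ** (cscale h (X w) + ctransp (cscale h (X w))) ** \<Psi> w)) (at w)"
        using D by (simp add: hol_data_def)
      then show ?thesis unfolding Y_def by (simp add: frechet_eq)
    qed
    have dXh: "((\<lambda>w. cscale h (X w)) has_derivative (\<lambda>l. cscale h (cscale l (X' z)))) (at z)"
      using bounded_linear.has_derivative[OF bounded_bilinear.bounded_linear_right[OF bounded_bilinear_cscale] mat_derivD[OF X']] .
    have dY: "(Y has_derivative (\<lambda>l. cscale h (cscale l (X' z)) + ctransp (cscale h (cscale l (X' z))))) (at z)"
      unfolding Y_def by (intro has_derivative_add has_derivative_ctransp dXh)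
    define Z where "Z = (\<lambda>l. (ctransp (\<Psi> z) ** Y z) ** cscale l (cscale H (X z ** \<Psi> z)) +
       (ctransp (\<Psi> z) ** (cscale h (cscale l (X' z)) + ctransp (cscale h (cscale l (X' z)))) + ctransp (cscale l (cscale H (X z ** \<Psi> z))) ** Y z) ** \<Psi> z)"
    have dfd: "((\<lambda>w. frechet_derivative f (at w) h) has_derivative Z) (at z)"
      unfolding df Z_def
      by (intro has_derivative_mat_mult has_derivative_ctransp dY mat_derivD[OF Psi])
    have orth: "herm_form (frechet_derivative f (at w) h) (unit_normal sp f w) = 0" for w
    proof -
      have k: "k w = trace (ctransp (X w) ** X w) / 2" and a: "X w $2$2 = - X w $1$1"
        using dX(1)[of w] by (auto simp: k_def entries add_eq_0_iff2 field_simps)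
      have 1: "herm_form (X w) (ctransp (X w) ** X w) = 0"
        by (rule herm_form_mult_left_degenerate[OF dX(2)])
      have 2: "herm_form (ctransp (X w)) (ctransp (X w) ** X w) = 0"
        using arg_cong[OF 1, of cnj] unfolding cnj_herm_form by (simp add: ctransp_mult)
      have "herm_form (X w) (mat 1) = 0" "herm_form (ctransp (X w)) (mat 1) = 0"
        unfolding herm_form_sym[of _ "mat 1"] herm_form_mat1 using dX by simp_all
      with 1 2 have "herm_form (Y w) (\<nu> w) = 0"
        unfolding Y_def \<nu>_def ctransp_cscale by (simp add: herm_form_bilin)
      then show ?thesis unfolding df N tr .
    qed
    have "((\<lambda>w. herm_form (frechet_derivative f (at w) h) (unit_normal sp f w)) has_derivative
      (\<lambda>l. herm_form (frechet_derivative f (at z) h) (frechet_derivative (unit_normal sp f) (at z) l) + herm_form (Z l) (unit_normal sp f z))) (at z)"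
      by (intro has_derivative_herm_form dfd dN)
    then have "((\<lambda>w. 0) has_derivative (\<lambda>l. herm_form (frechet_derivative f (at z) h) (frechet_derivative (unit_normal sp f) (at z) l) + herm_form (Z l) (unit_normal sp f z))) (at z)"
      unfolding orth .
    from has_derivative_of_const[OF this, of h]
    have main: "- herm_form (frechet_derivative f (at z) h) (frechet_derivative (unit_normal sp f) (at z) h) = herm_form (Z h) (unit_normal sp f z)"
      by (simp add: add_eq_0_iff)
    define W where "W = cscale (h\<^sup>2) (X' z) + ctransp (cscale (h\<^sup>2) (X' z)) + cscale (2 * H * (h * cnj h)) (ctransp (X z) ** X z)"
    have YX: "Y z ** X z = cscale (cnj h) (ctransp (X z) ** X z)"
      unfolding Y_def by (simp add: mat_distrib cscale_mult_left XX ctransp_cscale)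
    have XY: "ctransp (X z) ** Y z = cscale h (ctransp (X z) ** X z)"
    proof -
      have "ctransp (X z) ** ctransp (X z) = 0" using arg_cong[OF XX[of z], of ctransp]
        by (simp add: ctransp_mult entries)
      then show ?thesis unfolding Y_def by (simp add: mat_distrib cscale_mult_right ctransp_cscale)
    qed
    have Hr: "cnj H = H" by (simp add: H_def)
    have "Z h = ctransp (\<Psi> z) ** (cscale (h * H) (Y z ** X z) + (cscale h (cscale h (X' z)) + ctransp (cscale h (cscale h (X' z))))
         + cscale (cnj h * H) (ctransp (X z) ** Y z)) ** \<Psi> z"
      unfolding Z_def ctransp_cscale ctransp_mult Hr
      by (simp only: mat_distrib cscale_mult_left cscale_mult_right cscale_cscale matrix_mul_assoc add_ac)
    also have "\<dots> = ctransp (\<Psi> z) ** W ** \<Psi> z"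
      unfolding YX XY W_def by (rule arg_cong[of _ _ "\<lambda>x. ctransp (\<Psi> z) ** x ** \<Psi> z"])
        (simp add: entries power2_eq_square algebra_simps)
    finally have "herm_form (Z h) (unit_normal sp f z) = herm_form W (\<nu> z)" unfolding N using tr by simp
    also have "\<dots> = herm_form (X' z) (\<nu> z) * h\<^sup>2 + cnj (herm_form (X' z) (\<nu> z)) * (cnj h)\<^sup>2 + H * (h * cnj h) * (2 * k z)"
      unfolding W_def cnj_herm_form nuh ctransp_cscale by (simp add: herm_form_bilin nuk)
    also have "h * cnj h = of_real ((cmod h)\<^sup>2)" by (rule complex_norm_square[symmetric])
    finally show "- herm_form (frechet_derivative f (at z) h) (frechet_derivative (unit_normal sp f) (at z) h) =
         hopf_coeff X X' z * h\<^sup>2 + of_real (cmc_const sp) * (metric_coeff f z * of_real ((cmod h)\<^sup>2)) +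
         cnj (hopf_coeff X X' z) * (cnj h)\<^sup>2"
      unfolding main met hopf_coeff_def \<nu>_def k_def H_def by (simp add: algebra_simps)
  qed
qed

lemma hol_data_compose:
  assumes D: "hol_data sp f X \<Psi>" and g: "\<And>z. (g has_field_derivative g' z) (at z)" and g': "\<And>z. g' z \<noteq> 0"
    and g'': "\<And>z. (g' has_field_derivative g'' z) (at z)"
  shows "hol_data sp (\<lambda>z. f (g z)) (\<lambda>z. cscale (g' z) (X (g z))) (\<lambda>z. \<Psi> (g z))"
proof -
  obtain X' where X': "mat_deriv X X'" using D by (auto simp: hol_data_def)
  have Psi: "mat_deriv \<Psi> (\<lambda>z. cscale (of_real (cmc_const sp)) (X z ** \<Psi> z))"
    using D by (auto simp: hol_data_def)
  have df: "(f has_derivative (\<lambda>h. ctransp (\<Psi> z) ** (cscale h (X z) + ctransp (cscale h (X z))) ** \<Psi> z)) (at z)" for z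
    using D by (auto simp: hol_data_def)
  have "\<exists>X'. mat_deriv (\<lambda>z. cscale (g' z) (X (g z))) X'"
    using mat_deriv_cscale[OF g'' mat_deriv_compose[OF g X']] by blast
  moreover have "mat_deriv (\<lambda>z. \<Psi> (g z)) (\<lambda>z. cscale (of_real (cmc_const sp)) (cscale (g' z) (X (g z)) ** \<Psi> (g z)))"
    using mat_deriv_compose[OF g Psi] by (simp add: cscale_cscale cscale_mult_left mult.commute)
  moreover have "((\<lambda>z. f (g z)) has_derivative (\<lambda>h. ctransp (\<Psi> (g z)) ** (cscale h (cscale (g' z) (X (g z))) + ctransp (cscale h (cscale (g' z) (X (g z))))) ** \<Psi> (g z))) (at z)" for z
    using has_derivative_compose[OF g[unfolded has_field_derivative_def] df] by (simp add: cscale_cscale mult.commute)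
  moreover have "det (cscale c A) = c * c * det A" "trace (cscale c A) = c * trace A" "cscale c A = 0 \<longleftrightarrow> c = 0 \<or> A = 0" for c A
    by (auto simp: entries algebra_simps)
  ultimately show ?thesis using D g' unfolding hol_data_def by auto
qed

section \<open>The Enneper data\<close>

definition fps_entire :: "complex fps \<Rightarrow> bool" where
  "fps_entire f \<longleftrightarrow> fps_conv_radius f = \<infinity>"

lemma fps_entire_deriv: "fps_entire f \<Longrightarrow> fps_entire (fps_deriv f)"
  using fps_conv_radius_deriv[of f] by (simp add: fps_entire_def)
lemma fps_entire_mult: "fps_entire f \<Longrightarrow> fps_entire g \<Longrightarrow> fps_entire (f * g)"
  using fps_conv_radius_mult[of f g] by (simp add: fps_entire_def)
lemma fps_entire_add: "fps_entire f \<Longrightarrow> fps_entire g \<Longrightarrow> fps_entire (f + g)"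
  using fps_conv_radius_add[of f g] by (simp add: fps_entire_def)
lemma eval_fps_entire:
  assumes "fps_entire f" "fps_entire g"
  shows "eval_fps (f * g) z = eval_fps f z * eval_fps g z"
    "eval_fps (f + g) z = eval_fps f z + eval_fps g z"
    "(eval_fps f has_field_derivative eval_fps (fps_deriv f) z) (at z)"
  using assms by (auto simp: fps_entire_def eval_fps_mult eval_fps_add intro!: has_field_derivative_eval_fps)

text \<open>The power series with \<open>c\<^sub>k\<^sub>+\<^sub>1 = c\<^sub>k / ((k + 1) N (p + N k))\<close>, a rescaled hypergeometric function
\<open>\<^sub>0F\<^sub>1\<close>. Its first two derivatives at 0 determine the first-order behaviour of the frame in the
spectral parameter.\<close>

lemma bessel_type_entire:
  fixes N p :: real
  assumes "N > 0" "p > 0"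
  obtains F F' F'' :: "complex \<Rightarrow> complex"
  where "\<And>z. (F has_field_derivative F' z) (at z)" "\<And>z. (F' has_field_derivative F'' z) (at z)"
    "F 0 = 1" "F' 0 = 1 / (N * p)" "F'' 0 = 1 / (N\<^sup>2 * p * (p + N))"
    "\<And>t::complex. N * (p * F' t + N * t * F'' t) = F t"
proof -
  define c where "c = rec_nat (1::complex) (\<lambda>k x. x / complex_of_real (real (Suc k) * N * (p + N * real k)))"
  have c0: "c 0 = 1" and cS: "c (Suc k) = c k / complex_of_real (real (Suc k) * N * (p + N * real k))" for k
    by (simp_all add: c_def)
  have pk: "p + N * real k > 0" for k using assms by (simp add: add_pos_nonneg)
  have pos: "real (Suc k) * N * (p + N * real k) > 0" for k using assms pk[of k] by simp
  define f where "f = Abs_fps c"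
  have cle: "norm (c k) \<le> (1 / (N * p)) ^ k / fact k" for k
  proof (induction k)
    case (Suc k)
    have "norm (c (Suc k)) = norm (c k) / (real (Suc k) * (N * (p + N * real k)))"
      unfolding cS norm_divide norm_of_real using pos[of k] by (simp only: abs_of_pos mult.assoc)
    also have "\<dots> \<le> norm (c k) / (real (Suc k) * (N * p))"
      using assms by (intro divide_left_mono mult_left_mono mult_pos_pos pk) auto
    also have "\<dots> \<le> ((1 / (N * p)) ^ k / fact k) / (real (Suc k) * (N * p))"
      using assms Suc by (intro divide_right_mono) auto
    also have "\<dots> = (1 / (N * p)) ^ Suc k / fact (Suc k)"
      using assms by (simp add: field_simps del: of_nat_Suc)
    finally show ?case .
  qed (simp add: c0)
  have ent: "fps_entire f"
  proof -
    have "conv_radius c = \<infinity>"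
    proof (rule conv_radius_inftyI'')
      fix z :: complex
      show "summable (\<lambda>n. c n * z ^ n)"
      proof (rule summable_comparison_test'[of "\<lambda>n. (norm z / (N * p)) ^ n /\<^sub>R fact n" 0])
        show "summable (\<lambda>n. (norm z / (N * p)) ^ n /\<^sub>R fact n)" by (rule summable_exp_generic)
        fix n
        have "norm (c n * z ^ n) \<le> ((1 / (N * p)) ^ n / fact n) * norm z ^ n"
          unfolding norm_mult norm_power by (intro mult_right_mono cle) simp
        also have "\<dots> = (norm z / (N * p)) ^ n /\<^sub>R fact n"
          by (simp add: power_divide power_mult_distrib divide_inverse)
        finally show "norm (c n * z ^ n) \<le> (norm z / (N * p)) ^ n /\<^sub>R fact n" .
      qed
    qed
    then show ?thesis by (simp add: fps_entire_def fps_conv_radius_def f_def)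
  qed
  have const: "fps_entire (fps_const a)" for a by (simp add: fps_entire_def)
  have X: "fps_entire fps_X" by (simp add: fps_entire_def)
  note e' = fps_entire_deriv[OF ent] and e'' = fps_entire_deriv[OF fps_entire_deriv[OF ent]]
  have fnth: "fps_nth f k = c k" for k by (simp add: f_def)
  have cS': "complex_of_real (real (Suc k) * N * (p + N * real k)) * c (Suc k) = c k" for k
    unfolding cS using pos[of k] by (simp only: times_divide_eq_right nonzero_mult_div_cancel_left of_real_eq_0_iff)
  have ode: "fps_const N * (fps_const p * fps_deriv f + fps_const N * (fps_X * fps_deriv (fps_deriv f))) = f"
  proof (rule fps_ext)
    fix k
    show "fps_nth (fps_const N * (fps_const p * fps_deriv f + fps_const N * (fps_X * fps_deriv (fps_deriv f)))) k = fps_nth f k"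
      unfolding fnth cS'[of k, symmetric]
      by (cases k) (simp_all add: fnth algebra_simps)
  qed
  show thesis
  proof (rule that[of "eval_fps f" "eval_fps (fps_deriv f)" "eval_fps (fps_deriv (fps_deriv f))"])
    show "eval_fps f 0 = 1" by (simp add: eval_fps_at_0 fnth c0)
    have c1: "c 1 = 1 / (N * p)" using cS[of 0] by (simp add: c0)
    have c2: "c 2 = 1 / (2 * N\<^sup>2 * p * (p + N))"
      using cS[of 1] c1 by (simp add: numeral_2_eq_2 power2_eq_square mult_ac)
    show "eval_fps (fps_deriv f) 0 = 1 / (N * p)" by (simp add: eval_fps_at_0 fnth c1[unfolded One_nat_def])
    show "eval_fps (fps_deriv (fps_deriv f)) 0 = 1 / (N\<^sup>2 * p * (p + N))"
      using c2 by (simp add: eval_fps_at_0 fnth numeral_2_eq_2)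
    fix t :: complex
    have "eval_fps (fps_const (complex_of_real N) * (fps_const (complex_of_real p) * fps_deriv f + fps_const (complex_of_real N) * (fps_X * fps_deriv (fps_deriv f)))) t
        = N * (p * eval_fps (fps_deriv f) t + N * (t * eval_fps (fps_deriv (fps_deriv f)) t))"
      by (simp add: eval_fps_entire fps_entire_mult fps_entire_add const X e' e'')
    then show "N * (p * eval_fps (fps_deriv f) t + N * t * eval_fps (fps_deriv (fps_deriv f)) t) = eval_fps f t"
      unfolding ode by (simp add: mult.assoc)
  qed (use eval_fps_entire(3)[OF ent ent] eval_fps_entire(3)[OF e' e'] in auto)
qed

text \<open>Liouville's formula \<open>(det \<Phi>)' = tr A det \<Phi>\<close> for trace-free \<open>A\<close>.\<close>

lemma det_const_of_ode:
  assumes "mat_deriv \<Phi> (\<lambda>z. \<Phi> z ** A z)" and tr: "\<And>z. trace (A z) = 0"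
  shows "det (\<Phi> z) = det (\<Phi> 0)"
proof -
  note d = mat_deriv_entry[OF assms(1)]
  have "((\<lambda>z. det (\<Phi> z)) has_field_derivative 0) (at z)" for z
  proof -
    have a: "A z $2$2 = - A z $1$1" using tr[of z] by (simp add: entries add_eq_0_iff2)
    show ?thesis unfolding det_2
      by (rule derivative_eq_intros d refl)+ (simp add: mult_nth a algebra_simps)
  qed
  then have "\<exists>c. \<forall>x\<in>UNIV. det (\<Phi> x) = c"
    by (intro has_field_derivative_zero_constant) auto
  then show ?thesis by auto
qed

lemma adj_trace_free: "trace A = 0 \<Longrightarrow> adjugate2 A = - A"
  by (simp add: entries add_eq_0_iff2)

text \<open>For trace-free \<open>A\<close> the adjugate of \<open>R\<close> is its inverse and solves the adjoint equation, so \<open>P R\<^sup>-\<^sup>1\<close> is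
constant.\<close>

lemma ode_unique:
  assumes P: "mat_deriv P (\<lambda>z. P z ** A z)" and R: "mat_deriv R (\<lambda>z. R z ** A z)"
    and tr: "\<And>z. trace (A z) = 0" and det: "det (R 0) = 1" and init: "P 0 = R 0"
  shows "P z = R z"
proof -
  have det: "det (R z) = 1" for z using det_const_of_ode[OF R tr] det by simp
  have "mat_deriv (\<lambda>z. P z ** adjugate2 (R z)) (\<lambda>z. 0)"
    using mat_deriv_mult[OF P mat_deriv_adj[OF R]]
    by (simp add: adj_mult adj_trace_free[OF tr] mat_mult_uminus matrix_mul_assoc)
  then have "P z ** adjugate2 (R z) = P 0 ** adjugate2 (R 0)"
    by (intro has_derivative_zero_imp_const[where f="\<lambda>z. P z ** adjugate2 (R z)"]) (simp add: mat_deriv_def)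
  also have "\<dots> = mat 1" using adj_inverse[OF det] init by simp
  finally have "P z ** adjugate2 (R z) ** R z = R z" by simp
  then show ?thesis using adj_inverse[OF det] by (simp add: matrix_mul_assoc[symmetric])
qed

lemma lwr_frame_eq:
  assumes P: "\<And>l. mat_deriv (P l) (\<lambda>z. P l z ** \<xi> l z)" and tr: "\<And>l z. trace (\<xi> l z) = 0"
    and init: "\<And>l. P l 0 = mat 1"
  shows "lwr_frame \<xi> 0 (mat 1) = P"
  unfolding lwr_frame_def
proof (rule the_equality)
  have det: "det (P l z) = 1" for l z using det_const_of_ode[OF P tr] by (simp add: init)
  have "matrix_inv (P l z) ** cscale h (P l z ** \<xi> l z) = cscale h (\<xi> l z)" for l h z
    unfolding matrix_inv_eq_adj[OF det] cscale_mult_right by (simp add: adj_cancel[OF det])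
  then show "is_lwr_frame \<xi> 0 (mat 1) P"
    unfolding is_lwr_frame_def using init det mat_derivD[OF P] by blast
next
  fix R assume R: "is_lwr_frame \<xi> 0 (mat 1) R"
  have "mat_deriv (R l) (\<lambda>z. R l z ** \<xi> l z)" for l
    unfolding mat_deriv_def
  proof
    fix z
    obtain D where D: "(R l has_derivative D) (at z)" "\<And>h. matrix_inv (R l z) ** D h = cscale h (\<xi> l z)"
      and det: "det (R l z) = 1" using R unfolding is_lwr_frame_def by blast
    have "D h = cscale h (R l z ** \<xi> l z)" for h
    proof -
      have "R l z ** (adjugate2 (R l z) ** D h) = R l z ** cscale h (\<xi> l z)"
        using D(2)[of h] unfolding matrix_inv_eq_adj[OF det] by simp
      then show ?thesis unfolding adj_cancel[OF det] cscale_mult_right .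
    qed
    then have "D = (\<lambda>h. cscale h (R l z ** \<xi> l z))" by (rule ext)
    then show "(R l has_derivative (\<lambda>h. cscale h (R l z ** \<xi> l z))) (at z)" using D(1) by simp
  qed
  then have "R l z = P l z" for l z
    using P tr by (rule ode_unique) (use init R in \<open>auto simp: is_lwr_frame_def\<close>)
  then show "R = P" by (intro ext)
qed

lemma hol_data_Euc3I:
  assumes "mat_deriv X X'" "\<And>z. det (X z) = 0" "\<And>z. trace (X z) = 0" "\<And>z. X z \<noteq> 0"
    "\<And>z. f z \<in> space_of Euc3" "\<And>z. (f has_derivative (\<lambda>h. cscale h (X z) + ctransp (cscale h (X z)))) (at z)"
  shows "hol_data Euc3 f X (\<lambda>z. mat 1)"
  unfolding hol_data_def using assms mat_deriv_const[of "mat 1"] by (auto simp: cmc_const_def)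

lemma star_mult_pos:
  assumes "det A = 1"
  shows "ctransp A ** A \<in> space_of Hyp3"
proof -
  have "A \<noteq> 0" using assms by (auto simp: entries)
  then have "Re (trace (ctransp A ** A)) > 0"
    by (auto simp: entries mult.commute[of "cnj _"] complex_norm_square[symmetric] add_nonneg_pos add_pos_nonneg simp flip: of_real_power)
  then show ?thesis using assms by (simp add: hermitian_def ctransp_mult det_mul)
qed

lemma hol_data_Hyp3I:
  assumes X: "mat_deriv X X'" and Psi: "mat_deriv \<Psi> (\<lambda>z. X z ** \<Psi> z)" and "\<And>z. det (X z) = 0" "\<And>z. trace (X z) = 0" "\<And>z. X z \<noteq> 0"
    and det: "\<And>z. det (\<Psi> z) = 1" and f: "\<And>z. f z = ctransp (\<Psi> z) ** \<Psi> z"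
  shows "hol_data Hyp3 f X \<Psi>"
proof -
  have "(f has_derivative (\<lambda>h. ctransp (\<Psi> z) ** (cscale h (X z) + ctransp (cscale h (X z))) ** \<Psi> z)) (at z)" for z
  proof -
    have "ctransp (\<Psi> z) ** cscale h (X z ** \<Psi> z) + ctransp (cscale h (X z ** \<Psi> z)) ** \<Psi> z
       = ctransp (\<Psi> z) ** (cscale h (X z) + ctransp (cscale h (X z))) ** \<Psi> z" for h
      by (simp add: mat_distrib cscale_mult_left cscale_mult_right ctransp_cscale ctransp_mult matrix_mul_assoc)
    then show ?thesis unfolding f[abs_def] using has_derivative_star_mult[OF Psi Psi, of z] by simp
  qed
  then show ?thesis unfolding hol_data_def using assms star_mult_pos[OF det] by (auto simp: cmc_const_def)
qed

definition enneper_b :: "real \<Rightarrow> nat \<Rightarrow> complex \<Rightarrow> complex" where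
  "enneper_b r n z = of_real r * z ^ (n + 1) / of_nat (n + 1)"

text \<open>With \<open>b = \<integral> r z\<^sup>n dz\<close> and \<open>\<Phi>\<^sub>0\<close> unipotent with upper right entry \<open>b\<close>, this is \<open>\<plusminus> \<Phi>\<^sub>0 E \<Phi>\<^sub>0\<^sup>-\<^sup>1\<close>, where
\<open>E = \<partial>\<^sub>\<lambda> \<xi>\<close> has lower left entry 1. The sign is that of \<open>\<lambda>\<^sub>1 - \<lambda>\<^sub>0\<close>.\<close>

definition enneper_X :: "ambient \<Rightarrow> real \<Rightarrow> nat \<Rightarrow> complex \<Rightarrow> cmat2" where
  "enneper_X sp r n z = cscale (case sp of Euc3 \<Rightarrow> 1 | Hyp3 \<Rightarrow> -1)
     (mk2 (enneper_b r n z) (- (enneper_b r n z)\<^sup>2) 1 (- enneper_b r n z))"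

lemma power_Suc_deriv:
  "((\<lambda>z::complex. z ^ (m + 1)) has_field_derivative of_nat (m + 1) * z ^ m) (at z)"
  using DERIV_power_Suc[OF DERIV_ident[where F="at z"], of m] by simp

lemma enneper_b_deriv: "(enneper_b r n has_field_derivative of_real r * z ^ n) (at z)"
proof -
  have nz: "complex_of_nat (n + 1) \<noteq> 0" by (simp only: of_nat_eq_0_iff)
  have "(enneper_b r n has_field_derivative of_real r * (of_nat (n + 1) * z ^ n) / of_nat (n + 1)) (at z)"
    unfolding enneper_b_def by (intro DERIV_cdivide DERIV_cmult power_Suc_deriv)
  then show ?thesis using nz by simp
qed

definition enneper_X' :: "ambient \<Rightarrow> real \<Rightarrow> nat \<Rightarrow> complex \<Rightarrow> cmat2" where
  "enneper_X' sp r n z = cscale ((case sp of Euc3 \<Rightarrow> 1 | Hyp3 \<Rightarrow> -1) * (of_real r * z ^ n))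
     (mk2 1 (- 2 * enneper_b r n z) 0 (-1))"

lemma mat_deriv_mk2:
  assumes "\<And>z. (a has_field_derivative a' z) (at z)" "\<And>z. (b has_field_derivative b' z) (at z)"
     "\<And>z. (c has_field_derivative c' z) (at z)" "\<And>z. (d has_field_derivative d' z) (at z)"
  shows "mat_deriv (\<lambda>z. mk2 (a z) (b z) (c z) (d z)) (\<lambda>z. mk2 (a' z) (b' z) (c' z) (d' z))"
  unfolding mat_deriv_entries_iff forall_2 using assms by simp

lemma enneper_X_deriv: "mat_deriv (enneper_X sp r n) (enneper_X' sp r n)"
proof -
  define e :: complex where "e = (case sp of Euc3 \<Rightarrow> 1 | Hyp3 \<Rightarrow> -1)"
  have "mat_deriv (\<lambda>z. mk2 (enneper_b r n z) (- (enneper_b r n z)\<^sup>2) 1 (- enneper_b r n z))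
     (\<lambda>z. mk2 (of_real r * z ^ n) (- (2 * enneper_b r n z * (of_real r * z ^ n))) 0 (- (of_real r * z ^ n)))"
    by (rule mat_deriv_mk2) (auto intro!: derivative_eq_intros enneper_b_deriv)
  from mat_deriv_cscale[OF DERIV_const[of e] this]
  have "mat_deriv (enneper_X sp r n) (\<lambda>z. cscale e (mk2 (of_real r * z ^ n) (- (2 * enneper_b r n z * (of_real r * z ^ n))) 0 (- (of_real r * z ^ n))))"
    unfolding enneper_X_def e_def[symmetric] by simp
  moreover have "(\<lambda>z. cscale e (mk2 (of_real r * z ^ n) (- (2 * enneper_b r n z * (of_real r * z ^ n))) 0 (- (of_real r * z ^ n)))) = enneper_X' sp r n"
    unfolding enneper_X'_def e_def[symmetric] by (simp add: entries fun_eq_iff)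
  ultimately show ?thesis by simp
qed

lemma enneper_X_null: "det (enneper_X sp r n z) = 0" "trace (enneper_X sp r n z) = 0" "enneper_X sp r n z \<noteq> 0"
  by (cases sp; simp add: enneper_X_def entries power2_eq_square)+

text \<open>A row \<open>(a, c)\<close> of the frame satisfies \<open>a' = \<lambda> c\<close> and \<open>c' = r z\<^sup>n a\<close>, hence \<open>a'' = \<lambda> r z\<^sup>n a\<close>. The two
rows are \<open>a = F(t)\<close> and \<open>a = \<lambda> z G(t)\<close> for functions \<open>F\<close>, \<open>G\<close> of the single variable
\<open>t = r \<lambda> z\<^sup>n\<^sup>+\<^sup>2\<close>. This makes the dependence on \<open>\<lambda>\<close> explicit, and in particular the derivatives at
\<open>\<lambda> = 0\<close> that enter the Euclidean immersion.\<close>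

lemma enneper_frame:
  obtains P :: "complex \<Rightarrow> complex \<Rightarrow> cmat2" where "\<And>l. mat_deriv (P l) (\<lambda>z. P l z ** enneper_potential r n l z)"
    "\<And>l. P l 0 = mat 1" "\<And>z::complex. P 0 z = mk2 1 (enneper_b r n z) 0 1"
    "\<And>z::complex. ((\<lambda>l::complex. P l z $ 1 $ 1) has_field_derivative complex_of_real r * z ^ (n+2) / (of_nat (n+2) * of_nat (n+1))) (at 0)"
    "\<And>z::complex. ((\<lambda>l::complex. P l z $ 1 $ 2) has_field_derivative (complex_of_real r)\<^sup>2 * z ^ (2*n+3) / (of_nat (n+2) * of_nat (n+1) * of_nat (2*n+3))) (at 0)"
    "\<And>z::complex. ((\<lambda>l::complex. P l z $ 2 $ 1) has_field_derivative z) (at 0)"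
    "\<And>z::complex. ((\<lambda>l::complex. P l z $ 2 $ 2) has_field_derivative complex_of_real r * z ^ (n+2) / of_nat (n+2)) (at 0)"
proof -
  define N where "N = real (n + 2)"
  define p where "p = real (n + 1)"
  define q where "q = real (n + 3)"
  have pos: "N > 0" "p > 0" "q > 0" by (simp_all add: N_def p_def q_def)
  obtain F F' F'' :: "complex \<Rightarrow> complex" where F: "\<And>z. (F has_field_derivative F' z) (at z)" "\<And>z. (F' has_field_derivative F'' z) (at z)"
    "F 0 = 1" "F' 0 = 1 / (N * p)" "F'' 0 = 1 / (N\<^sup>2 * p * (p + N))"
    "\<And>t::complex. N * (p * F' t + N * t * F'' t) = F t" using bessel_type_entire[OF pos(1,2)] by metis
  obtain G G' G'' :: "complex \<Rightarrow> complex" where G: "\<And>z. (G has_field_derivative G' z) (at z)" "\<And>z. (G' has_field_derivative G'' z) (at z)"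
    "G 0 = 1" "G' 0 = 1 / (N * q)" 
    "\<And>t::complex. N * (q * G' t + N * t * G'' t) = G t" using bessel_type_entire[OF pos(1,3)] by metis
  define P where "P = (\<lambda>(l::complex) (z::complex). mk2 (F (r * l * z ^ (n+2))) (r * z ^ (n+1) * N * F' (r * l * z ^ (n+2)))
       (l * z * G (r * l * z ^ (n+2))) (G (r * l * z ^ (n+2)) + N * (r * l * z ^ (n+2)) * G' (r * l * z ^ (n+2))))"
  have t: "((\<lambda>z. r * l * z ^ (n+2)) has_field_derivative r * l * (N * z ^ (n+1))) (at z)" for l z :: complex
    using DERIV_cmult[OF power_Suc_deriv[of "n+1" z], of "r * l"] by (simp add: N_def)
  note chain = DERIV_chain2[OF F(1) t] DERIV_chain2[OF F(2) t] DERIV_chain2[OF G(1) t] DERIV_chain2[OF G(2) t]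
  have pw: "((\<lambda>z::complex. z ^ (n+1)) has_field_derivative p * z ^ n) (at z)" for z
    using power_Suc_deriv[of n z] by (simp add: p_def)
  show thesis
  proof (rule that[of P])
    fix l :: complex
    define E where "E = (\<lambda>z::complex. mk2 (F' (r * l * z ^ (n+2)) * (r * l * (N * z ^ (n+1))))
       (r * (p * z ^ n) * N * F' (r * l * z ^ (n+2)) + r * z ^ (n+1) * N * (F'' (r * l * z ^ (n+2)) * (r * l * (N * z ^ (n+1)))))
       (l * G (r * l * z ^ (n+2)) + l * z * (G' (r * l * z ^ (n+2)) * (r * l * (N * z ^ (n+1)))))
       (G' (r * l * z ^ (n+2)) * (r * l * (N * z ^ (n+1))) +
         (N * (r * l * (N * z ^ (n+1))) * G' (r * l * z ^ (n+2)) + N * (r * l * z ^ (n+2)) * (G'' (r * l * z ^ (n+2)) * (r * l * (N * z ^ (n+1)))))))"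
    have "mat_deriv (P l) E"
      unfolding P_def E_def
      by (rule mat_deriv_mk2, rule chain) (((rule t chain pw derivative_eq_intros refl)+, simp add: algebra_simps p_def)+)
    moreover have "E = (\<lambda>z::complex. P l z ** enneper_potential r n l z)"
    proof (rule ext)
      fix z :: complex
      define t where "t = r * l * z ^ (n+2)"
      have pot: "enneper_potential r n l z = mk2 0 (r * z ^ n) l 0" by (simp add: enneper_potential_def mk2_def)
      have tt: "r * l * (N * z ^ (n+1)) * z = N * t" "z ^ (n+1) * (r * l * (N * z ^ (n+1))) = z ^ n * (N * t)"
        by (simp_all add: t_def)
      have Ft: "F t = N * (p * F' t + N * t * F'' t)" using F(6) by simp
      have Gt: "G t = N * (q * G' t + N * t * G'' t)" using G(5) by simp
      have qN: "complex_of_real q = 1 + N" by (simp add: q_def N_def)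
      have z2: "r * z ^ n * (l * z) = r * l * z ^ (n+1)" by simp
      show "E z = P l z ** enneper_potential r n l z"
        unfolding pot P_def E_def t_def[symmetric] cmat2_eq_iff mult_nth mk2_nth
      proof (intro conjI)
        show "F' t * (r * l * (N * z ^ (n+1))) = F t * 0 + r * z ^ (n+1) * N * F' t * l" by simp
        have "r * (p * z ^ n) * N * F' t + r * z ^ (n+1) * N * (F'' t * (r * l * (N * z ^ (n+1))))
           = r * N * (p * z ^ n * F' t + F'' t * (z ^ (n+1) * (r * l * (N * z ^ (n+1)))))" by (simp add: algebra_simps)
        also have "\<dots> = r * z ^ n * F t" unfolding tt(2) Ft by (simp add: algebra_simps)
        finally show "r * (p * z ^ n) * N * F' t + r * z ^ (n+1) * N * (F'' t * (r * l * (N * z ^ (n+1))))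
           = F t * (r * z ^ n) + r * z ^ (n+1) * N * F' t * 0" by simp
        have "l * z * (G' t * (r * l * (N * z ^ (n+1)))) = l * G' t * (r * l * (N * z ^ (n+1)) * z)" by (simp add: algebra_simps)
        then show "l * G t + l * z * (G' t * (r * l * (N * z ^ (n+1)))) = l * z * G t * 0 + (G t + N * t * G' t) * l"
          unfolding tt(1) by (simp add: algebra_simps)
        have "G' t * (r * l * (N * z ^ (n+1))) + (N * (r * l * (N * z ^ (n+1))) * G' t + N * t * (G'' t * (r * l * (N * z ^ (n+1)))))
          = (r * l * z ^ (n+1)) * (N * (q * G' t + N * t * G'' t))" unfolding qN by (simp add: algebra_simps)
        also have "\<dots> = r * z ^ n * (l * z) * G t" unfolding Gt[symmetric] z2 ..
        finally show "G' t * (r * l * (N * z ^ (n+1))) + (N * (r * l * (N * z ^ (n+1))) * G' t + N * t * (G'' t * (r * l * (N * z ^ (n+1)))))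
          = l * z * G t * (r * z ^ n) + (G t + N * t * G' t) * 0" by (simp add: algebra_simps)
      qed
    qed
    ultimately show "mat_deriv (P l) (\<lambda>z. P l z ** enneper_potential r n l z)" by simp
    show "P l 0 = mat 1" by (simp add: P_def entries F G)
  next
    fix z :: complex
    have nz: "complex_of_real N \<noteq> 0" "complex_of_real p \<noteq> 0" "complex_of_real q \<noteq> 0" using pos by simp_all
    have of: "of_nat (n+2) = complex_of_real N" "of_nat (n+1) = complex_of_real p" "complex_of_real q = N + 1"
       "of_nat (2*n+3) = complex_of_real (p + N)" by (simp_all add: N_def p_def q_def)
    show "P 0 z = mk2 1 (enneper_b r n z) 0 1"
      unfolding enneper_b_def of using nz by (simp add: P_def F G)
    have t: "((\<lambda>l. r * l * z ^ (n+2)) has_field_derivative r * z ^ (n+2)) (at 0)"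
      by (auto intro!: derivative_eq_intros)
    have t0: "complex_of_real r * 0 * z ^ (n+2) = 0" by simp
    note chain = DERIV_chain2[where g="\<lambda>l. r * l * z ^ (n+2)" and x=0, OF F(1) t] DERIV_chain2[where g="\<lambda>l. r * l * z ^ (n+2)" and x=0, OF F(2) t]
        DERIV_chain2[where g="\<lambda>l. r * l * z ^ (n+2)" and x=0, OF G(1) t] DERIV_chain2[where g="\<lambda>l. r * l * z ^ (n+2)" and x=0, OF G(2) t]
    note chain = chain[unfolded t0]
    show "((\<lambda>l::complex. P l z $ 1 $ 1) has_field_derivative complex_of_real r * z ^ (n+2) / (of_nat (n+2) * of_nat (n+1))) (at 0)"
      unfolding P_def mk2_nth of using chain(1) by (simp add: F)
    show "((\<lambda>l::complex. P l z $ 1 $ 2) has_field_derivative (complex_of_real r)\<^sup>2 * z ^ (2*n+3) / (of_nat (n+2) * of_nat (n+1) * of_nat (2*n+3))) (at 0)"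
    proof -
      have "((\<lambda>l::complex. P l z $ 1 $ 2) has_field_derivative r * z ^ (n+1) * N * (F'' 0 * (r * z ^ (n+2)))) (at 0)"
        unfolding P_def mk2_nth by (rule DERIV_cmult[OF chain(2)])
      moreover have "z ^ (2*n+3) = z ^ (n+1) * z ^ (n+2)" by (simp add: power_add[symmetric] mult_2 eval_nat_numeral)
      moreover have "r * z ^ (n+1) * N * (F'' 0 * (r * z ^ (n+2))) = r\<^sup>2 * (z ^ (n+1) * z ^ (n+2)) / (N * p * complex_of_real (p + N))"
        unfolding F(5) using nz by (simp add: power2_eq_square mult_ac)
      ultimately show ?thesis unfolding of by simp
    qed
    show "((\<lambda>l::complex. P l z $ 2 $ 1) has_field_derivative z) (at 0)"
      unfolding P_def mk2_nth by (rule derivative_eq_intros chain refl)+ (simp add: G)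
    have "((\<lambda>l::complex. P l z $ 2 $ 2) has_field_derivative G' 0 * (r * z ^ (n+2)) + N * (r * z ^ (n+2)) * G' 0) (at 0)"
      unfolding P_def mk2_nth by (rule derivative_eq_intros chain refl)+ simp
    moreover have "G' 0 * (r * z ^ (n+2)) + N * (r * z ^ (n+2)) * G' 0 = r * z ^ (n+2) / N * (q * inverse q)"
    proof -
      have "G' 0 * (r * z ^ (n+2)) + N * (r * z ^ (n+2)) * G' 0 = G' 0 * (r * z ^ (n+2)) * q"
        unfolding of(3) by (simp add: algebra_simps)
      then show ?thesis unfolding G(4) by (simp add: divide_inverse mult_ac)
    qed
    ultimately show "((\<lambda>l::complex. P l z $ 2 $ 2) has_field_derivative complex_of_real r * z ^ (n+2) / of_nat (n+2)) (at 0)"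
      unfolding of using nz by simp
  qed
qed

lemma trace_enneper_potential: "trace (enneper_potential r n l z) = 0"
  by (simp add: enneper_potential_def trace_2)

text \<open>For \<open>\<Psi> = \<Phi>\<^sub>0 \<Phi>\<^sub>1\<^sup>-\<^sup>1\<close> (indices are values of \<open>\<lambda>\<close>) one has \<open>\<Psi>\<^sub>z = \<Phi>\<^sub>0 (\<xi>\<^sub>0 - \<xi>\<^sub>1) \<Phi>\<^sub>1\<^sup>-\<^sup>1\<close>, so
\<open>\<Psi>\<^sub>z \<Psi>\<^sup>-\<^sup>1 = \<Phi>\<^sub>0 (\<xi>\<^sub>0 - \<xi>\<^sub>1) \<Phi>\<^sub>0\<^sup>-\<^sup>1\<close> involves only the elementary frame at \<open>\<lambda> = 0\<close>.\<close>

lemma hol_data_enneper_Hyp3: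
  obtains \<Psi> where "hol_data Hyp3 (enneper_lwr Hyp3 r n) (enneper_X Hyp3 r n) \<Psi>"
proof -
  obtain P :: "complex \<Rightarrow> complex \<Rightarrow> cmat2" where P: "\<And>l. mat_deriv (P l) (\<lambda>z. P l z ** enneper_potential r n l z)"
    "\<And>l. P l 0 = mat 1" "\<And>z::complex. P 0 z = mk2 1 (enneper_b r n z) 0 1"
    by (rule enneper_frame[of r n]) blast
  have det: "det (P l z) = 1" for l z
    using det_const_of_ode[OF P(1) trace_enneper_potential] by (simp add: P(2))
  define \<Psi> where "\<Psi> = (\<lambda>z. P 0 z ** adjugate2 (P 1 z))"
  define f where "f = enneper_lwr Hyp3 r n"
  have f: "f z = ctransp (\<Psi> z) ** \<Psi> z" for z
    unfolding f_def enneper_lwr_def lwr_frame_eq[where \<xi>="enneper_potential r n" and P=P, OF P(1) trace_enneper_potential P(2)]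
    by (simp add: \<Psi>_def matrix_inv_eq_adj[OF det] Let_def)
  have X: "enneper_X Hyp3 r n z = P 0 z ** (enneper_potential r n 0 z - enneper_potential r n 1 z) ** adjugate2 (P 0 z)" for z
    unfolding P(3) by (simp add: enneper_X_def enneper_potential_def entries power2_eq_square)
  have dPsi: "mat_deriv \<Psi> (\<lambda>z. enneper_X Hyp3 r n z ** \<Psi> z)"
  proof -
    have "mat_deriv \<Psi> (\<lambda>z. P 0 z ** adjugate2 (P 1 z ** enneper_potential r n 1 z) + P 0 z ** enneper_potential r n 0 z ** adjugate2 (P 1 z))"
      unfolding \<Psi>_def by (rule mat_deriv_mult[OF P(1) mat_deriv_adj[OF P(1)]])
    moreover have "P 0 z ** adjugate2 (P 1 z ** enneper_potential r n 1 z) + P 0 z ** enneper_potential r n 0 z ** adjugate2 (P 1 z)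
       = enneper_X Hyp3 r n z ** \<Psi> z" for z
    proof -
      have "enneper_X Hyp3 r n z ** \<Psi> z = P 0 z ** (enneper_potential r n 0 z - enneper_potential r n 1 z) ** (adjugate2 (P 0 z) ** P 0 z) ** adjugate2 (P 1 z)"
        unfolding X \<Psi>_def by (simp only: matrix_mul_assoc)
      then show ?thesis
        using adj_inverse[OF det[of 0 z]] by (simp add: adj_mult adj_trace_free[OF trace_enneper_potential] mat_mult_uminus mat_mult_diff matrix_mul_assoc)
    qed
    ultimately show ?thesis by simp
  qed
  have dP: "det (\<Psi> z) = 1" for z by (simp add: \<Psi>_def det_mul det)
  have "hol_data Hyp3 f (enneper_X Hyp3 r n) \<Psi>"
    by (rule hol_data_Hyp3I[OF enneper_X_deriv dPsi _ _ _ dP f]) (rule enneper_X_null)+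
  then show thesis using that unfolding f_def by blast
qed

text \<open>The \<open>\<lambda>\<close>-derivatives of the frame give \<open>\<psi>\<close> as a matrix of monomials, which is a primitive of the
data.\<close>

lemma hol_data_enneper_Euc3: "hol_data Euc3 (enneper_lwr Euc3 r n) (enneper_X Euc3 r n) (\<lambda>z. mat 1)"
proof -
  obtain P :: "complex \<Rightarrow> complex \<Rightarrow> cmat2" where P: "\<And>l. mat_deriv (P l) (\<lambda>z. P l z ** enneper_potential r n l z)"
    "\<And>l. P l 0 = mat 1" "\<And>z::complex. P 0 z = mk2 1 (enneper_b r n z) 0 1"
    "\<And>z::complex. ((\<lambda>l::complex. P l z $ 1 $ 1) has_field_derivative complex_of_real r * z ^ (n+2) / (of_nat (n+2) * of_nat (n+1))) (at 0)"
    "\<And>z::complex. ((\<lambda>l::complex. P l z $ 1 $ 2) has_field_derivative (complex_of_real r)\<^sup>2 * z ^ (2*n+3) / (of_nat (n+2) * of_nat (n+1) * of_nat (2*n+3))) (at 0)"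
    "\<And>z::complex. ((\<lambda>l::complex. P l z $ 2 $ 1) has_field_derivative z) (at 0)"
    "\<And>z::complex. ((\<lambda>l::complex. P l z $ 2 $ 2) has_field_derivative complex_of_real r * z ^ (n+2) / of_nat (n+2)) (at 0)"
    by (rule enneper_frame[of r n]) blast
  have det: "det (P l z) = 1" for l z
    using det_const_of_ode[OF P(1) trace_enneper_potential] by (simp add: P(2))
  define N p q :: complex where "N = of_nat (n+2)" "p = of_nat (n+1)" "q = of_nat (2*n+3)"
  have nz: "N \<noteq> 0" "p \<noteq> 0" "q \<noteq> 0" unfolding N_p_q_def of_nat_eq_0_iff by simp_all
  have rel: "N = p + 1" "q = 2 * p + 1" by (simp_all add: N_p_q_def)
  define \<psi> where "\<psi> = (\<lambda>z::complex. mk2 (r * z ^ (n+2) / (N * p)) (- (r\<^sup>2 * z ^ (2*n+3) / (p\<^sup>2 * q))) z (- (r * z ^ (n+2) / (N * p))))"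
  define f where "f = enneper_lwr Euc3 r n"
  have f: "f z = \<psi> z + ctransp (\<psi> z)" for z
  proof -
    define D where "D = (\<chi> i j. deriv (\<lambda>l. P l z $ i $ j) 0)"
    have D: "D = mk2 (r * z ^ (n+2) / (N * p)) (r\<^sup>2 * z ^ (2*n+3) / (N * p * q)) z (r * z ^ (n+2) / N)"
      unfolding D_def cmat2_eq_iff using P(4-7)[of z, THEN DERIV_imp_deriv] by (simp add: N_p_q_def)
    have b: "enneper_b r n z = r * z ^ (n+1) / p" by (simp add: enneper_b_def N_p_q_def)
    have "D ** matrix_inv (P 0 z) = D ** mk2 1 (- enneper_b r n z) 0 1"
    proof -
      have "adjugate2 (mk2 1 (enneper_b r n z) 0 1) = mk2 1 (- enneper_b r n z) 0 1" by (simp add: entries)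
      then show ?thesis unfolding matrix_inv_eq_adj[OF det] unfolding P(3) by simp
    qed
    also have "\<dots> = \<psi> z"
    proof -
      have z3: "z ^ (2*n+3) = z ^ (n+2) * z ^ (n+1)" by (simp add: power_add[symmetric] mult_2 eval_nat_numeral)
      have e12: "r * z ^ (n+2) / (N * p) * - (r * z ^ (n+1) / p) + r\<^sup>2 * z ^ (2*n+3) / (N * p * q) = - (r\<^sup>2 * z ^ (2*n+3) / (p\<^sup>2 * q))"
      proof -
        have k: "- 1 / (N * p * p) + 1 / (N * p * q) = - (1 / (p\<^sup>2 * q))"
          using nz by (simp add: field_simps power2_eq_square) (simp add: rel distrib_left distrib_right mult_ac)
        have "r * z ^ (n+2) / (N * p) * - (r * z ^ (n+1) / p) + r\<^sup>2 * z ^ (2*n+3) / (N * p * q)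
          = r\<^sup>2 * z ^ (2*n+3) * (- 1 / (N * p * p) + 1 / (N * p * q))"
          unfolding z3 by (simp add: algebra_simps power2_eq_square)
        then show ?thesis unfolding k by simp
      qed
      have e22: "z * - (r * z ^ (n+1) / p) + r * z ^ (n+2) / N = - (r * z ^ (n+2) / (N * p))"
      proof -
        have "1 / N - 1 / p = (p - N) / (N * p)" using nz by (simp add: diff_frac_eq)
        moreover have "p - N = - 1" by (simp add: rel)
        ultimately have k: "1 / N - 1 / p = - (1 / (N * p))" by simp
        have "z * - (r * z ^ (n+1) / p) + r * z ^ (n+2) / N = r * z ^ (n+2) * (1 / N - 1 / p)" by (simp add: algebra_simps)
        then show ?thesis unfolding k by simp
      qed
      show ?thesis unfolding cmat2_eq_iff mult_nth D \<psi>_def b mk2_nth using e12 e22 by simp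
    qed
    finally have "D ** matrix_inv (P 0 z) = \<psi> z" .
    then show ?thesis
      unfolding f_def enneper_lwr_def lwr_frame_eq[where \<xi>="enneper_potential r n" and P=P, OF P(1) trace_enneper_potential P(2)]
      by (simp add: Let_def D_def)
  qed
  have d: "mat_deriv \<psi> (enneper_X Euc3 r n)"
  proof -
    have pw: "((\<lambda>z. z ^ (n+2)) has_field_derivative N * z ^ (n+1)) (at z)" for z
      using power_Suc_deriv[of "n+1" z] by (simp add: N_p_q_def)
    have pw2: "((\<lambda>z. z ^ (2*n+3)) has_field_derivative q * (z ^ (n+1) * z ^ (n+1))) (at z)" for z
    proof -
      have 1: "z ^ (n+1) * z ^ (n+1) = z ^ (2*n+2)" unfolding power_add[symmetric] by (rule arg_cong) simp
      have 2: "2*n+3 = (2*n+2) + 1" by simp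
      show ?thesis using power_Suc_deriv[of "2*n+2" z] unfolding 1 N_p_q_def 2 .
    qed
    have "mat_deriv \<psi> (\<lambda>z. mk2 (r * (N * z ^ (n+1)) / (N * p)) (- (r\<^sup>2 * (q * (z ^ (n+1) * z ^ (n+1))) / (p\<^sup>2 * q))) 1 (- (r * (N * z ^ (n+1)) / (N * p))))"
      unfolding \<psi>_def by (intro mat_deriv_mk2 DERIV_minus DERIV_cdivide DERIV_cmult pw pw2 DERIV_ident)
    moreover have "mk2 (r * (N * z ^ (n+1)) / (N * p)) (- (r\<^sup>2 * (q * (z ^ (n+1) * z ^ (n+1))) / (p\<^sup>2 * q))) 1 (- (r * (N * z ^ (n+1)) / (N * p))) = enneper_X Euc3 r n z" for z
    proof -
      have b: "enneper_b r n z = r * z ^ (n+1) / p" by (simp only: enneper_b_def N_p_q_def)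
      show ?thesis unfolding enneper_X_def b using nz by (simp add: entries power2_eq_square)
    qed
    ultimately show ?thesis by simp
  qed
  have "hol_data Euc3 f (enneper_X Euc3 r n) (\<lambda>z. mat 1)"
  proof (rule hol_data_Euc3I[OF enneper_X_deriv])
    show "f z \<in> space_of Euc3" for z
      by (simp add: f hermitian_def ctransp_add add.commute) (simp add: trace_2 \<psi>_def ctransp_nth)
    show "(f has_derivative (\<lambda>h. cscale h (enneper_X Euc3 r n z) + ctransp (cscale h (enneper_X Euc3 r n z)))) (at z)" for z
      unfolding f[abs_def] by (intro has_derivative_add has_derivative_ctransp mat_derivD d)
  qed (rule enneper_X_null)+
  then show ?thesis unfolding f_def .
qed

lemma hol_data_enneper:
  obtains \<Psi> where "hol_data sp (enneper_lwr sp r n) (enneper_X sp r n) \<Psi>"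
  by (cases sp) (use hol_data_enneper_Euc3 hol_data_enneper_Hyp3 in blast)+

lemma herm_form_enneper_X:
  "herm_form (enneper_X sp r n z) (ctransp (enneper_X sp r n z)) = of_real ((1 + (r * cmod z ^ (n+1) / (n+1))\<^sup>2)\<^sup>2 / 2)"
proof -
  define b where "b = enneper_b r n z"
  have bb: "b * cnj b = of_real ((r * cmod z ^ (n+1) / (n+1))\<^sup>2)"
  proof -
    have "cmod b = \<bar>r\<bar> * cmod z ^ (n+1) / (n+1)" 
      by (simp add: b_def enneper_b_def norm_mult norm_divide norm_power del: of_nat_Suc of_nat_add)
    then have "(cmod b)\<^sup>2 = (r * cmod z ^ (n+1) / (n+1))\<^sup>2" by (simp add: power_mult_distrib power_divide)
    then show ?thesis by (metis complex_norm_square)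
  qed
  have "herm_form (enneper_X sp r n z) (ctransp (enneper_X sp r n z)) = (1 + b * cnj b)\<^sup>2 / 2"
    by (cases sp; simp add: enneper_X_def b_def[symmetric] entries power2_eq_square field_simps)
  then show ?thesis unfolding bb by simp
qed

text \<open>The metric of the data is \<open>(1 + |b|\<^sup>2)\<^sup>2 |dz|\<^sup>2\<close> and \<open>|b|\<close> depends only on \<open>|z|\<close>. The surface is not
flat because the Hopf coefficient at \<open>z = 1\<close> is \<open>\<plusminus> r\<close>.\<close>

lemma enneper_surface_enneper_lwr:
  assumes r: "r > 0"
  shows "enneper_surface sp (enneper_lwr sp r n)"
proof -
  define g where "g = enneper_lwr sp r n"
  obtain \<Psi> where D: "hol_data sp g (enneper_X sp r n) \<Psi>" using hol_data_enneper unfolding g_def by blast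
  define Y where "Y = (\<lambda>z. cscale (exp z) (enneper_X sp r n (exp z)))"
  define Y' where "Y' = (\<lambda>z. cscale (exp z) (cscale (exp z) (enneper_X' sp r n (exp z))) + cscale (exp z) (enneper_X sp r n (exp z)))"
  have E: "hol_data sp (g \<circ> exp) Y (\<lambda>z. \<Psi> (exp z))"
    using hol_data_compose[OF D, of exp exp exp] DERIV_exp by (simp add: Y_def comp_def)
  have Y': "mat_deriv Y Y'" unfolding Y_def Y'_def
    by (rule mat_deriv_cscale[OF DERIV_exp mat_deriv_compose[OF DERIV_exp enneper_X_deriv]])
  have metric: "metric_coeff (g \<circ> exp) w = of_real ((1 + (r * cmod (exp w) ^ (n+1) / (n+1))\<^sup>2)\<^sup>2 * (cmod (exp w))\<^sup>2)" for w
  proof -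
    have "metric_coeff (g \<circ> exp) w = 2 * (exp w * cnj (exp w) * herm_form (enneper_X sp r n (exp w)) (ctransp (enneper_X sp r n (exp w))))"
      unfolding hol_data_metric[OF E] Y_def ctransp_cscale by (simp add: herm_form_bilin)
    also have "exp w * cnj (exp w) = of_real ((cmod (exp w))\<^sup>2)" by (rule complex_norm_square[symmetric])
    finally have "metric_coeff (g \<circ> exp) w = 2 * (of_real ((cmod (exp w))\<^sup>2) *
        of_real ((1 + (r * cmod (exp w) ^ (n+1) / (n+1))\<^sup>2)\<^sup>2 / 2))" unfolding herm_form_enneper_X .
    moreover have "2 * (of_real A * of_real (B / 2)) = complex_of_real (B * A)" for A B by simp
    ultimately show ?thesis by (simp only:)
  qed
  have "intrinsic_surface_of_revolution sp (g \<circ> exp)"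
    unfolding intrinsic_surface_of_revolution_def
  proof
    show "\<exists>m :: real \<Rightarrow> real. \<forall>w. m (cmod (exp w)) > 0 \<and>
        metric_coeff (g \<circ> exp) w = of_real ((m (cmod (exp w)))\<^sup>2 * (cmod (exp w))\<^sup>2)"
      by (rule exI[of _ "\<lambda>\<rho>. 1 + (r * \<rho> ^ (n+1) / (n+1))\<^sup>2"]) (use metric in \<open>auto intro: add_pos_nonneg\<close>)
  qed (rule hol_data_conformal_immersion[OF E])
  moreover have "has_ambient_cmc sp (g \<circ> exp)"
    unfolding has_ambient_cmc_def using hol_data_hopf[OF E Y'] unfolding cmc_const_def by blast
  moreover have "\<not> flat sp (g \<circ> exp)"
  proof
    assume "flat sp (g \<circ> exp)"
    then obtain H where "hopf_mean_curvature sp (g \<circ> exp) 0 0 H" by (auto simp: flat_def)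
    from hopf_unique[OF hol_data_hopf[OF E Y', of 0] this]
    have Q: "herm_form (Y' 0) (cscale (1 / herm_form (Y 0) (ctransp (Y 0))) (ctransp (Y 0) ** Y 0) - mat 1) = 0"
      unfolding hopf_coeff_def .
    define b where "b = r / (n+1)"
    have b1: "enneper_b r n 1 = of_real b" by (simp add: enneper_b_def b_def)
    define e :: complex where "e = (case sp of Euc3 \<Rightarrow> 1 | Hyp3 \<Rightarrow> -1)"
    have ee: "e * e = 1" "cnj e = e" by (cases sp; simp add: e_def)+
    have Y0: "Y 0 = cscale e (mk2 b (- b\<^sup>2) 1 (- b))" by (simp add: Y_def enneper_X_def e_def b1)
    have k: "herm_form (Y 0) (ctransp (Y 0)) = of_real ((1 + b\<^sup>2)\<^sup>2 / 2)"
      using herm_form_enneper_X[of sp r n 1] by (simp add: Y_def b_def)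
    have Y'0: "Y' 0 = cscale e (mk2 (r + b) (- 2 * b * r - b\<^sup>2) 1 (- r - b))"
      by (simp add: Y'_def enneper_X'_def enneper_X_def b1 e_def[symmetric] entries algebra_simps)
    have st: "ctransp (Y 0) ** Y 0 = cscale (1 + (of_real b)\<^sup>2) (mk2 1 (- b) (- b) (b\<^sup>2))"
    proof -
      have "ctransp (Y 0) ** Y 0 = cscale (e * e) (ctransp (mk2 b (- b\<^sup>2) 1 (- b)) ** mk2 b (- b\<^sup>2) 1 (- b))"
        unfolding Y0 ctransp_cscale ee(2) by (simp only: cscale_mult_left cscale_mult_right cscale_cscale)
      then show ?thesis unfolding ee(1) by (simp add: entries power2_eq_square algebra_simps)
    qed
    have "herm_form (Y' 0) (ctransp (Y 0) ** Y 0) = e * ((1 + (of_real b)\<^sup>2) * herm_form (mk2 (r + b) (- 2 * b * r - b\<^sup>2) 1 (- r - b)) (mk2 1 (- b) (- b) (b\<^sup>2)))"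
      unfolding st Y'0 by (simp only: herm_form_bilin mult_ac)
    also have "herm_form (mk2 (r + b) (- 2 * b * r - b\<^sup>2) 1 (- r - b)) (mk2 1 (- b) (- b) (b\<^sup>2)) = of_real r * (1 + (of_real b)\<^sup>2) / 2"
      by (simp add: herm_form_nth power2_eq_square field_simps)
    finally have "herm_form (Y' 0) (ctransp (Y 0) ** Y 0) = e * of_real r * of_real ((1 + b\<^sup>2)\<^sup>2 / 2)"
      by (simp add: power2_eq_square mult_ac)
    moreover have "herm_form (Y' 0) (mat 1) = 0" unfolding Y'0 by (simp add: herm_form_nth mat_1_nth cscale_nth algebra_simps)
    moreover have bpos: "(1 + b\<^sup>2)\<^sup>2 / 2 \<noteq> 0"
    proof -
      have "1 + b\<^sup>2 > 0" by (simp add: add_pos_nonneg)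
      then show ?thesis by simp
    qed
    ultimately have "e * of_real r = 0"
      using Q unfolding k by (simp add: herm_form_bilin del: of_real_power of_real_divide of_real_add of_real_mult)
    then show False using ee r by auto
  qed
  ultimately show ?thesis unfolding enneper_surface_def g_def[symmetric]
    using hol_data_conformal_immersion[OF D] by blast
qed

section \<open>Linear differential equations with entire coefficients\<close>

text \<open>Power series coefficients of the solution \<open>(a, b)\<close> of \<open>a' = a p + b s\<close>, \<open>b' = a q + b t\<close>, where the
arguments are the coefficient sequences of \<open>p\<close>, \<open>q\<close>, \<open>s\<close>, \<open>t\<close> and the initial value.\<close>

fun ode_coeff :: "(nat \<Rightarrow> complex) \<Rightarrow> (nat \<Rightarrow> complex) \<Rightarrow> (nat \<Rightarrow> complex) \<Rightarrow> (nat \<Rightarrow> complex) \<Rightarrow>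
    complex \<times> complex \<Rightarrow> nat \<Rightarrow> complex \<times> complex" where
  "ode_coeff p q s t y 0 = y"
| "ode_coeff p q s t y (Suc k) =
    ((\<Sum>j\<in>{0..k}. fst (ode_coeff p q s t y j) * p (k - j) + snd (ode_coeff p q s t y j) * s (k - j)) / of_nat (Suc k),
     (\<Sum>j\<in>{0..k}. fst (ode_coeff p q s t y j) * q (k - j) + snd (ode_coeff p q s t y j) * t (k - j)) / of_nat (Suc k))"

lemma fps_entire_coeff_bound:
  assumes "fps_entire f" "R > 0"
  obtains M where "M > 0" "\<And>k. norm (fps_nth f k) \<le> M / R ^ k"
proof -
  have "summable (\<lambda>k. fps_nth f k * of_real R ^ k)"
    using assms by (intro summable_in_conv_radius) (simp add: fps_entire_def fps_conv_radius_def)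
  then have "Bseq (\<lambda>k. fps_nth f k * of_real R ^ k)"
    by (intro convergent_imp_Bseq) (auto simp: convergent_def dest: summable_LIMSEQ_zero)
  then obtain M where M: "M > 0" "\<And>k. norm (fps_nth f k * of_real R ^ k) \<le> M" by (auto elim: BseqE)
  have "norm (fps_nth f k) \<le> M / R ^ k" for k
    using M(2)[of k] assms(2) by (simp add: norm_mult norm_power field_simps)
  then show thesis using that M(1) by blast
qed

text \<open>The estimate behind convergence: if the coefficients of the equation are bounded by \<open>M / R\<^sup>k\<close>, the
weighted sum \<open>S\<^sub>k\<close> of the solution coefficients up to index \<open>k\<close> majorises the next one and satisfies
\<open>S\<^sub>k\<^sub>+\<^sub>1 \<le> (1/R + 2M/(k + 1)) S\<^sub>k\<close>. So it eventually grows at most like \<open>(2/R)\<^sup>k\<close>, and \<open>R\<close> is arbitrary.\<close>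

lemma linear_ode_fps:
  assumes ent: "fps_entire p" "fps_entire q" "fps_entire s" "fps_entire t"
  obtains a b where "fps_entire a" "fps_entire b" "fps_nth a 0 = a0" "fps_nth b 0 = b0"
    "fps_deriv a = a * p + b * s" "fps_deriv b = a * q + b * t"
proof -
  define y where "y = ode_coeff (fps_nth p) (fps_nth q) (fps_nth s) (fps_nth t) (a0, b0)"
  define n where "n = (\<lambda>k. norm (fst (y k)) + norm (snd (y k)))"
  have n0: "n k \<ge> 0" for k by (simp add: n_def)
  have y1: "of_nat (Suc k) * fst (y (Suc k)) = (\<Sum>j\<in>{0..k}. fst (y j) * fps_nth p (k - j) + snd (y j) * fps_nth s (k - j))"
   and y2: "of_nat (Suc k) * snd (y (Suc k)) = (\<Sum>j\<in>{0..k}. fst (y j) * fps_nth q (k - j) + snd (y j) * fps_nth t (k - j))" for k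
    by (simp_all add: y_def del: of_nat_Suc)
  have summ: "summable (\<lambda>k. n k * norm z ^ k)" for z :: complex
  proof -
    \<comment> \<open>Any \<open>R > 2 |z|\<close> gives summability at \<open>z\<close>; the factor 4 leaves the ratio \<open>1/2\<close>.\<close>
    define R where "R = 4 * (norm z + 1)"
    have R: "R > 0" by (simp add: R_def add_nonneg_pos)
    obtain M where M: "M > 0" "\<And>k. norm (fps_nth p k) \<le> M / R ^ k" "\<And>k. norm (fps_nth q k) \<le> M / R ^ k"
       "\<And>k. norm (fps_nth s k) \<le> M / R ^ k" "\<And>k. norm (fps_nth t k) \<le> M / R ^ k"
    proof -
      obtain M1 where M1: "M1 > 0" "\<And>k. norm (fps_nth p k) \<le> M1 / R ^ k" using fps_entire_coeff_bound[OF ent(1) R] by metis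
      obtain M2 where M2: "M2 > 0" "\<And>k. norm (fps_nth q k) \<le> M2 / R ^ k" using fps_entire_coeff_bound[OF ent(2) R] by metis
      obtain M3 where M3: "M3 > 0" "\<And>k. norm (fps_nth s k) \<le> M3 / R ^ k" using fps_entire_coeff_bound[OF ent(3) R] by metis
      obtain M4 where M4: "M4 > 0" "\<And>k. norm (fps_nth t k) \<le> M4 / R ^ k" using fps_entire_coeff_bound[OF ent(4) R] by metis
      have "x \<le> (M1 + M2 + M3 + M4) / R ^ k" if "x \<le> m / R ^ k" "m \<le> M1 + M2 + M3 + M4" for x m k
        using that R by (meson divide_right_mono order_trans zero_le_power less_imp_le)
      then show thesis using that[of "M1 + M2 + M3 + M4"] M1 M2 M3 M4
        by (smt (verit, best))
    qed
    define S where "S = (\<lambda>k. \<Sum>j\<in>{0..k}. n j * (2 * M / R ^ (k - j)))"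
    have S0: "S k \<ge> 0" for k unfolding S_def using n0 M(1) R by (intro sum_nonneg) simp
    have step: "real (Suc k) * n (Suc k) \<le> S k" for k
    proof -
      have bd: "norm (fst (y j) * c + snd (y j) * d) \<le> n j * (M / R ^ (k - j))"
        if "norm c \<le> M / R ^ (k - j)" "norm d \<le> M / R ^ (k - j)" for c d j
      proof -
        have "norm (fst (y j) * c + snd (y j) * d) \<le> norm (fst (y j)) * norm c + norm (snd (y j)) * norm d"
          by (metis norm_mult norm_triangle_ineq)
        also have "\<dots> \<le> norm (fst (y j)) * (M / R ^ (k - j)) + norm (snd (y j)) * (M / R ^ (k - j))"
          using that by (intro add_mono mult_left_mono) auto
        finally show ?thesis unfolding n_def distrib_right .
      qed
      have "norm (of_nat (Suc k) * fst (y (Suc k))) \<le> (\<Sum>j\<in>{0..k}. n j * (M / R ^ (k - j)))"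
        unfolding y1 by (intro sum_norm_le bd M)
      moreover have "norm (of_nat (Suc k) * snd (y (Suc k))) \<le> (\<Sum>j\<in>{0..k}. n j * (M / R ^ (k - j)))"
        unfolding y2 by (intro sum_norm_le bd M)
      moreover have "S k = (\<Sum>j\<in>{0..k}. n j * (M / R ^ (k - j))) + (\<Sum>j\<in>{0..k}. n j * (M / R ^ (k - j)))"
        unfolding S_def sum.distrib[symmetric] by (rule sum.cong) (auto simp: field_simps)
      moreover have "real (Suc k) * n (Suc k) = norm (of_nat (Suc k) * fst (y (Suc k))) + norm (of_nat (Suc k) * snd (y (Suc k)))"
        unfolding n_def norm_mult norm_of_nat by (simp add: distrib_left)
      ultimately show ?thesis by simp
    qed
    have SS: "S (Suc k) = S k / R + 2 * M * n (Suc k)" for k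
    proof -
      have "(\<Sum>j\<in>{0..k}. n j * (2 * M / R ^ (Suc k - j))) = S k / R"
        unfolding S_def sum_divide_distrib by (rule sum.cong) (auto simp: Suc_diff_le)
      then show ?thesis unfolding S_def by simp
    qed
    \<comment> \<open>From index \<open>K\<close> on, \<open>2M/(k + 1) \<le> 1/R\<close>.\<close>
    obtain K where K: "real K > 2 * M * R" using reals_Archimedean2 by blast
    have grow: "S (Suc k) \<le> (2 / R) * S k" if "k \<ge> K" for k
    proof -
      have "2 * M * R * n (Suc k) \<le> real (Suc k) * n (Suc k)"
        using K that n0 by (intro mult_right_mono) auto
      also have "\<dots> \<le> S k" by (rule step)
      finally have "2 * M * n (Suc k) \<le> S k / R" using R by (simp add: field_simps)
      then show ?thesis unfolding SS by simp
    qed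
    have "summable (\<lambda>k. S k * norm z ^ k)"
    proof (rule summable_ratio_test[of "1/2" K])
      fix k assume k: "k \<ge> K"
      have "S (Suc k) * norm z ^ Suc k \<le> ((2 / R) * S k) * norm z ^ Suc k"
        by (rule mult_right_mono[OF grow[OF k]]) simp
      also have "\<dots> = (2 / R * norm z) * (S k * norm z ^ k)" by simp
      also have "\<dots> \<le> 1/2 * (S k * norm z ^ k)"
        using S0[of k] R by (intro mult_right_mono mult_nonneg_nonneg) (auto simp: R_def field_simps)
      finally show "norm (S (Suc k) * norm z ^ Suc k) \<le> 1/2 * norm (S k * norm z ^ k)"
        using S0[of k] S0[of "Suc k"] by (simp add: abs_mult)
    qed simp
    then have "summable (\<lambda>k. norm z * (S k * norm z ^ k))" by (rule summable_mult)
    then have "summable (\<lambda>k. n (Suc k) * norm z ^ Suc k)"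
    proof (rule summable_comparison_test'[where N=0])
      fix k
      have "n (Suc k) \<le> real (Suc k) * n (Suc k)" using n0[of "Suc k"] by (simp add: mult_le_cancel_right1)
      also have "\<dots> \<le> S k" by (rule step)
      finally have "n (Suc k) * norm z ^ Suc k \<le> S k * norm z ^ Suc k" by (rule mult_right_mono) simp
      then show "norm (n (Suc k) * norm z ^ Suc k) \<le> norm z * (S k * norm z ^ k)"
        using n0[of "Suc k"] by (simp add: abs_mult mult_ac)
    qed
    then show ?thesis using summable_Suc_iff[of "\<lambda>k. n k * norm z ^ k"] by blast
  qed
  have ent': "fps_entire (Abs_fps (\<lambda>k. c (y k)))" if "\<And>k. norm (c (y k)) \<le> n k" for c
  proof -
    have "conv_radius (\<lambda>k. c (y k)) = \<infinity>"
    proof (rule conv_radius_inftyI'')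
      fix z :: complex
      show "summable (\<lambda>k. c (y k) * z ^ k)"
        by (rule summable_comparison_test'[OF summ[of z], where N=0])
          (auto simp: norm_mult norm_power intro: mult_right_mono that)
    qed
    then show ?thesis by (simp add: fps_entire_def fps_conv_radius_def)
  qed
  show thesis
  proof (rule that[of "Abs_fps (\<lambda>k. fst (y k))" "Abs_fps (\<lambda>k. snd (y k))"])
    show "fps_entire (Abs_fps (\<lambda>k. fst (y k)))" "fps_entire (Abs_fps (\<lambda>k. snd (y k)))"
      by (intro ent'; simp add: n_def)+
    show "fps_nth (Abs_fps (\<lambda>k. fst (y k))) 0 = a0" "fps_nth (Abs_fps (\<lambda>k. snd (y k))) 0 = b0"
      by (simp_all add: y_def)
    show "fps_deriv (Abs_fps (\<lambda>k. fst (y k))) = Abs_fps (\<lambda>k. fst (y k)) * p + Abs_fps (\<lambda>k. snd (y k)) * s"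
      by (rule fps_ext) (use y1 in \<open>simp add: fps_mult_nth sum.distrib del: of_nat_Suc\<close>)
    show "fps_deriv (Abs_fps (\<lambda>k. snd (y k))) = Abs_fps (\<lambda>k. fst (y k)) * q + Abs_fps (\<lambda>k. snd (y k)) * t"
      by (rule fps_ext) (use y2 in \<open>simp add: fps_mult_nth sum.distrib del: of_nat_Suc\<close>)
  qed
qed

lemma entire_fps:
  assumes "f holomorphic_on UNIV"
  obtains F where "fps_entire F" "eval_fps F = f"
proof (rule that)
  have s: "(\<lambda>k. (deriv ^^ k) f 0 / fact k * z ^ k) sums f z" for z
    using holomorphic_power_series[of f 0 "norm z + 1" z] holomorphic_on_subset[OF assms] by simp
  let ?F = "Abs_fps (\<lambda>k. (deriv ^^ k) f 0 / fact k)"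
  have "conv_radius (\<lambda>k. (deriv ^^ k) f 0 / fact k) = \<infinity>"
    by (rule conv_radius_inftyI'') (use s sums_summable in blast)
  then show "fps_entire ?F" by (simp add: fps_entire_def fps_conv_radius_def)
  show "eval_fps ?F = f" using s by (auto simp: eval_fps_def fun_eq_iff sums_iff)
qed

lemma linear_ode_exists:
  assumes A: "mat_deriv A A'"
  obtains \<Psi> where "mat_deriv \<Psi> (\<lambda>z. \<Psi> z ** A z)" "\<Psi> 0 = C"
proof -
  have "(\<lambda>z. A z $ i $ j) holomorphic_on UNIV" for i j
    using mat_deriv_entry[OF A] by (auto simp: holomorphic_on_def field_differentiable_def intro: has_field_derivative_at_within)
  then have "\<exists>F. fps_entire F \<and> eval_fps F = (\<lambda>z. A z $ i $ j)" for i j using entire_fps by metis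
  then obtain F where F: "\<And>i j. fps_entire (F i j)" "\<And>i j. eval_fps (F i j) = (\<lambda>z. A z $ i $ j)" by metis
  obtain a b where ab: "fps_entire a" "fps_entire b" "fps_nth a 0 = C$1$1" "fps_nth b 0 = C$1$2"
    "fps_deriv a = a * F 1 1 + b * F 2 1" "fps_deriv b = a * F 1 2 + b * F 2 2"
    by (rule linear_ode_fps[OF F(1) F(1) F(1) F(1)])
  obtain c d where cd: "fps_entire c" "fps_entire d" "fps_nth c 0 = C$2$1" "fps_nth d 0 = C$2$2"
    "fps_deriv c = c * F 1 1 + d * F 2 1" "fps_deriv d = c * F 1 2 + d * F 2 2"
    by (rule linear_ode_fps[OF F(1) F(1) F(1) F(1)])
  define \<Psi> where "\<Psi> = (\<lambda>z. mk2 (eval_fps a z) (eval_fps b z) (eval_fps c z) (eval_fps d z))"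
  have "mat_deriv \<Psi> (\<lambda>z. mk2 (eval_fps (fps_deriv a) z) (eval_fps (fps_deriv b) z) (eval_fps (fps_deriv c) z) (eval_fps (fps_deriv d) z))"
    unfolding \<Psi>_def by (intro mat_deriv_mk2 eval_fps_entire(3)[where g=1] ab cd) (simp_all add: fps_entire_def)
  moreover have "mk2 (eval_fps (fps_deriv a) z) (eval_fps (fps_deriv b) z) (eval_fps (fps_deriv c) z) (eval_fps (fps_deriv d) z) = \<Psi> z ** A z" for z
    unfolding ab cd \<Psi>_def by (simp add: cmat2_eq_iff mult_nth eval_fps_entire fps_entire_mult fps_entire_add F ab(1,2) cd(1,2))
  ultimately have "mat_deriv \<Psi> (\<lambda>z. \<Psi> z ** A z)" by simp
  moreover have "\<Psi> 0 = C" by (simp add: \<Psi>_def cmat2_eq_iff eval_fps_at_0 ab cd)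
  ultimately show thesis by (rule that)
qed

section \<open>Symmetry of second derivatives\<close>

text \<open>The mean value theorem, first along \<open>u\<close> and then along \<open>v\<close>.\<close>

lemma second_difference:
  fixes g :: "'a::real_normed_vector \<Rightarrow> real"
  assumes g: "\<And>x. (g has_derivative Dg x) (at x)" and gu: "\<And>x. ((\<lambda>x. Dg x u) has_derivative Du x) (at x)" and h: "h > 0"
  obtains \<xi> \<eta> where "0 < \<xi>" "\<xi> < h" "0 < \<eta>" "\<eta> < h"
    "g (z + h *\<^sub>R u + h *\<^sub>R v) - g (z + h *\<^sub>R u) - g (z + h *\<^sub>R v) + g z = h * h * Du (z + \<xi> *\<^sub>R u + \<eta> *\<^sub>R v) v"
proof -
  have line: "((\<lambda>s. F (w + s *\<^sub>R e)) has_field_derivative D (w + s *\<^sub>R e) e) (at s)"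
    if "\<And>x. (F has_derivative D x) (at x)" for F :: "'a \<Rightarrow> real" and D w e s
  proof -
    have "((\<lambda>s. w + s *\<^sub>R e) has_derivative (\<lambda>l. l *\<^sub>R e)) (at s)"
      by (auto intro!: derivative_eq_intros)
    from has_derivative_compose[OF this that]
    have "((\<lambda>s. F (w + s *\<^sub>R e)) has_derivative (\<lambda>l. D (w + s *\<^sub>R e) (l *\<^sub>R e))) (at s)" .
    moreover have "D (w + s *\<^sub>R e) (l *\<^sub>R e) = D (w + s *\<^sub>R e) e * l" for l
      using linear_cmul[OF has_derivative_linear[OF that]] by simp
    ultimately show ?thesis by (simp add: has_field_derivative_def fun_eq_iff)
  qed
  define \<phi> where "\<phi> = (\<lambda>s. g ((z + h *\<^sub>R v) + s *\<^sub>R u) - g (z + s *\<^sub>R u))"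
  have "(\<phi> has_field_derivative Dg ((z + h *\<^sub>R v) + s *\<^sub>R u) u - Dg (z + s *\<^sub>R u) u) (at s)" for s
    unfolding \<phi>_def by (intro DERIV_diff line g)
  from MVT2[OF h this] obtain \<xi> where xi: "0 < \<xi>" "\<xi> < h"
    "\<phi> h - \<phi> 0 = h * (Dg ((z + h *\<^sub>R v) + \<xi> *\<^sub>R u) u - Dg (z + \<xi> *\<^sub>R u) u)" by auto
  from MVT2[OF h line[where F="\<lambda>x. Dg x u" and D=Du and e=v and w="z + \<xi> *\<^sub>R u", OF gu]]
  obtain \<eta> where eta: "0 < \<eta>" "\<eta> < h"
    "Dg ((z + \<xi> *\<^sub>R u) + h *\<^sub>R v) u - Dg ((z + \<xi> *\<^sub>R u) + 0 *\<^sub>R v) u = h * Du ((z + \<xi> *\<^sub>R u) + \<eta> *\<^sub>R v) v" by auto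
  have "\<phi> h - \<phi> 0 = h * h * Du ((z + \<xi> *\<^sub>R u) + \<eta> *\<^sub>R v) v"
    using xi(3) eta(3) by (simp add: add_ac)
  then show thesis using that[OF xi(1,2) eta(1,2)] by (simp add: \<phi>_def add_ac)
qed

text \<open>Schwarz's theorem: the second difference quotient is symmetric in the two directions and, by the
mean value theorem, tends to both mixed derivatives.\<close>

lemma mixed_derivatives_real:
  fixes g :: "'a::real_normed_vector \<Rightarrow> real"
  assumes g: "\<And>x. (g has_derivative Dg x) (at x)"
    and gu: "\<And>x. ((\<lambda>x. Dg x u) has_derivative Du x) (at x)" and cu: "continuous (at z) (\<lambda>x. Du x v)"
    and gv: "\<And>x. ((\<lambda>x. Dg x v) has_derivative Dv x) (at x)" and cv: "continuous (at z) (\<lambda>x. Dv x u)"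
  shows "Du z v = Dv z u"
proof -
  define h where "h = (\<lambda>n. 1 / real (Suc n))"
  have h: "h n > 0" for n by (simp add: h_def)
  have h0: "h \<longlonglongrightarrow> 0" unfolding h_def by real_asymp
  have "\<exists>\<xi> \<eta> \<xi>' \<eta>'. 0 < \<xi> \<and> \<xi> < h n \<and> 0 < \<eta> \<and> \<eta> < h n \<and> 0 < \<xi>' \<and> \<xi>' < h n \<and> 0 < \<eta>' \<and> \<eta>' < h n \<and>
     Du (z + \<xi> *\<^sub>R u + \<eta> *\<^sub>R v) v = Dv (z + \<xi>' *\<^sub>R v + \<eta>' *\<^sub>R u) u" for n
  proof -
    obtain \<xi> \<eta> where 1: "0 < \<xi>" "\<xi> < h n" "0 < \<eta>" "\<eta> < h n"
      "g (z + h n *\<^sub>R u + h n *\<^sub>R v) - g (z + h n *\<^sub>R u) - g (z + h n *\<^sub>R v) + g z = h n * h n * Du (z + \<xi> *\<^sub>R u + \<eta> *\<^sub>R v) v"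
      using second_difference[where g=g and Dg=Dg and u=u and Du=Du and v=v and z=z, OF g gu h[of n]] .
    obtain \<xi>' \<eta>' where 2: "0 < \<xi>'" "\<xi>' < h n" "0 < \<eta>'" "\<eta>' < h n"
      "g (z + h n *\<^sub>R v + h n *\<^sub>R u) - g (z + h n *\<^sub>R v) - g (z + h n *\<^sub>R u) + g z = h n * h n * Dv (z + \<xi>' *\<^sub>R v + \<eta>' *\<^sub>R u) u"
      using second_difference[where g=g and Dg=Dg and u=v and Du=Dv and v=u and z=z, OF g gv h[of n]] .
    have "h n * h n * Du (z + \<xi> *\<^sub>R u + \<eta> *\<^sub>R v) v = h n * h n * Dv (z + \<xi>' *\<^sub>R v + \<eta>' *\<^sub>R u) u"
      unfolding 1(5)[symmetric] 2(5)[symmetric] by (simp add: add_ac)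
    then have "Du (z + \<xi> *\<^sub>R u + \<eta> *\<^sub>R v) v = Dv (z + \<xi>' *\<^sub>R v + \<eta>' *\<^sub>R u) u" using h[of n] by simp
    then show ?thesis using 1(1-4) 2(1-4) by blast
  qed
  then obtain \<xi> \<eta> \<xi>' \<eta>' where x: "\<And>n. 0 < \<xi> n" "\<And>n. \<xi> n < h n" "\<And>n. 0 < \<eta> n" "\<And>n. \<eta> n < h n"
    "\<And>n. 0 < \<xi>' n" "\<And>n. \<xi>' n < h n" "\<And>n. 0 < \<eta>' n" "\<And>n. \<eta>' n < h n"
    "\<And>n. Du (z + \<xi> n *\<^sub>R u + \<eta> n *\<^sub>R v) v = Dv (z + \<xi>' n *\<^sub>R v + \<eta>' n *\<^sub>R u) u" by metis
  have lim: "c \<longlonglongrightarrow> 0" if "\<And>n. 0 < c n" "\<And>n. c n < h n" for c :: "nat \<Rightarrow> real"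
  proof (rule tendsto_sandwich[OF _ _ tendsto_const h0])
    show "\<forall>\<^sub>F n in sequentially. 0 \<le> c n" using that(1) by (intro always_eventually allI less_imp_le)
    show "\<forall>\<^sub>F n in sequentially. c n \<le> h n" using that(2) by (intro always_eventually allI less_imp_le)
  qed
  have "(\<lambda>n. z + \<xi> n *\<^sub>R u + \<eta> n *\<^sub>R v) \<longlonglongrightarrow> z + 0 *\<^sub>R u + 0 *\<^sub>R v"
    by (intro tendsto_intros lim x)
  then have l1: "(\<lambda>n. Du (z + \<xi> n *\<^sub>R u + \<eta> n *\<^sub>R v) v) \<longlonglongrightarrow> Du z v"
    using isCont_tendsto_compose[OF cu] by simp
  have "(\<lambda>n. z + \<xi>' n *\<^sub>R v + \<eta>' n *\<^sub>R u) \<longlonglongrightarrow> z + 0 *\<^sub>R v + 0 *\<^sub>R u"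
    by (intro tendsto_intros lim x)
  then have "(\<lambda>n. Dv (z + \<xi>' n *\<^sub>R v + \<eta>' n *\<^sub>R u) u) \<longlonglongrightarrow> Dv z u"
    using isCont_tendsto_compose[OF cv] by simp
  then show ?thesis using l1 LIMSEQ_unique unfolding x(9) by blast
qed

lemma mixed_derivatives:
  fixes f :: "complex \<Rightarrow> cmat2"
  assumes f: "\<And>x. (f has_derivative Df x) (at x)"
    and fu: "\<And>x. ((\<lambda>x. Df x u) has_derivative Du x) (at x)" and cu: "continuous (at z) (\<lambda>x. Du x v)"
    and fv: "\<And>x. ((\<lambda>x. Df x v) has_derivative Dv x) (at x)" and cv: "continuous (at z) (\<lambda>x. Dv x u)"
  shows "Du z v = Dv z u"
proof -
  have L: "L (Du z v) = L (Dv z u)" if L: "bounded_linear L" for L :: "cmat2 \<Rightarrow> real"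
    by (rule mixed_derivatives_real[where g="\<lambda>x. L (f x)" and Dg="\<lambda>x h. L (Df x h)" and Du="\<lambda>x h. L (Du x h)" and Dv="\<lambda>x h. L (Dv x h)"])
      (intro bounded_linear.has_derivative[OF L] f fu fv bounded_linear.continuous[OF L] cu cv)+
  have "Re (Du z v $ i $ j) = Re (Dv z u $ i $ j)" "Im (Du z v $ i $ j) = Im (Dv z u $ i $ j)" for i j
    by (rule L[OF bounded_linear_compose[OF bounded_linear_Re bounded_linear_nth_nth]],
        rule L[OF bounded_linear_compose[OF bounded_linear_Im bounded_linear_nth_nth]])
  then show ?thesis by (simp add: cmat2_eq_iff complex_eq_iff)
qed

section \<open>Holomorphic data of a given surface\<close>

text \<open>Splitting into the complex linear part, the Wirtinger derivative \<open>\<partial>\<^sub>z\<close>, and the antilinear part.\<close>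

lemma real_linear_split:
  fixes D :: "complex \<Rightarrow> cmat2"
  assumes "linear D"
  shows "D h = cscale h (cscale (1/2) (D 1 - cscale \<i> (D \<i>))) + cscale (cnj h) (cscale (1/2) (D 1 + cscale \<i> (D \<i>)))"
proof -
  have "h = Re h *\<^sub>R 1 + Im h *\<^sub>R \<i>" by (simp add: complex_eq_iff)
  then have "D h = D (Re h *\<^sub>R 1 + Im h *\<^sub>R \<i>)" by (rule arg_cong)
  also have "\<dots> = cscale (of_real (Re h)) (D 1) + cscale (of_real (Im h)) (D \<i>)"
    by (simp only: linear_add[OF assms] linear_cmul[OF assms] scaleR_eq_cscale)
  also have "\<dots> = cscale h (cscale (1/2) (D 1 - cscale \<i> (D \<i>))) + cscale (cnj h) (cscale (1/2) (D 1 + cscale \<i> (D \<i>)))"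
  proof -
    have "of_real x * p + of_real y * q
       = Complex x y * (1/2 * (p - \<i> * q)) + cnj (Complex x y) * (1/2 * (p + \<i> * q))" for x y p q
      by (simp add: complex_eq_iff field_simps)
    from this[of "Re h" _ "Im h"] show ?thesis by (simp add: cmat2_eq_iff cscale_nth)
  qed
  finally show ?thesis .
qed

text \<open>Obtained by differentiating the equations that define the ambient space.\<close>

lemma tangent_space:
  assumes sp: "range f \<subseteq> space_of sp" and D: "(f has_derivative D) (at z)"
  shows "ctransp (D h) = D h" "herm_form (base_pt sp (f z)) (D h) = 0"
proof -
  have herm: "ctransp (f x) = f x" for x
  proof -
    have "f x \<in> space_of sp" using sp by auto
    then show ?thesis by (cases sp) (auto simp: hermitian_def)
  qed
  have "(f has_derivative (\<lambda>h. ctransp (D h))) (at z)"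
    using has_derivative_ctransp[OF D] unfolding herm .
  from fun_cong[OF has_derivative_unique[OF this D]] show "ctransp (D h) = D h" .
  show "herm_form (base_pt sp (f z)) (D h) = 0"
  proof (cases sp)
    case Euc3
    have "herm_form (mat 1) (f x) = 0" for x
      using sp Euc3 by (auto simp: herm_form_mat1)
    then have "((\<lambda>x. 0) has_derivative (\<lambda>h. herm_form (mat 1) (D h) + herm_form 0 (f z))) (at z)"
      using has_derivative_herm_form[OF has_derivative_const[of "mat 1"] D] by simp
    from has_derivative_of_const[OF this] show ?thesis using Euc3 by simp
  next
    case Hyp3
    have "herm_form (f x) (f x) = - 1" for x
      using sp Hyp3 by (auto simp: herm_form_self)
    then have "((\<lambda>x. - 1) has_derivative (\<lambda>h. herm_form (f z) (D h) + herm_form (D h) (f z))) (at z)"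
      using has_derivative_herm_form[OF D D] by simp
    from has_derivative_of_const[OF this, of h]
    have "herm_form (f z) (D h) + herm_form (D h) (f z) = 0" .
    then show ?thesis using Hyp3 herm_form_sym[of "D h" "f z"] by simp
  qed
qed

lemma smooth_derivs:
  assumes "smooth f"
  shows "(f has_derivative frechet_derivative f (at z)) (at z)"
    "((\<lambda>z. frechet_derivative f (at z) v) has_derivative frechet_derivative (\<lambda>z. frechet_derivative f (at z) v) (at z)) (at z)"
    "continuous (at z) (\<lambda>z. frechet_derivative (\<lambda>z. frechet_derivative f (at z) v) (at z) w)"
proof -
  have "times_cont_diff (Suc (Suc 0)) f" using assms by (simp add: smooth_def)
  then have 1: "f differentiable (at z)" and 2: "(\<lambda>z. frechet_derivative f (at z) v) differentiable (at z)"
    and 3: "continuous_on UNIV (\<lambda>z. frechet_derivative (\<lambda>z. frechet_derivative f (at z) v) (at z) w)" for z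
    by auto
  show "(f has_derivative frechet_derivative f (at z)) (at z)"
    using 1 by (simp add: frechet_derivative_works)
  show "((\<lambda>z. frechet_derivative f (at z) v) has_derivative frechet_derivative (\<lambda>z. frechet_derivative f (at z) v) (at z)) (at z)"
    using 2 by (simp add: frechet_derivative_works)
  show "continuous (at z) (\<lambda>z. frechet_derivative (\<lambda>z. frechet_derivative f (at z) v) (at z) w)"
    using 3 by (simp add: continuous_on_eq_continuous_at)
qed

lemma conformal_frame:
  assumes "conformal_immersion sp f" and u: "u = diff_z f z"
  shows "diff_x f z = u + ctransp u" "diff_y f z = cscale \<i> (u - ctransp u)" "diff_zbar f z = ctransp u"
    "herm_form (base_pt sp (f z)) u = 0" "herm_form u u = 0" "u \<noteq> 0"
    "metric_coeff f z = 2 * herm_form u (ctransp u)"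
    "frechet_derivative f (at z) h = cscale h u + cscale (cnj h) (ctransp u)"
proof -
  have sm: "smooth f" and sp: "range f \<subseteq> space_of sp" and inj: "inj (frechet_derivative f (at z))"
    and uu: "herm_form u u = 0" using assms by (auto simp: conformal_immersion_def)
  note D = smooth_derivs(1)[OF sm, of z]
  have hx: "ctransp (diff_x f z) = diff_x f z" "ctransp (diff_y f z) = diff_y f z"
    "herm_form (base_pt sp (f z)) (diff_x f z) = 0" "herm_form (base_pt sp (f z)) (diff_y f z) = 0"
    unfolding diff_x_def diff_y_def by (rule tangent_space[OF sp D])+
  have cu: "ctransp u = diff_zbar f z"
    unfolding u diff_z_def diff_zbar_def ctransp_cscale ctransp_diff hx
    by (simp add: entries)
  show "diff_zbar f z = ctransp u" using cu ..
  show "diff_x f z = u + ctransp u" unfolding cu unfolding u diff_z_def diff_zbar_def by (simp add: entries field_simps)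
  show "diff_y f z = cscale \<i> (u - ctransp u)" unfolding cu unfolding u diff_z_def diff_zbar_def by (simp add: entries field_simps)
  show "herm_form (base_pt sp (f z)) u = 0" unfolding u diff_z_def by (simp add: herm_form_bilin hx)
  show "herm_form u u = 0" by (rule uu)
  show "metric_coeff f z = 2 * herm_form u (ctransp u)" unfolding metric_coeff_def cu unfolding u ..
  show fd: "frechet_derivative f (at z) h = cscale h u + cscale (cnj h) (ctransp u)" for h
    using real_linear_split[OF has_derivative_linear[OF D], of h] unfolding cu unfolding u diff_z_def diff_zbar_def diff_x_def diff_y_def .
  show "u \<noteq> 0"
  proof
    assume "u = 0"
    moreover have "ctransp 0 = 0" by (simp add: entries)
    ultimately have "frechet_derivative f (at z) 1 = frechet_derivative f (at z) 0" unfolding fd by simp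
    then show False using injD[OF inj, of 1 0] by simp
  qed
qed

lemma frame_products:
  assumes p: "p \<in> space_of sp" and u: "herm_form (base_pt sp p) u = 0" "herm_form u u = 0" "u \<noteq> 0"
  defines "M \<equiv> ctransp u ** adjugate2 (base_pt sp p) ** u"
  shows "herm_form M u = 0" "herm_form M (ctransp u) = 0" "herm_form M M = 0"
    "herm_form (base_pt sp p) M = - herm_form u (ctransp u)" "ctransp M = M" "ctransp (base_pt sp p) = base_pt sp p"
    "det (base_pt sp p) = 1"
proof -
  obtain V s where V: "det V = 1" "base_pt sp p = V ** ctransp V" "s \<noteq> 0" "u = V ** mk2 0 0 s 0 ** ctransp V"
    and uc: "ctransp u = V ** mk2 0 (cnj s) 0 0 ** ctransp V"
    using adapted_frame[OF p u] .
  have pr: "mk2 0 (cnj s) 0 0 ** mk2 0 0 s 0 = cscale (s * cnj s) (mk2 1 0 0 0)"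
    by (simp add: entries)
  have M: "M = V ** cscale (s * cnj s) (mk2 1 0 0 0) ** ctransp V"
    unfolding M_def uc V(2) unfolding V(4) star_adj_frame[OF V(1)] pr ..
  have b: "base_pt sp p = V ** mat 1 ** ctransp V" using V by simp
  show "herm_form M u = 0" unfolding M V(4) herm_form_transport[OF V(1)] by (simp add: herm_form_nth cscale_nth)
  show "herm_form M (ctransp u) = 0" unfolding M uc herm_form_transport[OF V(1)] by (simp add: herm_form_nth cscale_nth)
  show "herm_form M M = 0" unfolding M herm_form_transport[OF V(1)] by (simp add: herm_form_nth cscale_nth)
  show "herm_form (base_pt sp p) M = - herm_form u (ctransp u)"
    unfolding M uc unfolding b V(4) herm_form_transport[OF V(1)] by (simp add: herm_form_nth cscale_nth mat_1_nth)
  have "ctransp (cscale (s * cnj s) (mk2 1 0 0 0)) = cscale (s * cnj s) (mk2 1 0 0 0)"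
    by (simp add: entries)
  then show "ctransp M = M" unfolding M ctransp_mult by (simp add: matrix_mul_assoc)
  show "ctransp (base_pt sp p) = base_pt sp p" "det (base_pt sp p) = 1"
    using V(1) by (simp_all add: V(2) ctransp_mult det_mul)
qed

text \<open>The Gauss formula for the mixed derivative of a conformal immersion. Both sides are determined
by their products with the basis \<open>u\<close>, \<open>u\<^sup>*\<close>, base point, normal. The products of the left side with
the first three follow from conformality and the tangency of \<open>u\<close>, the last one is the \<open>|h|\<^sup>2\<close>
coefficient of the second fundamental form. Symmetry of second derivatives enters as Hermitian
symmetry of the left side.\<close>

lemma cmc_equation:
  assumes F: "conformal_immersion sp F" and cmc: "has_ambient_cmc sp F"
    and Du: "(diff_z F has_derivative Du) (at z)" and u: "u = diff_z F z"
  shows "cscale (1/2) (Du 1 + cscale \<i> (Du \<i>)) =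
    cscale (of_real (cmc_const sp)) (ctransp u ** adjugate2 (base_pt sp (F z)) ** u)"
proof -
  define H where "H = complex_of_real (cmc_const sp)"
  define w where "w = cscale (1/2) (Du 1 + cscale \<i> (Du \<i>))"
  define M where "M z = ctransp (diff_z F z) ** adjugate2 (base_pt sp (F z)) ** diff_z F z" for z
  define k where "k z = herm_form (diff_z F z) (ctransp (diff_z F z))" for z
  have sm: "smooth F" and sp: "range F \<subseteq> space_of sp" using F by (auto simp: conformal_immersion_def)
  have spx: "F x \<in> space_of sp" for x using sp by auto
  note cf = conformal_frame[OF F refl]
  note fp = frame_products[OF spx cf(4-6), folded M_def k_def]
  have kpos: "k x \<noteq> 0" for x
  proof -
    obtain t where "t > 0" "k x = of_real t" using tangent_nonzero[OF spx cf(4-6)] unfolding k_def .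
    then show ?thesis by simp
  qed
  define DF where "DF = (\<lambda>x. frechet_derivative F (at x))"
  define D2 where "D2 = (\<lambda>v x. frechet_derivative (\<lambda>z. DF z v) (at x))"
  have DF: "(F has_derivative DF x) (at x)" for x unfolding DF_def by (rule smooth_derivs[OF sm])
  have D2: "((\<lambda>z. DF z v) has_derivative D2 v x) (at x)" for v x unfolding DF_def D2_def by (rule smooth_derivs[OF sm])
  have D2c: "continuous (at x) (\<lambda>z. D2 v z w)" for v w x unfolding DF_def D2_def by (rule smooth_derivs[OF sm])
  have sym: "D2 1 z \<i> = D2 \<i> z 1"
    by (rule mixed_derivatives[OF DF D2 D2c D2 D2c])
  have dz: "diff_z F = (\<lambda>x. cscale (1/2) (DF x 1 - cscale \<i> (DF x \<i>)))"
    by (simp add: fun_eq_iff diff_z_def diff_x_def diff_y_def DF_def)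
  have "(diff_z F has_derivative (\<lambda>h. cscale (1/2) (D2 1 z h - cscale \<i> (D2 \<i> z h)))) (at z)"
    unfolding dz
    by (intro bounded_linear.has_derivative[OF bounded_bilinear.bounded_linear_right[OF bounded_bilinear_cscale]] has_derivative_diff D2)
  from has_derivative_unique[OF Du this]
  have Du_eq: "Du h = cscale (1/2) (D2 1 z h - cscale \<i> (D2 \<i> z h))" for h by (rule fun_cong)
  have herm2: "ctransp (D2 v z h) = D2 v z h" for v h
  proof -
    have "ctransp (DF x v) = DF x v" for x using tangent_space(1)[OF sp DF] .
    then have "((\<lambda>z. DF z v) has_derivative (\<lambda>h. ctransp (D2 v z h))) (at z)"
      using has_derivative_ctransp[OF D2[of v z]] by simp
    from fun_cong[OF has_derivative_unique[OF this D2]] show ?thesis .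
  qed
  have "w = cscale (1/4) (D2 1 z 1 + D2 \<i> z \<i>)"
    unfolding w_def Du_eq using sym by (simp add: entries field_simps)
  \<comment> \<open>\<open>w\<close> is a quarter of the Laplacian of a Hermitian matrix function.\<close>
  then have wh: "ctransp w = w" by (simp add: ctransp_cscale ctransp_add herm2)
  define N where "N = unit_normal sp F"
  have N: "N = (\<lambda>x. cscale (1 / k x) (M x) - base_pt sp (F x))"
    using unit_normal_formula[where f=F and sp=sp, OF spx cf(4-6) cf(1,2)] by (simp add: N_def M_def k_def fun_eq_iff)
  have orth: "herm_form (diff_z F x) (N x) = 0" "herm_form (ctransp (diff_z F x)) (N x) = 0" for x
  proof -
    have 1: "herm_form (diff_z F x) (M x) = 0" "herm_form (diff_z F x) (base_pt sp (F x)) = 0"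
      using fp(1)[of x] cf(4)[of x] by (simp_all only: herm_form_sym[of "diff_z F x"])
    then show 2: "herm_form (diff_z F x) (N x) = 0" unfolding N by (simp add: herm_form_bilin)
    have "herm_form (ctransp (diff_z F x)) (M x) = 0" using fp(2)[of x] by (simp only: herm_form_sym[of "ctransp (diff_z F x)"])
    moreover have "herm_form (ctransp (diff_z F x)) (base_pt sp (F x)) = 0"
      using arg_cong[OF 1(2), of cnj] unfolding cnj_herm_form fp(6) by simp
    ultimately show "herm_form (ctransp (diff_z F x)) (N x) = 0" unfolding N by (simp add: herm_form_bilin)
  qed
  have db: "((\<lambda>x. base_pt sp (F x)) has_derivative (\<lambda>h. cscale H (DF z h))) (at z)"
    by (cases sp) (use DF in \<open>auto simp: H_def cmc_const_def\<close>)
  have dM: "M differentiable (at z)" unfolding M_def[abs_def] differentiable_def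
    using has_derivative_mat_mult[OF has_derivative_mat_mult[OF has_derivative_ctransp[OF Du] has_derivative_adj[OF db]] Du] by blast
  have dk: "k differentiable (at z)" unfolding k_def[abs_def] differentiable_def
    using has_derivative_herm_form[OF Du has_derivative_ctransp[OF Du]] by blast
  have "(\<lambda>x. base_pt sp (F x)) differentiable (at z)" unfolding differentiable_def using db by blast
  then have "N differentiable (at z)" unfolding N by (rule differentiable_cscale_inverse_diff[OF dk kpos dM])
  then have dN: "(N has_derivative frechet_derivative N (at z)) (at z)"
    by (simp add: frechet_derivative_works)
  define DN where "DN = frechet_derivative N (at z)"
  have o1: "herm_form u (DN h) = - herm_form (Du h) (N z)" for h
  proof -
    have "((\<lambda>x. 0) has_derivative (\<lambda>h. herm_form u (DN h) + herm_form (Du h) (N z))) (at z)"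
      using has_derivative_herm_form[OF Du dN] unfolding orth u DN_def .
    from has_derivative_of_const[OF this, of h]
    show ?thesis by (simp add: add_eq_0_iff)
  qed
  have o2: "herm_form (ctransp u) (DN h) = - herm_form (ctransp (Du h)) (N z)" for h
  proof -
    have "((\<lambda>x. 0) has_derivative (\<lambda>h. herm_form (ctransp u) (DN h) + herm_form (ctransp (Du h)) (N z))) (at z)"
      using has_derivative_herm_form[OF has_derivative_ctransp[OF Du] dN] unfolding orth u DN_def .
    from has_derivative_of_const[OF this, of h]
    show ?thesis by (simp add: add_eq_0_iff)
  qed
  obtain Q where Q: "hopf_mean_curvature sp F z Q (cmc_const sp)"
    using cmc unfolding has_ambient_cmc_def cmc_const_def by blast
  have hopf: "- herm_form (DF z h) (DN h) = Q * h\<^sup>2 + H * (2 * k z * of_real ((cmod h)\<^sup>2)) + cnj Q * (cnj h)\<^sup>2" for h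
    using Q unfolding hopf_mean_curvature_def cf(7) DF_def DN_def N_def H_def k_def by blast
  have DFu: "DF z h = cscale h u + cscale (cnj h) (ctransp u)" for h
    unfolding DF_def u using cf(8)[of z h] .
  have e1: "herm_form (Du 1) (N z) + herm_form (ctransp (Du 1)) (N z) = Q + H * (2 * k z) + cnj Q"
    using hopf[of 1] unfolding DFu by (simp add: herm_form_bilin o1 o2 add.commute)
  have e2: "\<i> * herm_form (Du \<i>) (N z) - \<i> * herm_form (ctransp (Du \<i>)) (N z) = - Q + H * (2 * k z) - cnj Q"
    using hopf[of \<i>] unfolding DFu by (simp add: herm_form_bilin o1 o2)
  have wN: "herm_form w (N z) = H * k z"
  proof -
    have "4 * herm_form w (N z) = 2 * herm_form w (N z) + 2 * herm_form (ctransp w) (N z)" by (simp add: wh)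
    also have "\<dots> = (herm_form (Du 1) (N z) + herm_form (ctransp (Du 1)) (N z)) + (\<i> * herm_form (Du \<i>) (N z) - \<i> * herm_form (ctransp (Du \<i>)) (N z))"
      unfolding w_def ctransp_cscale ctransp_add by (simp add: herm_form_bilin algebra_simps)
    also have "\<dots> = 4 * (H * k z)" unfolding e1 e2 by simp
    finally show ?thesis by simp
  qed
  have wu: "herm_form w u = 0"
  proof -
    have "((\<lambda>x. 0) has_derivative (\<lambda>h. herm_form u (Du h) + herm_form (Du h) u)) (at z)"
      using has_derivative_herm_form[OF Du Du] unfolding cf(5) u .
    from has_derivative_of_const[OF this]
    have "herm_form u (Du h) + herm_form (Du h) u = 0" for h .
    then have "2 * herm_form (Du h) u = 0" for h by (simp add: herm_form_sym[of u])
    then have "herm_form (Du h) u = 0" for h by simp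
    then show ?thesis unfolding w_def by (simp add: herm_form_bilin)
  qed
  have wuc: "herm_form w (ctransp u) = 0"
    using arg_cong[OF wu, of cnj] unfolding cnj_herm_form wh by simp
  have wb: "herm_form w (base_pt sp (F z)) = - H * k z"
  proof -
    have "((\<lambda>x. 0) has_derivative (\<lambda>h. herm_form (base_pt sp (F z)) (Du h) + herm_form (cscale H (DF z h)) u)) (at z)"
      using has_derivative_herm_form[OF db Du] unfolding cf(4) u .
    from has_derivative_of_const[OF this]
    have "herm_form (base_pt sp (F z)) (Du h) + herm_form (cscale H (DF z h)) u = 0" for h .
    then have b: "herm_form (base_pt sp (F z)) (Du h) = - herm_form (cscale H (DF z h)) u" for h by (simp add: add_eq_0_iff)
    have uu: "herm_form u u = 0" "herm_form (ctransp u) u = k z" unfolding u using cf(5) by (auto simp: k_def herm_form_sym)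
    have "herm_form (base_pt sp (F z)) w = - H * k z"
      unfolding w_def herm_form_bilin b DFu uu by (simp add: algebra_simps)
    then show ?thesis by (simp add: herm_form_sym)
  qed
  have "k z * herm_form w (N z) = herm_form w (M z) - k z * herm_form w (base_pt sp (F z))"
    unfolding N using kpos by (simp add: herm_form_bilin right_diff_distrib)
  then have wM: "herm_form w (M z) = 0" unfolding wN wb by (simp add: algebra_simps)
  have "w - cscale H (M z) = 0"
  proof (rule orthogonal_frame_zero[OF spx cf(4-6)])
    show "herm_form (base_pt sp (F z)) (w - cscale H (M z)) = 0"
      using wb fp(4)[of z] by (simp add: herm_form_bilin herm_form_sym[of _ w])
    show "herm_form (diff_z F z) (w - cscale H (M z)) = 0"
      using wu fp(1)[of z] by (simp add: herm_form_bilin u herm_form_sym[of "diff_z F z"])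
    show "herm_form (ctransp (diff_z F z)) (w - cscale H (M z)) = 0"
      using wuc fp(2)[of z] by (simp add: herm_form_bilin u herm_form_sym[of "ctransp (diff_z F z)"])
    show "herm_form (ctransp (diff_z F z) ** adjugate2 (base_pt sp (F z)) ** diff_z F z) (w - cscale H (M z)) = 0"
      unfolding M_def[symmetric]
      using wM fp(3)[of z] by (simp add: herm_form_bilin herm_form_sym[of "M z" w])
  qed
  then show ?thesis unfolding w_def[symmetric] H_def[symmetric] M_def u by simp
qed

text \<open>This is the derivative of the inverse, \<open>d(p\<^sup>-\<^sup>1) = - p\<^sup>-\<^sup>1 dp p\<^sup>-\<^sup>1\<close>, as the adjugate is linear on
\<open>2 \<times> 2\<close> matrices and inverts \<open>p\<close>.\<close>

lemma adj_sandwich: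
  assumes "det p = 1" "herm_form p x = 0"
  shows "adjugate2 p ** x ** adjugate2 p = - adjugate2 x"
proof -
  have "trace (adjugate2 p ** x) = 0"
  proof -
    have "trace (adjugate2 p ** x) = - 2 * herm_form p x" by (simp add: entries algebra_simps)
    then show ?thesis using assms(2) by simp
  qed
  then have "adjugate2 x ** p = - (adjugate2 p ** x)"
    using adj_trace_free[of "adjugate2 p ** x"] by (simp add: adj_mult)
  then have "adjugate2 x ** p ** adjugate2 p = - (adjugate2 p ** x ** adjugate2 p)"
    by (simp add: mat_mult_uminus)
  moreover have "adjugate2 x ** p ** adjugate2 p = adjugate2 x"
    using adj_inverse[OF assms(1)] by (simp add: matrix_mul_assoc[symmetric])
  ultimately show ?thesis by simp
qed

text \<open>Minimal surfaces have holomorphic \<open>f\<^sub>z\<close>, and surfaces of constant mean curvature 1 in hyperbolic space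
have holomorphic \<open>f\<^sup>-\<^sup>1 f\<^sub>z\<close>: the derivative of \<open>f\<^sup>-\<^sup>1\<close> cancels the mean curvature term.\<close>

lemma cmc_holomorphic:
  assumes F: "conformal_immersion sp F" and cmc: "has_ambient_cmc sp F"
  obtains B' where "mat_deriv (\<lambda>z. adjugate2 (base_pt sp (F z)) ** diff_z F z) B'"
proof -
  define H where "H = complex_of_real (cmc_const sp)"
  have sm: "smooth F" and sp: "range F \<subseteq> space_of sp" using F by (auto simp: conformal_immersion_def)
  have spx: "F x \<in> space_of sp" for x using sp by auto
  note cf = conformal_frame[OF F refl]
  define B where "B = (\<lambda>z. adjugate2 (base_pt sp (F z)) ** diff_z F z)"
  have "\<exists>b. (B has_derivative (\<lambda>h. cscale h b)) (at z)" for z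
  proof -
    define u where "u = diff_z F z"
    define P where "P = adjugate2 (base_pt sp (F z))"
    define DF where "DF = frechet_derivative F (at z)"
    have DF: "(F has_derivative DF) (at z)" unfolding DF_def by (rule smooth_derivs[OF sm])
    have db: "((\<lambda>x. base_pt sp (F x)) has_derivative (\<lambda>h. cscale H (DF h))) (at z)"
      by (cases sp) (use DF in \<open>auto simp: H_def cmc_const_def\<close>)
    have "diff_z F differentiable (at z)"
    proof -
      have "diff_z F = (\<lambda>x. cscale (1/2) (frechet_derivative F (at x) 1 - cscale \<i> (frechet_derivative F (at x) \<i>)))"
        by (simp add: fun_eq_iff diff_z_def diff_x_def diff_y_def)
      then show ?thesis unfolding differentiable_def
        using has_derivative_cscale[OF has_derivative_const[of "1/2"] has_derivative_diff[OF smooth_derivs(2)[OF sm, of 1 z]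
            has_derivative_cscale[OF has_derivative_const[of \<i>] smooth_derivs(2)[OF sm, of \<i> z]]]] by auto
    qed
    then obtain Du where Du: "(diff_z F has_derivative Du) (at z)" by (auto simp: differentiable_def)
    define DB where "DB = (\<lambda>h. P ** Du h + adjugate2 (cscale H (DF h)) ** u)"
    have DB: "(B has_derivative DB) (at z)" unfolding B_def DB_def P_def u_def
      by (rule has_derivative_mat_mult[OF has_derivative_adj[OF db] Du])
    have eq: "Du 1 + cscale \<i> (Du \<i>) = cscale (2 * H) (ctransp u ** P ** u)"
    proof -
      have "Du 1 + cscale \<i> (Du \<i>) = cscale 2 (cscale (1/2) (Du 1 + cscale \<i> (Du \<i>)))" by (simp add: cscale_cscale)
      then show ?thesis unfolding cmc_equation[OF F cmc Du u_def] by (simp add: cscale_cscale P_def H_def)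
    qed
    have DFu: "DF h = cscale h u + cscale (cnj h) (ctransp u)" for h
      unfolding DF_def u_def using cf(8)[of z h] .
    have ac: "adjugate2 (cscale c x) = cscale c (adjugate2 x)" "adjugate2 (x + y) = adjugate2 x + adjugate2 y" for c x y
      by (simp_all add: entries)
    have det: "det (base_pt sp (F z)) = 1" and bh: "ctransp (base_pt sp (F z)) = base_pt sp (F z)"
      by (rule frame_products[OF spx cf(4-6)])+
    have "herm_form (base_pt sp (F z)) (ctransp u) = 0"
      using arg_cong[OF cf(4), of cnj z] unfolding cnj_herm_form bh u_def by simp
    then have sand: "P ** ctransp u ** P = - adjugate2 (ctransp u)"
      unfolding P_def by (rule adj_sandwich[OF det])
    have "DB 1 + cscale \<i> (DB \<i>) = P ** (Du 1 + cscale \<i> (Du \<i>)) + cscale (2 * H) (adjugate2 (ctransp u) ** u)"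
      unfolding DB_def DFu ac by (simp add: entries algebra_simps)
    also have "\<dots> = cscale (2 * H) ((P ** ctransp u ** P) ** u + adjugate2 (ctransp u) ** u)"
      unfolding eq by (simp add: cscale_mult_right cscale_add_right matrix_mul_assoc)
    also have "\<dots> = 0" unfolding sand by (simp add: mat_mult_uminus)
    finally have z: "DB 1 + cscale \<i> (DB \<i>) = 0" .
    have DB_eq: "DB = (\<lambda>h. cscale h (cscale (1/2) (DB 1 - cscale \<i> (DB \<i>))))"
    proof
      fix h
      show "DB h = cscale h (cscale (1/2) (DB 1 - cscale \<i> (DB \<i>)))"
        using real_linear_split[OF has_derivative_linear[OF DB], of h] unfolding z by simp
    qed
    show ?thesis by (rule exI, rule has_derivative_eq_rhs[OF DB DB_eq])
  qed
  then have "\<exists>B'. \<forall>z. (B has_derivative (\<lambda>h. cscale h (B' z))) (at z)" by (intro choice allI)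
  then show thesis using that unfolding B_def mat_deriv_def by blast
qed

text \<open>The curvature condition is known only on the universal cover of the punctured plane, where it makes
\<open>z A(z)\<close> holomorphic in \<open>log z\<close>. So \<open>A\<close> is holomorphic away from 0, and it is continuous at 0
because \<open>g\<close> is smooth there.\<close>

lemma descend_exp:
  assumes g: "conformal_immersion sp g" and F: "conformal_immersion sp (g \<circ> exp)" and cmc: "has_ambient_cmc sp (g \<circ> exp)"
  obtains A' where "mat_deriv (\<lambda>z. adjugate2 (base_pt sp (g z)) ** diff_z g z) A'"
proof -
  define A where "A = (\<lambda>z. adjugate2 (base_pt sp (g z)) ** diff_z g z)"
  define B where "B = (\<lambda>z. adjugate2 (base_pt sp ((g \<circ> exp) z)) ** diff_z (g \<circ> exp) z)"
  obtain B' where B': "mat_deriv B B'" using cmc_holomorphic[OF F cmc] unfolding B_def by blast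
  have sm: "smooth g" using g by (auto simp: conformal_immersion_def)
  have dz: "diff_z (g \<circ> exp) w = cscale (exp w) (diff_z g (exp w))" for w
  proof -
    define u where "u = diff_z g (exp w)"
    have "((\<lambda>w. g (exp w)) has_derivative (\<lambda>h. frechet_derivative g (at (exp w)) (exp w * h))) (at w)"
      using has_derivative_compose[OF DERIV_exp[of w, unfolded has_field_derivative_def] smooth_derivs(1)[OF sm]] .
    then have "frechet_derivative (g \<circ> exp) (at w) = (\<lambda>h. frechet_derivative g (at (exp w)) (exp w * h))"
      unfolding comp_def by (rule frechet_eq)
    then have fd: "frechet_derivative (g \<circ> exp) (at w) h = cscale (exp w * h) u + cscale (cnj (exp w * h)) (ctransp u)" for h
      using conformal_frame(8)[OF g u_def] by simp
    show ?thesis unfolding diff_z_def[of "g \<circ> exp"] diff_x_def diff_y_def fd u_def[symmetric]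
      by (simp add: entries field_simps)
  qed
  have BA: "B w = cscale (exp w) (A (exp w))" for w
    unfolding B_def A_def dz by (simp add: cscale_mult_right)
  have hol: "(\<lambda>z. A z $ i $ j) holomorphic_on UNIV" for i j
  proof (rule no_isolated_singularity[where K="{0}"])
    have "continuous (at z) A" for z
    proof -
      have c1: "continuous (at z) g" using has_derivative_continuous[OF smooth_derivs(1)[OF sm]] .
      have c2: "continuous (at z) (\<lambda>z. frechet_derivative g (at z) v)" for v
        using has_derivative_continuous[OF smooth_derivs(2)[OF sm]] .
      have c3: "continuous (at z) (\<lambda>z. base_pt sp (g z))" by (cases sp) (use c1 in auto)
      have c4: "continuous (at z) (diff_z g)"
        unfolding diff_z_def[abs_def] diff_x_def diff_y_def
        by (intro bounded_bilinear.continuous[OF bounded_bilinear_cscale] continuous_diff continuous_const c2)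
      show ?thesis unfolding A_def
        by (intro bounded_bilinear.continuous[OF bounded_bilinear_mat_mult] bounded_linear.continuous[OF bounded_linear_adj] c3 c4)
    qed
    then show "continuous_on UNIV (\<lambda>z. A z $ i $ j)"
      unfolding continuous_on_eq_continuous_at[OF open_UNIV]
      by (intro ballI bounded_linear.continuous[OF bounded_linear_nth_nth])
    show "(\<lambda>z. A z $ i $ j) holomorphic_on UNIV - {0}"
      unfolding holomorphic_on_open[OF open_Diff[OF open_UNIV closed_singleton]]
    proof
      fix z0 :: complex assume "z0 \<in> UNIV - {0}"
      then have z0: "z0 \<noteq> 0" by simp
      \<comment> \<open>A branch of the logarithm near \<open>z0\<close>, whatever the argument of \<open>z0\<close>.\<close>
      define L where "L = (\<lambda>z. Ln z0 + Ln (z / z0))"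
      define S where "S = {z. z / z0 \<notin> \<real>\<^sub>\<le>\<^sub>0}"
      have S: "open S"
      proof -
        have "S = (\<lambda>z. z / z0) -` (- \<real>\<^sub>\<le>\<^sub>0)" by (auto simp: S_def)
        then show ?thesis by (simp add: z0) (intro open_vimage open_Compl closed_nonpos_Reals_complex continuous_intros, simp add: z0)
      qed
      have z0S: "z0 \<in> S" using z0 by (simp add: S_def)
      have e: "A z $ i $ j = B (L z) $ i $ j / z" if "z \<in> S" for z
      proof -
        have nz: "z \<noteq> 0" using that by (auto simp: S_def)
        have "exp (L z) = z" using z0 nz by (simp add: L_def exp_add)
        then show ?thesis using BA[of "L z"] nz by (simp add: cscale_nth)
      qed
      have L: "(L has_field_derivative inverse (z0 / z0) * (1 / z0)) (at z0)"
        unfolding L_def using z0 by (auto intro!: derivative_eq_intros)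
      have dB: "((\<lambda>z. B (L z) $ i $ j / z) has_field_derivative
        ((B' (L z0) $ i $ j * (inverse (z0 / z0) * (1 / z0))) * z0 - B (L z0) $ i $ j * 1) / (z0 * z0)) (at z0)"
        by (intro DERIV_divide DERIV_chain2[where f="\<lambda>w. B w $ i $ j", OF mat_deriv_entry[OF B'] L] DERIV_ident z0)
      then show "\<exists>f'. ((\<lambda>z. A z $ i $ j) has_field_derivative f') (at z0)"
        using has_field_derivative_transform_within_open[OF dB S z0S e[symmetric]] by blast
    qed
  qed auto
  have "mat_deriv A (\<lambda>z. \<chi> i j. deriv (\<lambda>z. A z $ i $ j) z)"
    unfolding mat_deriv_entries_iff using holomorphic_derivI[OF hol open_UNIV UNIV_I] by simp
  then show thesis using that unfolding A_def by blast
qed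

text \<open>In Euclidean space the data is \<open>g\<^sub>z\<close> itself. In hyperbolic space \<open>a = g\<^sup>-\<^sup>1 g\<^sub>z\<close> is entire, and \<open>\<Psi>\<close> is the
solution of \<open>\<Psi>' = \<Psi> a\<close> that starts at a factor of \<open>g(0)\<close>. Then \<open>(\<Psi>\<^sup>-\<^sup>1)\<^sup>* g \<Psi>\<^sup>-\<^sup>1\<close> has vanishing
derivative, which gives \<open>g = \<Psi>\<^sup>* \<Psi>\<close>.\<close>

lemma hol_data_exists:
  assumes g: "conformal_immersion sp g" and A: "mat_deriv (\<lambda>z. adjugate2 (base_pt sp (g z)) ** diff_z g z) A'"
  obtains X \<Psi> where "hol_data sp g X \<Psi>"
proof -
  have sm: "smooth g" and sp: "range g \<subseteq> space_of sp" using g by (auto simp: conformal_immersion_def)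
  have spx: "g x \<in> space_of sp" for x using sp by auto
  note cf = conformal_frame[OF g refl]
  have fd: "frechet_derivative g (at z) = (\<lambda>h. cscale h (diff_z g z) + ctransp (cscale h (diff_z g z)))" for z
    using cf(8) by (simp add: fun_eq_iff ctransp_cscale)
  have dg: "(g has_derivative (\<lambda>h. cscale h (diff_z g z) + ctransp (cscale h (diff_z g z)))) (at z)" for z
    using smooth_derivs(1)[OF sm, of z] unfolding fd .
  show thesis
  proof (cases sp)
    case Euc3
    have m: "mat_deriv (diff_z g) A'" using A Euc3 by simp
    have "hol_data Euc3 g (diff_z g) (\<lambda>z. mat 1)"
    proof (rule hol_data_Euc3I[OF m])
      fix z
      show "det (diff_z g z) = 0" using cf(5)[of z] by (simp add: herm_form_self)
      show "trace (diff_z g z) = 0" using cf(4)[of z] Euc3 by (simp add: herm_form_mat1)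
      show "diff_z g z \<noteq> 0" by (rule cf)
      show "g z \<in> space_of Euc3" using spx Euc3 by blast
      show "(g has_derivative (\<lambda>h. cscale h (diff_z g z) + ctransp (cscale h (diff_z g z)))) (at z)" by (rule dg)
    qed
    then show ?thesis using that Euc3 by blast
  next
    case Hyp3
    define a where "a = (\<lambda>z. adjugate2 (g z) ** diff_z g z)"
    have a: "mat_deriv a A'" using A Hyp3 by (simp add: a_def)
    have g1: "det (g z) = 1" and gh: "ctransp (g z) = g z" for z using spx[of z] Hyp3 by (auto simp: hermitian_def)
    have gz: "diff_z g z = g z ** a z" for z unfolding a_def by (simp add: adj_cancel[OF g1])
    have tra: "trace (a z) = 0" for z
    proof -
      have "trace (a z) = - 2 * herm_form (diff_z g z) (g z)"
        by (simp add: a_def entries algebra_simps)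
      then show ?thesis using cf(4)[of z] Hyp3 by (simp add: herm_form_sym)
    qed
    have deta: "det (a z) = 0" for z
      using cf(5)[of z] by (simp add: a_def det_mul herm_form_self)
    obtain W where W: "det W = 1" "g 0 = W ** ctransp W" using cholesky spx[of 0] Hyp3 by blast
    obtain \<Psi> where P: "mat_deriv \<Psi> (\<lambda>z. \<Psi> z ** a z)" "\<Psi> 0 = ctransp W" using linear_ode_exists[OF a] .
    have det: "det (\<Psi> z) = 1" for z using det_const_of_ode[OF P(1) tra, of z] P(2) W(1) by simp
    define R where "R = (\<lambda>z. adjugate2 (\<Psi> z))"
    have dR: "mat_deriv R (\<lambda>z. - (a z ** R z))"
      using mat_deriv_adj[OF P(1)] unfolding R_def by (simp add: adj_mult adj_trace_free[OF tra] mat_mult_uminus)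
    define G where "G = (\<lambda>z. ctransp (R z) ** g z ** R z)"
    have "(G has_derivative (\<lambda>h. 0)) (at z)" for z
    proof -
      have "(G has_derivative (\<lambda>h. (ctransp (R z) ** g z) ** cscale h (- (a z ** R z)) +
         (ctransp (R z) ** (cscale h (diff_z g z) + ctransp (cscale h (diff_z g z))) + ctransp (cscale h (- (a z ** R z))) ** g z) ** R z)) (at z)"
        unfolding G_def by (intro has_derivative_mat_mult has_derivative_ctransp mat_derivD[OF dR] dg)
      moreover have "(ctransp (R z) ** g z) ** cscale h (- (a z ** R z)) +
         (ctransp (R z) ** (cscale h (diff_z g z) + ctransp (cscale h (diff_z g z))) + ctransp (cscale h (- (a z ** R z))) ** g z) ** R z = 0" for h
      proof -
        have cm: "cscale h (- x) = - cscale h x" "ctransp (- x) = - ctransp x" for x by (simp_all add: entries)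
        show ?thesis unfolding gz cm
          by (simp add: ctransp_cscale ctransp_mult gh cscale_mult_left cscale_mult_right mat_distrib mat_mult_uminus matrix_mul_assoc)
      qed
      ultimately show ?thesis by simp
    qed
    then have "G z = G 0" for z by (rule has_derivative_zero_imp_const)
    moreover have "G 0 = mat 1"
    proof -
      have "G 0 = (adjugate2 W ** W) ** (ctransp W ** adjugate2 (ctransp W))"
        unfolding G_def R_def P(2) W(2) adj_ctransp by (simp add: matrix_mul_assoc)
      then show ?thesis using adj_inverse[OF W(1)] adj_inverse[of "ctransp W"] W(1) by simp
    qed
    ultimately have G: "G z = mat 1" for z by simp
    have f: "g z = ctransp (\<Psi> z) ** \<Psi> z" for z
    proof -
      have "ctransp (\<Psi> z) ** G z ** \<Psi> z = ctransp (R z ** \<Psi> z) ** g z ** (R z ** \<Psi> z)"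
        unfolding G_def by (simp only: ctransp_mult matrix_mul_assoc)
      then show ?thesis unfolding G using adj_inverse[OF det[of z]] by (simp add: R_def)
    qed
    define X where "X = (\<lambda>z. \<Psi> z ** a z ** R z)"
    have XP: "X z ** \<Psi> z = \<Psi> z ** a z" for z
      unfolding X_def R_def using adj_inverse[OF det[of z]] by (simp add: matrix_mul_assoc[symmetric])
    have dX: "\<exists>X'. mat_deriv X X'" unfolding X_def using mat_deriv_mult[OF mat_deriv_mult[OF P(1) a] dR] by blast
    then obtain X' where X': "mat_deriv X X'" by blast
    have "hol_data Hyp3 g X \<Psi>"
    proof (rule hol_data_Hyp3I[OF X' _ _ _ _ det f])
      show "mat_deriv \<Psi> (\<lambda>z. X z ** \<Psi> z)" unfolding XP by (rule P)
      fix z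
      show "det (X z) = 0" by (simp add: X_def det_mul deta)
      have "trace (X z) = trace (R z ** \<Psi> z ** a z)" unfolding X_def by (simp add: entries algebra_simps)
      then show "trace (X z) = 0" using adj_inverse[OF det[of z]] tra by (simp add: R_def)
      show "X z \<noteq> 0"
      proof
        assume "X z = 0"
        then have "\<Psi> z ** a z = 0" using XP[of z] by simp
        then have "a z = 0" using adj_cancel(2)[OF det[of z], of "a z"] by simp
        then show False using gz[of z] cf(6)[of z] by simp
      qed
    qed
    then show ?thesis using that Hyp3 by blast
  qed
qed

section \<open>Null data of radial norm\<close>

text \<open>Reflection in circles. The function \<open>K(z, w) = \<Sum> f\<^sub>i(z) cnj (f\<^sub>i(cnj w))\<close> is holomorphic in both
variables, and \<open>t / z = cnj z\<close> on the circle \<open>|z|\<^sup>2 = t\<close>. So \<open>z \<mapsto> K(z, t/z)\<close> is constant on that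
circle, hence on the punctured plane. Letting \<open>t \<rightarrow> 0\<close> shows that \<open>K(z, 0)\<close> is constant.\<close>

lemma radial_sum_const:
  fixes f :: "'i \<Rightarrow> complex \<Rightarrow> complex"
  assumes hol: "\<And>i. i \<in> I \<Longrightarrow> f i holomorphic_on UNIV"
    and radial: "\<And>z w. z \<noteq> 0 \<Longrightarrow> cmod z = cmod w \<Longrightarrow> (\<Sum>i\<in>I. f i z * cnj (f i z)) = (\<Sum>i\<in>I. f i w * cnj (f i w))"
  shows "(\<Sum>i\<in>I. f i z * cnj (f i 0)) = (\<Sum>i\<in>I. f i 0 * cnj (f i 0))"
proof -
  define K where "K = (\<lambda>z w. \<Sum>i\<in>I. f i z * cnj (f i (cnj w)))"
  have hol': "(\<lambda>w. cnj (f i (cnj w))) holomorphic_on UNIV" if "i \<in> I" for i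
    using holomorphic_on_compose_cnj_cnj[of "f i" UNIV] holomorphic_on_subset[OF hol[OF that]] by (simp add: comp_def)
  have eq: "K z (of_real t / z) = K 1 (of_real t)" if t: "t > 0" and z: "z \<noteq> 0" for t :: real and z :: complex
  proof -
    define c where "c = K (of_real (sqrt t)) (of_real (sqrt t))"
    have "K z (of_real t / z) - c = 0" if z: "z \<noteq> 0" for z
    proof (rule analytic_continuation[where f="\<lambda>z. K z (of_real t / z) - c" and w=z and S="- {0}" and U="sphere 0 (sqrt t)" and \<xi>="of_real (sqrt t)"])
      have "(\<lambda>z. cnj (f i (cnj (of_real t / z)))) holomorphic_on - {0}" if "i \<in> I" for i
      proof -
        have "(\<lambda>z. complex_of_real t / z) holomorphic_on - {0}" by (auto intro!: holomorphic_intros)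
        from holomorphic_on_compose[OF this holomorphic_on_subset[OF hol'[OF that] subset_UNIV]]
        show ?thesis unfolding comp_def .
      qed
      then show "(\<lambda>z. K z (of_real t / z) - c) holomorphic_on - {0}"
        unfolding K_def by (intro holomorphic_intros holomorphic_on_subset[OF hol]) auto
      show "open (- {0::complex})" by auto
      show "connected (- {0::complex})" by (rule connected_punctured_universe) simp
      show "sphere 0 (sqrt t) \<subseteq> - {0::complex}" using t by auto
      show "complex_of_real (sqrt t) \<in> - {0}" using t by simp
      show "complex_of_real (sqrt t) islimpt sphere 0 (sqrt t)"
      proof (rule connected_imp_perfect)
        show "connected (sphere (0::complex) (sqrt t))" by (rule connected_sphere) simp
        show "complex_of_real (sqrt t) \<in> sphere 0 (sqrt t)" using t by simp
        fix x :: complex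
        have "complex_of_real (sqrt t) \<in> sphere 0 (sqrt t)" "- complex_of_real (sqrt t) \<in> sphere 0 (sqrt t)"
          "complex_of_real (sqrt t) \<noteq> - complex_of_real (sqrt t)" using t by simp_all
        then show "sphere 0 (sqrt t) \<noteq> {x}" by (metis singletonD)
      qed
      show "z \<in> - {0}" using z by simp
    next
      fix y :: complex assume y: "y \<in> sphere 0 (sqrt t)"
      then have y0: "y \<noteq> 0" and ny: "cmod y = sqrt t" using t by auto
      have "y * cnj y = of_real t" using ny t by (simp add: complex_norm_square[symmetric] flip: of_real_power)
      then have "of_real t / y = cnj y" using y0 by (simp add: field_simps)
      then have "K y (of_real t / y) = (\<Sum>i\<in>I. f i y * cnj (f i y))" by (simp add: K_def)
      also have "\<dots> = c" unfolding c_def K_def using radial[OF y0, of "of_real (sqrt t)"] ny t by simp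
      finally show "K y (of_real t / y) - c = 0" by simp
    qed
    from this[OF z] this[of 1] show ?thesis by simp
  qed
  have lim: "(\<lambda>n. K z (of_real (1 / real (Suc n)) / a)) \<longlonglongrightarrow> K z 0" for z a
  proof -
    have "isCont (\<lambda>w. K z w) 0" unfolding K_def
    proof (intro continuous_sum continuous_mult continuous_const)
      fix i assume "i \<in> I"
      then show "isCont (\<lambda>w. cnj (f i (cnj w))) 0"
        using hol' holomorphic_on_imp_continuous_on continuous_on_eq_continuous_at[OF open_UNIV] by blast
    qed
    moreover have "(\<lambda>n. complex_of_real (1 / real (Suc n)) / a) \<longlonglongrightarrow> 0"
    proof -
      have "(\<lambda>n. 1 / real (Suc n)) \<longlonglongrightarrow> 0" by real_asymp
      then have "(\<lambda>n. complex_of_real (1 / real (Suc n)) / a) \<longlonglongrightarrow> of_real 0 / a"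
        unfolding divide_inverse[of _ a] by (intro tendsto_mult tendsto_of_real tendsto_const)
      then show ?thesis by simp
    qed
    ultimately show ?thesis by (rule isCont_tendsto_compose)
  qed
  have k: "K z 0 = K 1 0" if "z \<noteq> 0" for z
  proof -
    have "(\<lambda>n. K z (of_real (1 / real (Suc n)) / z)) = (\<lambda>n. K 1 (of_real (1 / real (Suc n)) / 1))"
      using eq[OF _ that, of "1 / real (Suc n)" for n] by (simp add: fun_eq_iff)
    then have "(\<lambda>n. K z (of_real (1 / real (Suc n)) / z)) \<longlonglongrightarrow> K 1 0" using lim[of 1 1] by (simp only:)
    from LIMSEQ_unique[OF lim this] show ?thesis .
  qed
  have c: "isCont (\<lambda>z. K z 0) 0" unfolding K_def
  proof (intro continuous_sum continuous_mult continuous_const)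
    fix i assume "i \<in> I"
    then show "isCont (f i) 0"
      using hol holomorphic_on_imp_continuous_on continuous_on_eq_continuous_at[OF open_UNIV] by blast
  qed
  have "(\<lambda>n. complex_of_real (1 / real (Suc n))) \<longlonglongrightarrow> of_real 0"
    by (intro tendsto_of_real) real_asymp
  from isCont_tendsto_compose[OF c, of "\<lambda>n. complex_of_real (1 / real (Suc n))" sequentially] this
  have "(\<lambda>n. K (of_real (1 / real (Suc n))) 0) \<longlonglongrightarrow> K 0 0" by simp
  moreover have "K (of_real (1 / real (Suc n))) 0 = K 1 0" for n
    by (rule k) (simp del: of_nat_Suc)
  ultimately have "(\<lambda>n. K 1 0) \<longlonglongrightarrow> K 0 0" by (simp only:)
  from LIMSEQ_unique[OF this tendsto_const] have "K 0 0 = K 1 0" .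
  then have "K z 0 = K 0 0" using k[of z] by (cases "z = 0") auto
  then show ?thesis by (simp add: K_def)
qed

text \<open>After division by the leading power of \<open>z\<close> the quotient is nonzero at 0, and the preceding lemma for
this single function makes it constant.\<close>

lemma radial_entire_monomial:
  assumes p: "p holomorphic_on UNIV" and radial: "\<And>z w. z \<noteq> 0 \<Longrightarrow> cmod z = cmod w \<Longrightarrow> cmod (p z) = cmod (p w)"
  obtains c k where "\<And>z. p z = c * z ^ k"
proof -
  obtain P where P: "fps_entire P" "eval_fps P = p" using entire_fps[OF p] .
  show thesis
  proof (cases "P = 0")
    case True
    then show thesis using that[of 0] P(2) by (auto simp: fun_eq_iff)
  next
    case False
    define k where "k = subdegree P"
    define G where "G = fps_shift k P"
    have G: "fps_entire G" using P(1) by (simp add: G_def fps_entire_def)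
    have "P = G * fps_X ^ k" unfolding G_def k_def by (rule subdegree_decompose)
    then have "p z = eval_fps (G * fps_X ^ k) z" for z using P(2) by metis
    also have "eval_fps (G * fps_X ^ k) z = eval_fps G z * z ^ k" for z
      using eval_fps_entire(1)[OF G, of "fps_X ^ k"] by (simp add: fps_entire_def)
    finally have pG: "p z = eval_fps G z * z ^ k" for z .
    have G0: "eval_fps G 0 \<noteq> 0" unfolding eval_fps_at_0 G_def k_def using False by simp
    have "(\<Sum>i\<in>{()}. eval_fps G z * cnj (eval_fps G 0)) = (\<Sum>i\<in>{()}. eval_fps G 0 * cnj (eval_fps G 0))" for z
    proof (rule radial_sum_const[where f="\<lambda>_. eval_fps G"])
      show "eval_fps G holomorphic_on UNIV"
        using eval_fps_entire(3)[OF G G] by (auto simp: holomorphic_on_def field_differentiable_def intro: has_field_derivative_at_within)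
      fix z w :: complex assume zw: "z \<noteq> 0" "cmod z = cmod w"
      have "cmod (eval_fps G z) * cmod z ^ k = cmod (eval_fps G w) * cmod w ^ k"
        using radial[OF zw] unfolding pG by (simp add: norm_mult norm_power)
      moreover have "w \<noteq> 0" using zw by auto
      ultimately have "cmod (eval_fps G z) = cmod (eval_fps G w)" using zw by simp
      then show "(\<Sum>i\<in>{()}. eval_fps G z * cnj (eval_fps G z)) = (\<Sum>i\<in>{()}. eval_fps G w * cnj (eval_fps G w))"
        by (simp add: complex_norm_square[symmetric])
    qed
    then have "eval_fps G z = eval_fps G 0" for z using G0 by simp
    then show thesis using that[of "eval_fps G 0" k] pG by simp
  qed
qed

lemma herm_form_star_trace_free:
  assumes "trace X = 0"
  shows "herm_form X (ctransp X) = (\<Sum>i\<in>UNIV. X $ fst i $ snd i * cnj (X $ fst i $ snd i)) / 2"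
proof -
  have a: "X$2$2 = - X$1$1" using assms by (simp add: entries add_eq_0_iff2)
  have "(\<Sum>i\<in>UNIV. X $ fst i $ snd i * cnj (X $ fst i $ snd i)) = (\<Sum>i\<in>UNIV. \<Sum>j\<in>UNIV. X $ i $ j * cnj (X $ i $ j))"
    unfolding UNIV_Times_UNIV[symmetric] sum.cartesian_product by (simp add: case_prod_unfold)
  then show ?thesis by (simp add: sum_2 herm_form_nth ctransp_nth a field_simps)
qed

lemma unitary_mult:
  assumes "det U = 1" "U ** ctransp U = mat 1" "det D = 1" "D ** ctransp D = mat 1"
  shows "det (U ** D) = 1" "(U ** D) ** ctransp (U ** D) = mat 1"
proof -
  show "det (U ** D) = 1" using assms by (simp add: det_mul)
  have "(U ** D) ** ctransp (U ** D) = U ** (D ** ctransp D) ** ctransp U"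
    by (simp only: ctransp_mult matrix_mul_assoc)
  then show "(U ** D) ** ctransp (U ** D) = mat 1" using assms by simp
qed

text \<open>Rotate \<open>X(0)\<close> to a matrix whose only entry is \<open>s\<close>, in the lower left corner. Constancy of
\<open>tr(X(z) X(0)\<^sup>*)\<close> makes the lower left entry of \<open>X\<close> constant, and \<open>det X = 0\<close> expresses the upper right
entry by the diagonal entry \<open>p\<close>. The norm of \<open>X\<close> is then a strictly increasing function of \<open>|p|\<close>, so
\<open>|p|\<close> is radial and \<open>p\<close> is a monomial.\<close>

lemma radial_nilpotent_normal_form:
  assumes X: "mat_deriv X X'" and det: "\<And>z. det (X z) = 0" and tr: "\<And>z. trace (X z) = 0" and nz: "X 0 \<noteq> 0"
    and radial: "\<And>z w. z \<noteq> 0 \<Longrightarrow> cmod z = cmod w \<Longrightarrow> herm_form (X z) (ctransp (X z)) = herm_form (X w) (ctransp (X w))"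
  obtains U s c k where "det U = 1" "U ** ctransp U = mat 1" "s \<noteq> 0" "c = 0 \<or> k > 0"
    "\<And>z::complex. X z = U ** mk2 (c * z ^ k) (- (c * z ^ k)\<^sup>2 / s) s (- (c * z ^ k)) ** ctransp U"
proof -
  obtain U s where U: "det U = 1" "U ** ctransp U = mat 1" "s \<noteq> 0" "X 0 = U ** mk2 0 0 s 0 ** ctransp U"
    using nilpotent_schur[OF det tr nz] .
  note U' = unitary_inverse[OF U(1,2)]
  define Y where "Y = (\<lambda>z. ctransp U ** X z ** U)"
  have XY: "X z = U ** Y z ** ctransp U" for z
  proof -
    have "U ** Y z ** ctransp U = (U ** ctransp U) ** X z ** (U ** ctransp U)"
      unfolding Y_def by (simp only: matrix_mul_assoc)
    then show ?thesis using U(2) by simp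
  qed
  have dY: "mat_deriv Y (\<lambda>z. ctransp U ** X' z ** U)"
    unfolding Y_def using mat_deriv_mult[OF mat_deriv_mult[OF mat_deriv_const X] mat_deriv_const, of "ctransp U" U] by simp
  have Y0: "Y 0 = mk2 0 0 s 0"
  proof -
    have "Y 0 = (ctransp U ** U) ** mk2 0 0 s 0 ** (ctransp U ** U)" unfolding Y_def U(4) by (simp only: matrix_mul_assoc)
    then show ?thesis using U'(2) by simp
  qed
  have trY: "trace (Y z) = 0" for z
  proof -
    have "trace (Y z) = trace (U ** ctransp U ** X z)" unfolding Y_def by (simp add: entries algebra_simps)
    then show ?thesis using U(2) tr by simp
  qed
  have detY: "det (Y z) = 0" for z unfolding Y_def by (simp add: det_mul det)
  have hY: "herm_form (Y z) (ctransp (Y z)) = herm_form (X z) (ctransp (X z))" for z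
  proof -
    have "ctransp (X z) = U ** ctransp (Y z) ** ctransp U" unfolding XY by (simp add: ctransp_mult matrix_mul_assoc)
    then show ?thesis using XY herm_form_transport[OF U(1)] by metis
  qed
  have holY: "(\<lambda>z. Y z $ i $ j) holomorphic_on UNIV" for i j
    using mat_deriv_entry[OF dY] by (auto simp: holomorphic_on_def field_differentiable_def intro: has_field_derivative_at_within)
  have "(\<Sum>i\<in>UNIV. Y z $ fst i $ snd i * cnj (Y 0 $ fst i $ snd i)) = (\<Sum>i\<in>UNIV. Y 0 $ fst i $ snd i * cnj (Y 0 $ fst i $ snd i))" for z
  proof (rule radial_sum_const[where f="\<lambda>i z. Y z $ fst i $ snd i"])
    fix z w :: complex assume "z \<noteq> 0" "cmod z = cmod w"
    then have "herm_form (Y z) (ctransp (Y z)) = herm_form (Y w) (ctransp (Y w))" unfolding hY by (rule radial)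
    then show "(\<Sum>i\<in>UNIV. Y z $ fst i $ snd i * cnj (Y z $ fst i $ snd i)) = (\<Sum>i\<in>UNIV. Y w $ fst i $ snd i * cnj (Y w $ fst i $ snd i))"
      unfolding herm_form_star_trace_free[OF trY] by simp
  qed (rule holY)
  moreover have "(\<Sum>i\<in>UNIV. M $ fst i $ snd i * cnj (Y 0 $ fst i $ snd i)) = M $ 2 $ 1 * cnj s" for M :: cmat2
  proof -
    have "(\<Sum>i\<in>UNIV. M $ fst i $ snd i * cnj (Y 0 $ fst i $ snd i)) = (\<Sum>i\<in>UNIV. \<Sum>j\<in>UNIV. M $ i $ j * cnj (Y 0 $ i $ j))"
      unfolding UNIV_Times_UNIV[symmetric] sum.cartesian_product by (simp add: case_prod_unfold)
    then show ?thesis by (simp add: sum_2 Y0)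
  qed
  ultimately have Y21: "Y z $ 2 $ 1 = s" for z using U(3) by (simp add: Y0)
  define p where "p z = Y z $ 1 $ 1" for z
  have Y22: "Y z $ 2 $ 2 = - p z" for z using trY[of z] by (simp add: p_def entries add_eq_0_iff2)
  have Y12: "Y z $ 1 $ 2 = - (p z)\<^sup>2 / s" for z
  proof -
    have "Y z $ 1 $ 2 * s = - (p z)\<^sup>2"
    proof -
      have "p z * - p z - Y z $ 1 $ 2 * s = 0"
        using detY[of z] unfolding det_2 Y22 Y21 p_def[symmetric] .
      then have "Y z $ 1 $ 2 * s = p z * - p z" by (simp only: right_minus_eq)
      then show ?thesis by (simp add: power2_eq_square)
    qed
    then show ?thesis using U(3) by (simp add: field_simps)
  qed
  have hp: "herm_form (Y z) (ctransp (Y z)) = of_real ((2 * (cmod (p z))\<^sup>2 + ((cmod (p z))\<^sup>2)\<^sup>2 / (cmod s)\<^sup>2 + (cmod s)\<^sup>2) / 2)" for z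
  proof -
    have "herm_form (Y z) (ctransp (Y z)) = (2 * (p z * cnj (p z)) + (Y z $ 1 $ 2) * cnj (Y z $ 1 $ 2) + s * cnj s) / 2"
      by (simp add: herm_form_nth ctransp_nth Y21 Y22 p_def[symmetric] field_simps)
    also have "\<dots> = of_real ((2 * (cmod (p z))\<^sup>2 + (cmod (Y z $ 1 $ 2))\<^sup>2 + (cmod s)\<^sup>2) / 2)"
      unfolding complex_norm_square[symmetric] by simp
    also have "(cmod (Y z $ 1 $ 2))\<^sup>2 = ((cmod (p z))\<^sup>2)\<^sup>2 / (cmod s)\<^sup>2"
      unfolding Y12 by (simp add: norm_divide norm_power power_divide)
    finally show ?thesis .
  qed
  have pr: "cmod (p z) = cmod (p w)" if "z \<noteq> 0" "cmod z = cmod w" for z w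
  proof -
    define x y a where "x = (cmod (p z))\<^sup>2" "y = (cmod (p w))\<^sup>2" "a = 1 / (cmod s)\<^sup>2"
    have xy: "x \<ge> 0" "y \<ge> 0" "a > 0" using U(3) by (simp_all add: x_y_a_def)
    have "herm_form (Y z) (ctransp (Y z)) = herm_form (Y w) (ctransp (Y w))" unfolding hY by (rule radial[OF that])
    then have "(2 * x + x\<^sup>2 * a + (cmod s)\<^sup>2) / 2 = (2 * y + y\<^sup>2 * a + (cmod s)\<^sup>2) / 2"
      unfolding hp of_real_eq_iff by (simp add: x_y_a_def)
    then have "(x - y) * (2 + a * (x + y)) = 0" by (simp add: algebra_simps power2_eq_square)
    moreover have "2 + a * (x + y) > 0" using xy by (simp add: add_pos_nonneg)
    ultimately have "x = y" by simp
    then show ?thesis by (simp add: x_y_a_def)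
  qed
  obtain c k where ck: "\<And>z. p z = c * z ^ k"
    using radial_entire_monomial[of p] holY[of 1 1] pr unfolding p_def[abs_def] by blast
  have "p 0 = 0" by (simp add: p_def Y0)
  then have "c = 0 \<or> k > 0" using ck[of 0] by (cases k) auto
  moreover have "Y z = mk2 (c * z ^ k) (- (c * z ^ k)\<^sup>2 / s) s (- (c * z ^ k))" for z
    unfolding cmat2_eq_iff mk2_nth using Y12[of z] Y21[of z] Y22[of z] ck[of z] by (simp add: p_def)
  ultimately show thesis using that[OF U(1-3), of c k] XY by simp
qed

text \<open>The modulus of \<open>\<mu>\<close> is forced by the lower left entry. Its argument is chosen so that the diagonal
entry belongs to a positive \<open>r\<close>, and the diagonal unitary matrix \<open>D\<close> then corrects the argument of
the lower left entry; the upper right entry follows from \<open>det = 0\<close>.\<close>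

lemma enneper_X_normal_form:
  assumes s: "s \<noteq> 0" and c: "c \<noteq> 0"
  obtains D and \<mu> :: complex and r :: real where "det D = 1" "D ** ctransp D = mat 1" "\<mu> \<noteq> 0" "r > 0"
    "\<And>z::complex. mk2 (c * z ^ (n+1)) (- (c * z ^ (n+1))\<^sup>2 / s) s (- (c * z ^ (n+1))) = D ** cscale \<mu> (enneper_X sp r n (\<mu> * z)) ** ctransp D"
proof -
  define e :: complex where "e = (case sp of Euc3 \<Rightarrow> 1 | Hyp3 \<Rightarrow> -1)"
  have e: "e * e = 1" "e \<noteq> 0" "cmod e = 1" by (cases sp; simp add: e_def)+
  obtain \<tau> where tau: "\<tau> ^ (n+2) = e * c / of_real (cmod c)" using exists_complex_root[of "n+2"] by (metis add_is_0 zero_neq_numeral)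
  have "cmod \<tau> ^ (n+2) = 1" using arg_cong[OF tau, of cmod] c by (simp add: norm_power norm_mult norm_divide e)
  then have ntau: "cmod \<tau> = 1" using power_eq_1_iff[of "cmod \<tau>" "n+2"] by simp
  define \<mu> where "\<mu> = of_real (cmod s) * \<tau>"
  have nmu: "cmod \<mu> = cmod s" by (simp add: \<mu>_def norm_mult ntau)
  then have mu: "\<mu> \<noteq> 0" using s by auto
  \<comment> \<open>Comparing diagonal entries, \<open>r = e c (n + 1) / \<mu>\<^sup>n\<^sup>+\<^sup>2\<close>, which is positive by the choice of \<open>\<tau>\<close>.\<close>
  define r where "r = cmod c * real (n+1) / cmod s ^ (n+2)"
  have r: "r > 0" using s c by (simp add: r_def)
  have emb: "e * \<mu> * enneper_b r n (\<mu> * z) = c * z ^ (n+1)" for z :: complex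
  proof -
    have mupow: "\<mu> ^ (n+2) * of_real (cmod c) = of_real (cmod s ^ (n+2)) * (e * c)"
      unfolding \<mu>_def power_mult_distrib tau using c by simp
    have "e * \<mu> * enneper_b r n (\<mu> * z) = e * (\<mu> ^ (n+2) * of_real (cmod c)) / of_real (cmod s ^ (n+2)) * (of_nat (n+1) / of_nat (n+1)) * z ^ (n+1)"
      unfolding enneper_b_def r_def power_mult_distrib by (simp add: mult_ac del: of_nat_add of_nat_Suc)
    also have "of_nat (n+1) / of_nat (n+1) = (1::complex)" by (rule divide_self) (simp only: of_nat_eq_0_iff)
    also have "e * (\<mu> ^ (n+2) * of_real (cmod c)) / of_real (cmod s ^ (n+2)) = (e * e) * c"
      unfolding mupow using s by simp
    finally show ?thesis using e by simp
  qed
  define d where "d = csqrt (e * \<mu> / s)"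
  have dd: "d * d = e * \<mu> / s" by (simp add: d_def flip: power2_eq_square)
  have "cmod d * cmod d = 1" using arg_cong[OF dd, of cmod] s nmu by (simp add: norm_mult norm_divide e)
  then have nd: "cmod d = 1" by (metis abs_norm_cancel abs_square_eq_1 power2_eq_square)
  then have dc: "d * cnj d = 1" by (simp add: complex_norm_square[symmetric])
  define D where "D = mk2 d 0 0 (cnj d)"
  show thesis
  proof (rule that[OF _ _ mu r])
    show "det D = 1" "D ** ctransp D = mat 1" using dc by (simp_all add: D_def entries mult.commute)
    fix z :: complex
    define b where "b = enneper_b r n (\<mu> * z)"
    have conj: "D ** mk2 x y w v ** ctransp D = mk2 x (y * (d * d)) (w * (cnj d * cnj d)) v" for x y w v
    proof -
      have "x * d * cnj d = x" "v * d * cnj d = v" using dc by (simp_all add: mult.assoc)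
      then show ?thesis by (simp add: D_def entries mult_ac)
    qed
    have emb': "e * \<mu> * b = c * z ^ (n+1)" using emb b_def by simp
    have cd: "e * \<mu> * (cnj d * cnj d) = s"
    proof -
      have "(d * d) * (cnj d * cnj d) = 1" using dc by (metis mult.assoc mult.left_commute mult.right_neutral)
      then show ?thesis unfolding dd using s by (simp add: field_simps)
    qed
    have "D ** cscale \<mu> (enneper_X sp r n (\<mu> * z)) ** ctransp D = D ** mk2 (e * \<mu> * b) (- (e * \<mu>) * b\<^sup>2) (e * \<mu>) (- (e * \<mu> * b)) ** ctransp D"
      by (rule arg_cong[of _ _ "\<lambda>M. D ** M ** ctransp D"]) (simp add: enneper_X_def e_def[symmetric] b_def[symmetric] entries)
    also have "\<dots> = mk2 (e * \<mu> * b) (- (e * \<mu>) * b\<^sup>2 * (d * d)) s (- (e * \<mu> * b))" unfolding conj cd ..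
    also have "- (e * \<mu>) * b\<^sup>2 * (d * d) = - (e * \<mu> * b)\<^sup>2 / s" unfolding dd by (simp add: power2_eq_square)
    finally show "mk2 (c * z ^ (n+1)) (- (c * z ^ (n+1))\<^sup>2 / s) s (- (c * z ^ (n+1))) = D ** cscale \<mu> (enneper_X sp r n (\<mu> * z)) ** ctransp D"
      unfolding emb' by simp
  qed
qed

section \<open>Congruence and classification\<close>

lemma ambient_isometry_Euc3:
  assumes C: "det C = 1" "ctransp C ** C = mat 1" and K: "K \<in> space_of Euc3"
  shows "ambient_isometry Euc3 (\<lambda>x. ctransp C ** x ** C + K)"
proof -
  have C': "det (ctransp C) = 1" "ctransp C ** ctransp (ctransp C) = mat 1" using C by simp_all
  have CC: "C ** ctransp C = mat 1" using unitary_inverse(2)[OF C'] by simp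
  have sp: "A ** x ** ctransp A \<in> space_of Euc3" if "ctransp A ** A = mat 1" "x \<in> space_of Euc3" for A x
  proof -
    have "trace (A ** x ** ctransp A) = trace (ctransp A ** A ** x)" by (simp add: entries algebra_simps)
    then show ?thesis using that by (simp add: hermitian_def ctransp_mult matrix_mul_assoc)
  qed
  have lin: "x + y \<in> space_of Euc3" "x - y \<in> space_of Euc3" if "x \<in> space_of Euc3" "y \<in> space_of Euc3" for x y
    using that by (auto simp: hermitian_def ctransp_add ctransp_diff trace_add trace_sub)
  have "bij_betw (\<lambda>x. ctransp C ** x ** C + K) (space_of Euc3) (space_of Euc3)"
  proof (rule bij_betw_byWitness[where f'="\<lambda>y. C ** (y - K) ** ctransp C"])
    have i: "C ** (ctransp C ** x ** C) ** ctransp C = x" "ctransp C ** (C ** x ** ctransp C) ** C = x" for x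
    proof -
      have "C ** (ctransp C ** x ** C) ** ctransp C = (C ** ctransp C) ** x ** (C ** ctransp C)" by (simp only: matrix_mul_assoc)
      then show "C ** (ctransp C ** x ** C) ** ctransp C = x" using CC by simp
      have "ctransp C ** (C ** x ** ctransp C) ** C = (ctransp C ** C) ** x ** (ctransp C ** C)" by (simp only: matrix_mul_assoc)
      then show "ctransp C ** (C ** x ** ctransp C) ** C = x" using C by simp
    qed
    show "\<forall>a\<in>space_of Euc3. C ** (ctransp C ** a ** C + K - K) ** ctransp C = a" by (simp add: i)
    show "\<forall>a'\<in>space_of Euc3. ctransp C ** (C ** (a' - K) ** ctransp C) ** C + K = a'" by (simp add: i)
    show "(\<lambda>x. ctransp C ** x ** C + K) ` space_of Euc3 \<subseteq> space_of Euc3"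
      using sp[of "ctransp C"] CC lin K by auto
    show "(\<lambda>y. C ** (y - K) ** ctransp C) ` space_of Euc3 \<subseteq> space_of Euc3"
      using sp[of C] C(2) lin K by blast
  qed
  moreover have "(ctransp C ** x ** C + K) - (ctransp C ** y ** C + K) = ctransp C ** (x - y) ** C" for x y
    by (simp add: mat_mult_diff)
  then have "ambient_dist Euc3 (ctransp C ** x ** C + K) (ctransp C ** y ** C + K) = ambient_dist Euc3 x y" for x y
    using C(1) by (simp add: herm_form_congruence)
  ultimately show ?thesis unfolding ambient_isometry_def by blast
qed

lemma ambient_isometry_Hyp3:
  assumes C: "det C = 1"
  shows "ambient_isometry Hyp3 (\<lambda>x. ctransp C ** x ** C)"
proof -
  have sp: "ctransp A ** x ** A \<in> space_of Hyp3" if "det A = 1" "x \<in> space_of Hyp3" for A x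
  proof -
    note x = that(2)
    obtain V where V: "det V = 1" "x = V ** ctransp V" using cholesky[OF x] .
    have "ctransp A ** x ** A = ctransp (ctransp V ** A) ** (ctransp V ** A)"
      unfolding V(2) by (simp add: ctransp_mult matrix_mul_assoc)
    then show ?thesis using star_mult_pos[of "ctransp V ** A"] V that by (simp add: det_mul)
  qed
  have i: "ctransp A ** (ctransp (adjugate2 A) ** x ** adjugate2 A) ** A = x" if "det A = 1" for A x
  proof -
    have "ctransp A ** (ctransp (adjugate2 A) ** x ** adjugate2 A) ** A = ctransp (adjugate2 A ** A) ** x ** (adjugate2 A ** A)"
      by (simp only: ctransp_mult matrix_mul_assoc)
    then show ?thesis using adj_inverse[OF that] by simp
  qed
  have "bij_betw (\<lambda>x. ctransp C ** x ** C) (space_of Hyp3) (space_of Hyp3)"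
  proof (rule bij_betw_byWitness[where f'="\<lambda>x. ctransp (adjugate2 C) ** x ** adjugate2 C"])
    show "\<forall>a\<in>space_of Hyp3. ctransp (adjugate2 C) ** (ctransp C ** a ** C) ** adjugate2 C = a"
      using i[of "adjugate2 C"] C by simp
    show "\<forall>a\<in>space_of Hyp3. ctransp C ** (ctransp (adjugate2 C) ** a ** adjugate2 C) ** C = a"
      using i[of C] C by simp
    show "(\<lambda>x. ctransp C ** x ** C) ` space_of Hyp3 \<subseteq> space_of Hyp3" using sp[OF C] by blast
    show "(\<lambda>x. ctransp (adjugate2 C) ** x ** adjugate2 C) ` space_of Hyp3 \<subseteq> space_of Hyp3"
      using sp[of "adjugate2 C"] C by auto
  qed
  then show ?thesis unfolding ambient_isometry_def using C by (simp add: herm_form_congruence)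
qed

text \<open>\<open>\<Psi>\<close> and \<open>U \<Theta>\<close> solve the same linear equation, so they differ by a constant right factor \<open>C\<close>, and
\<open>g - C\<^sup>* f C\<close> has derivative 0. In Euclidean space \<open>C\<close> is unitary and the constant is a
translation; in hyperbolic space it vanishes.\<close>

lemma hol_data_congruent:
  assumes g: "hol_data sp g X \<Psi>" and f: "hol_data sp f Y \<Theta>"
    and U: "det U = 1" "U ** ctransp U = mat 1"
    and XY: "\<And>z. X z = U ** Y z ** ctransp U"
  obtains T where "ambient_isometry sp T" "\<And>z. g z = T (f z)"
proof -
  note U' = unitary_inverse[OF U]
  define H where "H = complex_of_real (cmc_const sp)"
  have dPsi: "mat_deriv \<Psi> (\<lambda>z. cscale H (X z ** \<Psi> z))" using g by (simp add: hol_data_def H_def)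
  have dTheta: "mat_deriv \<Theta> (\<lambda>z. cscale H (Y z ** \<Theta> z))" using f by (simp add: hol_data_def H_def)
  have det: "det (\<Psi> z) = 1" "det (\<Theta> z) = 1" and trX: "trace (X z) = 0" for z using f g by (auto simp: hol_data_def)
  define S where "S = (\<lambda>z. U ** \<Theta> z)"
  have detS: "det (S z) = 1" for z by (simp add: S_def det_mul U det)
  have XS: "X z ** S z = U ** (Y z ** \<Theta> z)" for z
  proof -
    have "X z ** S z = U ** Y z ** (ctransp U ** U) ** \<Theta> z"
      unfolding XY S_def by (simp only: matrix_mul_assoc)
    then show ?thesis using U'(2) by (simp add: matrix_mul_assoc)
  qed
  have dS: "mat_deriv S (\<lambda>z. cscale H (X z ** S z))"
    unfolding XS unfolding S_def
    using mat_deriv_mult[OF mat_deriv_const[of U] dTheta] by (simp add: cscale_mult_right)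
  define C where "C = adjugate2 (S 0) ** \<Psi> 0"
  have C: "\<Psi> z = S z ** C" for z
  proof -
    have ac: "adjugate2 (cscale c x) = cscale c (adjugate2 x)" for c x by (simp add: entries)
    have "mat_deriv (\<lambda>z. adjugate2 (S z) ** \<Psi> z) (\<lambda>z. 0)"
      using mat_deriv_mult[OF mat_deriv_adj[OF dS] dPsi]
      by (simp add: ac adj_mult adj_trace_free[OF trX] cscale_mult_left cscale_mult_right mat_mult_uminus matrix_mul_assoc flip: cscale_add_right)
    then have "adjugate2 (S z) ** \<Psi> z = C" unfolding C_def
      by (intro has_derivative_zero_imp_const[where f="\<lambda>z. adjugate2 (S z) ** \<Psi> z"]) (simp add: mat_deriv_def)
    then have "S z ** C = S z ** (adjugate2 (S z) ** \<Psi> z)" by simp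
    then show ?thesis unfolding adj_cancel(1)[OF detS] ..
  qed
  have detC: "det C = 1" by (simp add: C_def det_mul detS det)
  define K where "K = g 0 - ctransp C ** f 0 ** C"
  have gK: "g z = ctransp C ** f z ** C + K" for z
  proof -
    define G where "G = (\<lambda>z. g z - ctransp C ** f z ** C)"
    have "(G has_derivative (\<lambda>h. 0)) (at z)" for z
    proof -
      have dg: "(g has_derivative (\<lambda>h. ctransp (\<Psi> z) ** (cscale h (X z) + ctransp (cscale h (X z))) ** \<Psi> z)) (at z)"
        and df: "(f has_derivative (\<lambda>h. ctransp (\<Theta> z) ** (cscale h (Y z) + ctransp (cscale h (Y z))) ** \<Theta> z)) (at z)"
        using f g by (simp_all add: hol_data_def)
      have "(G has_derivative (\<lambda>h. ctransp (\<Psi> z) ** (cscale h (X z) + ctransp (cscale h (X z))) ** \<Psi> z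
        - ((ctransp C ** f z) ** 0 + (ctransp C ** (ctransp (\<Theta> z) ** (cscale h (Y z) + ctransp (cscale h (Y z))) ** \<Theta> z) + 0 ** f z) ** C))) (at z)"
        unfolding G_def by (intro has_derivative_diff dg has_derivative_mat_mult has_derivative_const df)
      moreover have "ctransp (\<Psi> z) ** (cscale h (X z) + ctransp (cscale h (X z))) ** \<Psi> z
         = ctransp C ** (ctransp (\<Theta> z) ** (cscale h (Y z) + ctransp (cscale h (Y z))) ** \<Theta> z) ** C" for h
      proof -
        have "ctransp U ** (cscale h (X z) + ctransp (cscale h (X z))) ** U
           = (ctransp U ** U) ** (cscale h (Y z) + ctransp (cscale h (Y z))) ** (ctransp U ** U)"
          unfolding XY by (simp add: ctransp_cscale ctransp_mult mat_distrib cscale_mult_left cscale_mult_right matrix_mul_assoc)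
        then have e: "ctransp U ** (cscale h (X z) + ctransp (cscale h (X z))) ** U
           = cscale h (Y z) + ctransp (cscale h (Y z))" using U'(2) by simp
        have "ctransp (\<Psi> z) ** (cscale h (X z) + ctransp (cscale h (X z))) ** \<Psi> z
          = ctransp C ** (ctransp (\<Theta> z) ** (ctransp U ** (cscale h (X z) + ctransp (cscale h (X z))) ** U) ** \<Theta> z) ** C"
          unfolding C S_def by (simp only: ctransp_mult matrix_mul_assoc)
        then show ?thesis unfolding e .
      qed
      ultimately show ?thesis by simp
    qed
    then have "G z = G 0" by (rule has_derivative_zero_imp_const)
    then show ?thesis by (simp add: G_def K_def algebra_simps)
  qed
  have base: "base_pt sp (g z) = ctransp C ** base_pt sp (f z) ** C" for z
  proof -
    have "base_pt sp (g z) = ctransp C ** (ctransp (\<Theta> z) ** (ctransp U ** U) ** \<Theta> z) ** C"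
      using g unfolding hol_data_def by (simp add: C S_def ctransp_mult matrix_mul_assoc)
    then show ?thesis using f U'(2) unfolding hol_data_def by simp
  qed
  show thesis
  proof (cases sp)
    case Euc3
    have CC: "ctransp C ** C = mat 1" using base[of 0] Euc3 by simp
    have "K \<in> space_of Euc3"
    proof -
      have fg: "f 0 \<in> space_of Euc3" "g 0 \<in> space_of Euc3" using f g Euc3 by (auto simp: hol_data_def)
      have C': "det (ctransp C) = 1" "ctransp C ** ctransp (ctransp C) = mat 1" using detC CC by simp_all
      have "C ** ctransp C = mat 1" using unitary_inverse(2)[OF C'] by simp
      moreover have "trace (ctransp C ** f 0 ** C) = trace (C ** ctransp C ** f 0)" by (simp add: entries algebra_simps)
      ultimately show ?thesis using fg by (simp add: K_def hermitian_def ctransp_diff ctransp_mult trace_sub matrix_mul_assoc)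
    qed
    from ambient_isometry_Euc3[OF detC CC this] show ?thesis using that[of "\<lambda>x. ctransp C ** x ** C + K"] gK Euc3 by simp
  next
    case Hyp3
    have "g z = ctransp C ** f z ** C" for z using base[of z] Hyp3 by simp
    then show ?thesis using that[of "\<lambda>x. ctransp C ** x ** C"] ambient_isometry_Hyp3[OF detC] Hyp3 by simp
  qed
qed

text \<open>Constant data pull back under \<open>exp\<close> to a multiple of one nilpotent matrix, which equals its own
derivative; the Hopf coefficient vanishes because this matrix is orthogonal to the normal.\<close>

lemma hol_data_const_flat:
  assumes D: "hol_data sp g (\<lambda>z. M) \<Psi>"
  shows "flat sp (g \<circ> exp)"
proof -
  define Y where "Y = (\<lambda>z. cscale (exp z) M)"
  have E: "hol_data sp (g \<circ> exp) Y (\<lambda>z. \<Psi> (exp z))"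
    using hol_data_compose[OF D, of exp exp exp] DERIV_exp by (simp add: Y_def comp_def)
  have Y: "mat_deriv Y Y" unfolding Y_def using mat_deriv_cscale[OF DERIV_exp mat_deriv_const[of M]] by simp
  have d: "det (Y z) = 0" "trace (Y z) = 0" for z using E by (auto simp: hol_data_def)
  have "herm_form (Y z) (cscale c (ctransp (Y z) ** Y z) - mat 1) = 0" for c z
  proof -
    have "herm_form (Y z) (ctransp (Y z) ** Y z) = 0"
      by (rule herm_form_mult_left_degenerate[OF d(1)])
    moreover have "herm_form (Y z) (mat 1) = 0" using d herm_form_mat1[of "Y z"] by (simp add: herm_form_sym)
    ultimately show ?thesis by (simp add: herm_form_bilin)
  qed
  then have "hopf_coeff Y Y z = 0" for z by (simp add: hopf_coeff_def)
  then show ?thesis using hol_data_hopf[OF E Y] unfolding flat_def by metis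
qed

text \<open>Pulling the metric back to the plane shows that the data have radial norm, and non-flatness
excludes constant data, so the normal form is that of the data of an Enneper surface.\<close>

lemma enneper_surface_classification:
  assumes "enneper_surface sp g"
  shows "\<exists>r>0. \<exists>n T \<phi>. ambient_isometry sp T \<and> \<phi> holomorphic_on UNIV \<and> bij \<phi> \<and>
         (\<forall>z. g z = T (enneper_lwr sp r n (\<phi> z)))"
proof -
  have g: "conformal_immersion sp g" and F: "conformal_immersion sp (g \<circ> exp)" and cmc: "has_ambient_cmc sp (g \<circ> exp)"
    and nonflat: "\<not> flat sp (g \<circ> exp)"
    using assms by (auto simp: enneper_surface_def intrinsic_surface_of_revolution_def)
  obtain m :: "real \<Rightarrow> real" where m: "\<And>w. metric_coeff (g \<circ> exp) w = of_real ((m (cmod (exp w)))\<^sup>2 * (cmod (exp w))\<^sup>2)"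
    using assms by (auto simp: enneper_surface_def intrinsic_surface_of_revolution_def)
  obtain A' where A': "mat_deriv (\<lambda>z. adjugate2 (base_pt sp (g z)) ** diff_z g z) A'" using descend_exp[OF g F cmc] .
  obtain X \<Psi> where D: "hol_data sp g X \<Psi>" using hol_data_exists[OF g A'] .
  have E: "hol_data sp (g \<circ> exp) (\<lambda>z. cscale (exp z) (X (exp z))) (\<lambda>z. \<Psi> (exp z))"
    using hol_data_compose[OF D, of exp exp exp] DERIV_exp by (simp add: comp_def)
  have h: "herm_form (X z) (ctransp (X z)) = of_real ((m (cmod z))\<^sup>2 / 2)" if z: "z \<noteq> 0" for z
  proof -
    obtain w where w: "z = exp w" using z by (metis exp_Ln)
    have "metric_coeff (g \<circ> exp) w = 2 * (exp w * cnj (exp w) * herm_form (X z) (ctransp (X z)))"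
      unfolding hol_data_metric[OF E] ctransp_cscale w by (simp add: herm_form_bilin)
    then have "of_real ((m (cmod z))\<^sup>2 * (cmod z)\<^sup>2) = 2 * (of_real ((cmod z)\<^sup>2) * herm_form (X z) (ctransp (X z)))"
      unfolding m w[symmetric] complex_norm_square[symmetric] .
    from this[symmetric]
    have "of_real ((cmod z)\<^sup>2) * (2 * herm_form (X z) (ctransp (X z))) = of_real ((cmod z)\<^sup>2) * of_real ((m (cmod z))\<^sup>2)"
      by (simp only: of_real_mult mult_ac)
    moreover have "complex_of_real ((cmod z)\<^sup>2) \<noteq> 0" using z by simp
    ultimately have "2 * herm_form (X z) (ctransp (X z)) = of_real ((m (cmod z))\<^sup>2)"
      by (simp only: mult_cancel_left simp_thms)
    then show ?thesis by (simp add: mult.commute)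
  qed
  obtain X' where X': "mat_deriv X X'" using D by (auto simp: hol_data_def)
  have dt: "det (X z) = 0" "trace (X z) = 0" "X z \<noteq> 0" for z using D by (auto simp: hol_data_def)
  have "herm_form (X z) (ctransp (X z)) = herm_form (X w) (ctransp (X w))" if "z \<noteq> 0" "cmod z = cmod w" for z w
  proof -
    have "w \<noteq> 0" using that by auto
    then show ?thesis using h[of w] unfolding h[OF that(1)] that(2) by simp
  qed
  from radial_nilpotent_normal_form[OF X' dt this] obtain U s c k where
    U: "det U = 1" "U ** ctransp U = mat 1" "s \<noteq> 0" "c = 0 \<or> k > 0"
    and XU: "\<And>z::complex. X z = U ** mk2 (c * z ^ k) (- (c * z ^ k)\<^sup>2 / s) s (- (c * z ^ k)) ** ctransp U" by metis
  have c: "c \<noteq> 0"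
  proof
    assume "c = 0"
    then have "X = (\<lambda>z. U ** mk2 0 0 s 0 ** ctransp U)" using XU by (simp add: fun_eq_iff)
    then show False using hol_data_const_flat[of sp g] D nonflat by metis
  qed
  then obtain n where k: "k = n + 1" using U(4) by (metis Suc_eq_plus1 gr0_conv_Suc)
  obtain V and \<mu> :: complex and r :: real where V: "det V = 1" "V ** ctransp V = mat 1" "\<mu> \<noteq> 0" "r > 0"
    "\<And>z::complex. mk2 (c * z ^ (n+1)) (- (c * z ^ (n+1))\<^sup>2 / s) s (- (c * z ^ (n+1))) = V ** cscale \<mu> (enneper_X sp r n (\<mu> * z)) ** ctransp V"
    by (rule enneper_X_normal_form[OF U(3) c, of n sp]) blast
  have XV: "X z = (U ** V) ** cscale \<mu> (enneper_X sp r n (\<mu> * z)) ** ctransp (U ** V)" for z :: complex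
    unfolding XU k V(5) by (simp add: ctransp_mult matrix_mul_assoc)
  obtain \<Theta> where E: "hol_data sp (enneper_lwr sp r n) (enneper_X sp r n) \<Theta>" using hol_data_enneper .
  have lin: "((\<lambda>z. \<mu> * z) has_field_derivative \<mu>) (at z)" for z by (auto intro!: derivative_eq_intros)
  obtain T where T: "ambient_isometry sp T" "\<And>z::complex. g z = T (enneper_lwr sp r n (\<mu> * z))"
    by (rule hol_data_congruent[OF D hol_data_compose[OF E lin V(3) DERIV_const] unitary_mult[OF U(1,2) V(1,2)] XV]) blast
  moreover have "(\<lambda>z. \<mu> * z) holomorphic_on UNIV" by (intro holomorphic_intros)
  moreover have "bij (\<lambda>z. \<mu> * z)"
    by (rule bij_betw_byWitness[where f'="\<lambda>z. z / \<mu>"]) (use V(3) in auto)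
  ultimately show ?thesis using V(4) by blast
qed

theorem theorem6p5:
  shows "(\<forall>sp. \<forall>r>0. \<forall>n. enneper_surface sp (enneper_lwr sp r n)) \<and>
    (\<forall>sp g. enneper_surface sp g \<longrightarrow>
      (\<exists>r>0. \<exists>n T \<phi>. ambient_isometry sp T \<and> \<phi> holomorphic_on UNIV \<and> bij \<phi> \<and>
         (\<forall>z. g z = T (enneper_lwr sp r n (\<phi> z)))))"
  using enneper_surface_enneper_lwr enneper_surface_classification by blast

end
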